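(* Let $\gamma\in(0,1/2)\setminus\mathbb Q$. Then $t_\gamma^{\mathrm B}=t_\gamma$, and the kneading map of $P_{t_\gamma^{\mathrm B}}$ is $Q_\gamma$.
   Context: $P_t(x)=x^2+t$. For $\gamma\in(0,1/2)\setminus\mathbb Q$ put $\omega_\gamma=\gamma/(1-\gamma)$ and $Q_\gamma(k)=\lfloor k\omega_\gamma\rfloor-\lfloor(k-1)\omega_\gamma\rfloor$ for $k\ge1$. Kneading map of a unimodal map $f:I\to I$ with turning point $c$ a maximum (continuous, strictly increasing to the left of $c$ and strictly decreasing to the right, $f(\partial I)\subset\partial I$, $c_n=f^n(c)$, $c_2<c<c_1$, $c_2<c_3$): with $[a,b]$ denoting the closed interval with endpoints $a,b$ in either order, let $D_1=[c,c_1]$ and, for $n\ge2$, $D_n=f(D_{n-1})$ if $c\notin D_{n-1}$, $D_n=[c_n,c_1]$ if $c\in D_{n-1}$. An integer $n\ge1$ is a cutting time if $c\in D_n$; cutting times are enumerated as $1=S_0<S_1=2<S_2<\cdots$, consecutive differences of cutting times are cutting times, and the kneading map $Q:\mathbb N\to\mathbb N_0$ is defined by $S_k-S_{k-1}=S_{Q(k)}$. For real $t\in[-2,-1)$, $P_t$ has a minimum at its turning point $0$; it is regarded as a unimodal map on $[-\beta_t,\beta_t]$, $\beta_t=\frac{1+\sqrt{1-4t}}2$, and its kneading map is by definition that of its maximum-type affine conjugate $x\mapsto -P_t(-x)$. The parameter $t_\gamma$: the unique parameter $t\in[-2,-1]$ such that $P_t$ has kneading map $Q_\gamma$ (existence follows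 from the known fullness of the real quadratic family and admissibility of $Q_\gamma$; uniqueness from known real quadratic rigidity). The parameter $t_\gamma^{\mathrm B}$ (Blé): let $M$ be the Mandelbrot set and, for $\theta\in\mathbb R/\mathbb Z$, let $R_M(\theta)$ be the external parameter ray of angle $\theta$, i.e. the preimage of $\{re^{2\pi i\theta}:r>1\}$ under the conformal isomorphism $\mathbb C\setminus M\to\mathbb C\setminus\overline{\mathbb D}$ tangent to the identity at infinity. Let $\theta_\gamma$ be the external argument of the point of the main cardioid with internal argument $\gamma$; in base $2$ it is given by $$\theta_\gamma=\sum_{n\ge1}\frac{s_\gamma(n)}{2^n},\qquad s_\gamma(n)=\lfloor (n+1)\gamma\rfloor-\lfloor n\gamma\rfloor .$$ Let $T(\theta)=\frac12+\frac\theta4$. By a theorem of Blé the ray $R_M(T(\theta_\gamma))$ lands at a real parameter, and $t_\gamma^{\mathrm B}$ denotes this landing point. *)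

theory Defs
  imports "HOL-Complex_Analysis.Complex_Analysis"
begin

definition quad :: "'a::comm_ring_1 \<Rightarrow> 'a \<Rightarrow> 'a" where
  "quad t x = x ^ 2 + t"


section \<open>Kneading maps of unimodal maps\<close>

definition unimodal :: "real \<Rightarrow> real \<Rightarrow> (real \<Rightarrow> real) \<Rightarrow> real \<Rightarrow> bool" where
  "unimodal a b f c \<longleftrightarrow>
     a < c \<and> c < b \<and>
     f ` {a..b} \<subseteq> {a..b} \<and> f ` {a, b} \<subseteq> {a, b} \<and>
     continuous_on {a..b} f \<and>
     strict_mono_on {a..c} f \<and> strict_antimono_on {c..b} f \<and>
     (f ^^ 2) c < c \<and> c < f c \<and> (f ^^ 2) c < (f ^^ 3) c"

text \<open>The value at index 0 is a dummy; the sequence of intervals starts at index 1.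
  On the reals, \<^const>\<open>closed_segment\<close> takes its endpoints in either order.\<close>

fun D :: "(real \<Rightarrow> real) \<Rightarrow> real \<Rightarrow> nat \<Rightarrow> real set" where
  "D f c 0 = {}"
| "D f c (Suc 0) = closed_segment c (f c)"
| "D f c (Suc (Suc n)) =
     (if c \<notin> D f c (Suc n) then f ` D f c (Suc n)
      else closed_segment ((f ^^ Suc (Suc n)) c) (f c))"

definition cutting_times :: "(real \<Rightarrow> real) \<Rightarrow> real \<Rightarrow> nat set" where
  "cutting_times f c = {n. n \<ge> 1 \<and> c \<in> D f c n}"

definition cutting_time :: "(real \<Rightarrow> real) \<Rightarrow> real \<Rightarrow> nat \<Rightarrow> nat" where
  "cutting_time f c = enumerate (cutting_times f c)"

text \<open>A kneading map is indexed by \<open>k \<ge> 1\<close>; the value \<open>Q 0\<close> is irrelevant. Since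
  the cutting times are strictly increasing, the values \<open>Q k\<close> with \<open>k \<ge> 1\<close> are
  uniquely determined by this relation.\<close>

definition has_kneading_map ::
    "real \<Rightarrow> real \<Rightarrow> (real \<Rightarrow> real) \<Rightarrow> real \<Rightarrow> (nat \<Rightarrow> nat) \<Rightarrow> bool" where
  "has_kneading_map a b f c Q \<longleftrightarrow>
     unimodal a b f c \<and> infinite (cutting_times f c) \<and>
     (\<forall>k\<ge>1. cutting_time f c k - cutting_time f c (k - 1) = cutting_time f c (Q k))"

definition beta :: "real \<Rightarrow> real" where
  "beta t = (1 + sqrt (1 - 4 * t)) / 2"

text \<open>The polynomial has a minimum at 0, so its kneading map is that of the affine
  conjugate under \<open>x \<mapsto> -x\<close>, which has a maximum at 0.\<close>

definition quad_has_kneading_map :: "real \<Rightarrow> (nat \<Rightarrow> nat) \<Rightarrow> bool" where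
  "quad_has_kneading_map t Q \<longleftrightarrow>
     t \<in> {-2..<-1} \<and> has_kneading_map (- beta t) (beta t) (\<lambda>x. - quad t (- x)) 0 Q"


section \<open>The kneading maps \<open>Q\<^sub>\<gamma>\<close> and the parameter \<open>t\<^sub>\<gamma>\<close>\<close>

definition omega :: "real \<Rightarrow> real" where
  "omega \<gamma> = \<gamma> / (1 - \<gamma>)"

definition Q_rot :: "real \<Rightarrow> nat \<Rightarrow> nat" where
  "Q_rot \<gamma> k = nat (\<lfloor>real k * omega \<gamma>\<rfloor> - \<lfloor>(real k - 1) * omega \<gamma>\<rfloor>)"

definition t_rot :: "real \<Rightarrow> real" where
  "t_rot \<gamma> = (THE t. t \<in> {-2..-1} \<and> quad_has_kneading_map t (Q_rot \<gamma>))"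


section \<open>External parameter rays and the parameter of Ble\<close>

definition mandelbrot :: "complex set" where
  "mandelbrot = {t. bounded (range (\<lambda>n. (quad t ^^ n) 0))}"

text \<open>The conformal isomorphism is unique as a map on the complement of the Mandelbrot set;
  the choice below only concerns its irrelevant values on the Mandelbrot set itself.\<close>

definition riemann_map :: "complex \<Rightarrow> complex" where
  "riemann_map = (SOME \<Phi>.
     \<Phi> holomorphic_on (- mandelbrot) \<and>
     bij_betw \<Phi> (- mandelbrot) (- cball 0 1) \<and>
     ((\<lambda>z. \<Phi> z / z) \<longlongrightarrow> 1) at_infinity)"

text \<open>The ray of angle \<open>\<theta>\<close> is the image of \<open>{1<..}\<close> under \<open>parameter_ray \<theta>\<close>, which
  parametrises it by the modulus \<open>r\<close> of the image under the conformal isomorphism.\<close>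

definition parameter_ray :: "real \<Rightarrow> real \<Rightarrow> complex" where
  "parameter_ray \<theta> r =
     inv_into (- mandelbrot) riemann_map (of_real r * exp (2 * of_real pi * \<i> * of_real \<theta>))"

definition ray_lands_at :: "real \<Rightarrow> complex \<Rightarrow> bool" where
  "ray_lands_at \<theta> z \<longleftrightarrow> (parameter_ray \<theta> \<longlongrightarrow> z) (at_right 1)"

definition s_rot :: "real \<Rightarrow> nat \<Rightarrow> int" where
  "s_rot \<gamma> n = \<lfloor>real (n + 1) * \<gamma>\<rfloor> - \<lfloor>real n * \<gamma>\<rfloor>"

text \<open>The external argument of the point of the main cardioid with internal argument \<open>\<gamma>\<close>,
  given by its binary expansion, whose digits are indexed from 1.\<close>

definition theta_rot :: "real \<Rightarrow> real" where
  "theta_rot \<gamma> = (\<Sum>n. real_of_int (s_rot \<gamma> (Suc n)) / 2 ^ Suc n)"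

definition T_ble :: "real \<Rightarrow> real" where
  "T_ble \<theta> = 1 / 2 + \<theta> / 4"

definition t_ble :: "real \<Rightarrow> real" where
  "t_ble \<gamma> = (THE t. ray_lands_at (T_ble (theta_rot \<gamma>)) (complex_of_real t))"

end

theory Submission
  imports Defs
begin

text \<open>Each index \<open>n\<close> carries a type read off the rotation by \<open>\<gamma>\<close>: orbit values at indices of type \<open>Q1\<close>
  should lie in the right half plane, those of type \<open>Q3\<close> in the left one. On the ray of angle
  \<open>T_ble (theta_rot \<gamma>)\<close> this holds for large orbit values by the Boettcher coordinate, and it persists
  along the whole ray because a value near the imaginary axis is mapped into the left half plane and
  then out of it, which no admissible pair of types allows.

  Let \<open>t\<close> be a real parameter with kneading map \<open>Q_rot \<gamma>\<close>; its critical orbit has the same types. For a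
  closest return \<open>k\<close> of the rotation, consider the component \<open>Om\<close> around \<open>t\<close> of the parameters whose orbit
  value at time \<open>k + 2\<close> lies in a large disc almost touching the imaginary axis. Pulling back
  along the orbit, with the itineraries excluding critical values, shows that on \<open>Om\<close> this orbit value
  takes the centre of the disc exactly at two complex conjugate points, whose Boettcher positions are
  explicit. A two-zero Schwarz estimate then controls \<open>Om\<close>, and by a normal family argument its part over
  a smaller disc shrinks to \<open>t\<close> as \<open>k\<close> grows. The end of the ray lies in this part, so the ray lands
  at \<open>t\<close>. Uniqueness of limits makes \<open>t\<close> unique; existence follows from the intermediate value theorem
  applied to iterated real pullbacks.\<close>

section \<open>Proper holomorphic maps\<close>

text \<open>The critical point, index 0, sits at \<open>x 0 = 1 - \<gamma>\<close> and so has type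
  \<open>Q2\<close>; this is why no half plane is prescribed at that type. When the centre of the
  disc is pulled back from time \<open>k + 2\<close>, type \<open>Q3\<close> selects the root at
  time \<open>k + 1\<close>, but at time \<open>k\<close>, of type \<open>Q2\<close>, both square
  roots are admissible. Complex conjugation of the parameter exchanges the two choices, hence the
  two conjugate centres; all earlier roots come from continuation over \<open>Om\<close>. A value in
  the smaller disc bounds only the product of the pseudohyperbolic distances to the two centres, so
  a square root enters the estimate, but the bound depends only on the radii of the two discs and is
  the same for all closest returns. The shrinking is forced by escape: a centre lies outside the
  Mandelbrot set, so its orbit tends to infinity, whereas on \<open>Om\<close> the value at time
  \<open>k + 2\<close> is bounded. Hence each centre belongs to \<open>Om\<close> for only finitely
  many closest returns, which excludes nonconstant limits.\<close>

lemma critical_point_imp_not_inj: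
  fixes f :: "complex \<Rightarrow> complex"
  assumes holf: "f holomorphic_on S" and S: "open S" "connected S" and x: "x \<in> S"
    and nc: "\<not> f constant_on S" and d0: "deriv f x = 0" and fx: "f x \<noteq> 0"
    and U: "open U" "x \<in> U" "U \<subseteq> S"
  obtains y0 y1 where "y0 \<in> U" "y1 \<in> U" "y0 \<noteq> y1" "f y0 = f y1" "cmod (f y0) < cmod (f x)"
proof -
  have "\<exists>n>0. (deriv ^^ n) f x \<noteq> 0"
  proof (rule ccontr)
    assume "\<not> ?thesis"
    then have *: "\<And>n. 0 < n \<Longrightarrow> (deriv ^^ n) f x = 0" by blast
    have "f w = f x" if "w \<in> S" for w
      by (rule holomorphic_fun_eq_const_on_connected[OF holf S(1) S(2) * x that])
    then show False using nc unfolding constant_on_def by blast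
  qed
  then obtain n0 where n0: "n0 > 0 \<and> (deriv ^^ n0) f x \<noteq> 0" by blast
  \<comment> \<open>The order of vanishing of \<open>f - f x\<close> at \<open>x\<close>: finite
    because \<open>f\<close> is not constant, at least 2 because the derivative vanishes.\<close>
  define n where [abs_def]: "n = (LEAST n. n > 0 \<and> (deriv ^^ n) f x \<noteq> 0)"
  have n_ne: "n > 0" "(deriv ^^ n) f x \<noteq> 0"
    using def_LeastI [OF n_def n0] by auto
  have n_min: "\<And>k. 0 < k \<Longrightarrow> k < n \<Longrightarrow> (deriv ^^ k) f x = 0"
    using def_Least_le [OF n_def] not_le by auto
  obtain g d where "0 < d" and holg: "g holomorphic_on ball x d"
     and fd: "\<And>w. w \<in> ball x d \<Longrightarrow> f w - f x = ((w - x) * g w) ^ n"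
     and gnz: "\<And>w. w \<in> ball x d \<Longrightarrow> g w \<noteq> 0"
    by (rule holomorphic_factor_order_of_zero_strong [OF holf S(1) x n_ne n_min]) (assumption+, blast)
  have n1: "n \<noteq> 1" using n_ne d0 by auto
  obtain r where r: "r > 0" "ball x r \<subseteq> U" using U openE by blast
  define m where "m = min r d"
  have m: "m > 0" "ball x m \<subseteq> ball x d" "ball x m \<subseteq> U" using r \<open>d > 0\<close> by (auto simp: m_def)
  have holgw: "(\<lambda>w. (w - x) * g w) holomorphic_on ball x m"
    by (intro holomorphic_intros holomorphic_on_subset[OF holg m(2)])
  have gd: "(g has_field_derivative deriv g x) (at x)"
    using holg \<open>d>0\<close> by (simp add: holomorphic_derivI)
  have "((\<lambda>w. (w - x) * g w) has_field_derivative ((x - x) * deriv g x + g x)) (at x)"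
    by (rule gd derivative_eq_intros | simp)+
  then have dn: "deriv (\<lambda>w. (w - x) * g w) x \<noteq> 0"
    using \<open>d>0\<close> by (simp add: DERIV_imp_deriv gnz)
  obtain T where T: "x \<in> T" "open T" "T \<subseteq> ball x m" "open ((\<lambda>w. (w - x) * g w) ` T)"
    using has_complex_derivative_locally_invertible [OF holgw, of x] m dn by force
  define I where "I = (\<lambda>w. (w - x) * g w) ` T"
  have "0 \<in> I" using T by (force simp: I_def)
  then obtain e where e: "e > 0" "cball 0 e \<subseteq> I"
    using T(4) open_contains_cball unfolding I_def by blast
  \<comment> \<open>An \<open>n\<close>-th root of \<open>- f x\<close>: at the point with local
    coordinate \<open>s * w0\<close> the value is \<open>(1 - s ^ n) * f x\<close>, so the modulus
    drops, and rotation by \<open>\<zeta>\<close> gives a second point with the same value.\<close>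
  define w0 where "w0 = exp (Ln (- f x) / of_nat n)"
  have w0: "w0 ^ n = - f x"
    using fx n_ne by (simp add: w0_def exp_of_nat_mult[symmetric] )
  have w0n: "w0 \<noteq> 0" by (simp add: w0_def)
  define s where "s = min (1/2) (e / cmod w0)"
  have s: "0 < s" "s \<le> 1/2" "s * cmod w0 \<le> e" using e w0n by (auto simp: s_def field_simps min_def)
  define \<zeta> where "\<zeta> = exp(2 * of_real pi * \<i> * (1/of_nat n))"
  have \<zeta>: "\<zeta> ^ n = 1" "\<zeta> \<noteq> 1" "cmod \<zeta> = 1"
    using complex_root_unity [of n 1] complex_root_unity_eq_1 [of n 1] n_ne n1
    by (auto simp: \<zeta>_def)
  have "of_real s * w0 \<in> I" "of_real s * w0 * \<zeta> \<in> I"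
    using e s \<zeta> by (auto simp: norm_mult intro!: subsetD[OF e(2)])
  then obtain y0 y1 where y: "y0 \<in> T" "(y0 - x) * g y0 = of_real s * w0"
      "y1 \<in> T" "(y1 - x) * g y1 = of_real s * w0 * \<zeta>" by (auto simp: I_def)
  have f0: "f y0 = f x + (of_real s * w0)^n" and f1: "f y1 = f x + (of_real s * w0 * \<zeta>)^n"
    using fd[of y0] fd[of y1] y T m by (auto simp: algebra_simps)
  have eq: "f y0 = f y1" by (simp add: f0 f1 power_mult_distrib \<zeta>)
  have "f y0 = of_real (1 - s^n) * f x" by (simp add: f0 power_mult_distrib w0 algebra_simps)
  then have "cmod (f y0) = \<bar>1 - s^n\<bar> * cmod (f x)" by (metis norm_mult norm_of_real)
  moreover have "0 < s^n" "s^n < 1" using s n_ne by (auto simp: power_less_one_iff)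
  ultimately have lt: "cmod (f y0) < cmod (f x)" using fx by simp
  have "y0 \<noteq> y1" using y \<zeta> w0n s by auto
  then show thesis using that[of y0 y1] y T m eq lt by blast
qed

text \<open>Non-injectivity is pushed down to smaller moduli by the open mapping theorem.\<close>

lemma proper_simple_zero_imp_bij:
  fixes f :: "complex \<Rightarrow> complex"
  assumes W: "open W" and holf: "f holomorphic_on W" and into: "\<And>x. x \<in> W \<Longrightarrow> cmod (f x) < 1"
    and proper: "\<And>s. s < 1 \<Longrightarrow> compact {x \<in> W. cmod (f x) \<le> s}"
    and x0: "x0 \<in> W" "f x0 = 0" "deriv f x0 \<noteq> 0"
    and uniq: "\<And>x. x \<in> W \<Longrightarrow> f x = 0 \<Longrightarrow> x = x0"
  shows "bij_betw f W (ball 0 1)"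
proof -
  define C where "C x = connected_component_set W x" for x
  have C: "open (C x)" "connected (C x)" "C x \<subseteq> W" for x
    using W by (auto simp: C_def open_connected_component connected_component_subset)
  have xC: "x \<in> C x" if "x \<in> W" for x using that by (simp add: C_def connected_component_refl_eq)
  have contf: "continuous_on W f" using holf holomorphic_on_imp_continuous_on by blast
  have nc: "\<not> f constant_on C x" if x: "x \<in> W" for x
  proof
    assume "f constant_on C x"
    then have fc: "\<And>y. y \<in> C x \<Longrightarrow> f y = f x" using xC[OF x] unfolding constant_on_def by metis
    let ?K = "{y \<in> W. cmod (f y) \<le> cmod (f x)}"
    have K: "compact ?K" using proper into[OF x] by blast
    have CK: "C x \<subseteq> ?K" using fc C(3) by force
    have "closedin (top_of_set W) (C x)" by (simp add: C_def closedin_connected_component)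
    then have "closedin (top_of_set ?K) (C x)"
      using CK by (rule closedin_subset_trans) auto
    then have "compact (C x)" using K closedin_compact by blast
    then show False using C(1)[of x] xC[OF x] compact_open by blast
  qed
  have omap: "open (f ` U)" if "open U" "x \<in> W" "U \<subseteq> C x" for U x
    using open_mapping_thm[OF holomorphic_on_subset[OF holf C(3)] C(1) C(2) that(1) that(3) nc[OF that(2)]] .
  have inj: "inj_on f W"
  proof (rule ccontr)
    define Q where "Q = {(x,y) \<in> W \<times> W. f x = f y \<and> x \<noteq> y}"
    assume "\<not> inj_on f W"
    then have Qne: "Q \<noteq> {}" by (auto simp: Q_def inj_on_def)
    \<comment> \<open>The infimum of the moduli at which injectivity fails. Properness makes a
      minimising sequence of pairs converge inside \<open>W\<close>, either to two distinct points
      or to a single critical point.\<close>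
    define m where "m = Inf ((\<lambda>p. cmod (f (fst p))) ` Q)"
    have mle: "m \<le> cmod (f (fst p))" if "p \<in> Q" for p
      unfolding m_def by (rule cInf_lower) (use that in \<open>auto intro: bdd_belowI[of _ 0]\<close>)
    have m0: "m \<ge> 0" unfolding m_def by (rule cInf_greatest) (use Qne in auto)
    have ex: "\<exists>p. p \<in> Q \<and> cmod (f (fst p)) < m + e" if "e > 0" for e
      using cInf_lessD[of "(\<lambda>p. cmod (f (fst p))) ` Q" "m + e"] Qne that unfolding m_def by auto
    obtain p0 where p0: "p0 \<in> Q" using Qne by blast
    have m1: "m < 1" using mle[OF p0] into[of "fst p0"] p0 by (auto simp: Q_def)
    have "\<forall>n. \<exists>p. p \<in> Q \<and> cmod (f (fst p)) < m + ((1-m)/2) / (real n + 1)"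
      using ex m1 by (auto intro!: ex divide_pos_pos)
    then obtain P where P: "\<And>n. P n \<in> Q" "\<And>n. cmod (f (fst (P n))) < m + ((1-m)/2) / (real n + 1)"
      by metis
    let ?K = "{y \<in> W. cmod (f y) \<le> (1+m)/2}"
    have K: "compact ?K" using proper[of "(1+m)/2"] m1 by auto
    have PK: "P n \<in> ?K \<times> ?K" for n
    proof -
      have "((1-m)/2) / (real n + 1) \<le> (1-m)/2" using m1 mult_right_mono[of m 1 "real n"] by (simp add: field_simps)
      then have "cmod (f (fst (P n))) \<le> m + (1-m)/2" using P(2)[of n] add_left_mono less_le_trans less_imp_le by meson
      then have "cmod (f (fst (P n))) \<le> (1+m)/2" by (simp add: field_simps)
      then show ?thesis using P(1)[of n] by (auto simp: Q_def case_prod_beta mem_Times_iff)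
    qed
    obtain l r where l: "l \<in> ?K \<times> ?K" and r: "strict_mono (r::nat\<Rightarrow>nat)" and lim: "(P \<circ> r) \<longlonglongrightarrow> l"
      using compact_Times[OF K K] PK unfolding compact_def by blast
    obtain x y where xy: "l = (x,y)" by force
    have xW: "x \<in> W" and yW: "y \<in> W" using l xy by auto
    have lx: "(\<lambda>n. fst (P (r n))) \<longlonglongrightarrow> x" and ly: "(\<lambda>n. snd (P (r n))) \<longlonglongrightarrow> y"
      using tendsto_fst[OF lim] tendsto_snd[OF lim] xy by (auto simp: o_def)
    have cx: "isCont f x" and cy: "isCont f y"
      using contf W xW yW continuous_on_eq_continuous_at by blast+
    have fx: "(\<lambda>n. f (fst (P (r n)))) \<longlonglongrightarrow> f x" and fy: "(\<lambda>n. f (snd (P (r n)))) \<longlonglongrightarrow> f y"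
      using isCont_tendsto_compose[OF cx lx] isCont_tendsto_compose[OF cy ly] by auto
    have "f (fst (P n)) = f (snd (P n))" for n using P(1)[of n] by (auto simp: Q_def case_prod_beta)
    then have fxy: "f x = f y" using fx fy LIMSEQ_unique by simp
    have "(\<lambda>n. m + ((1-m)/2) / (real n + 1)) \<longlonglongrightarrow> m" by real_asymp
    then have "(\<lambda>n. m + ((1-m)/2) / (real (r n) + 1)) \<longlonglongrightarrow> m"
      using LIMSEQ_subseq_LIMSEQ[OF _ r] by (auto simp: o_def)
    then have lm: "(\<lambda>n. m + ((1-m)/2) / (real (r n) + 1)) \<longlonglongrightarrow> m" .
    have "cmod (f x) \<le> m"
      by (rule LIMSEQ_le[OF tendsto_norm[OF fx] lm]) (use P(2) less_imp_le in blast)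
    have smaller: False if "p \<in> Q" "cmod (f (fst p)) < m" for p using mle[OF that(1)] that(2) by linarith
    \<comment> \<open>The value 0 is taken once and simply, so the limiting value is nonzero and its
      modulus can still be lowered.\<close>
    have fx0: "f x \<noteq> 0" if "x \<noteq> y \<or> deriv f x = 0"
      using that fxy uniq[OF xW] uniq[OF yW] x0 by metis
    show False
    proof (cases "x = y")
      case False
      obtain U V where UV: "open U" "open V" "x \<in> U" "y \<in> V" "U \<inter> V = {}"
        using False by (metis hausdorff)
      have "open (f ` (U \<inter> C x))" "open (f ` (V \<inter> C y))"
        using omap[of "U \<inter> C x" x] omap[of "V \<inter> C y" y] UV C xW yW by auto
      then have o: "open (f ` (U \<inter> C x) \<inter> f ` (V \<inter> C y))" by auto
      have "f x \<in> f ` (U \<inter> C x)" using UV xC[OF xW] by blast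
      moreover have "f x \<in> f ` (V \<inter> C y)" using UV xC[OF yW] fxy by blast
      ultimately have "f x \<in> f ` (U \<inter> C x) \<inter> f ` (V \<inter> C y)" by blast
      then obtain e where e: "e > 0" "cball (f x) e \<subseteq> f ` (U \<inter> C x) \<inter> f ` (V \<inter> C y)"
        using o open_contains_cball by meson
      define s where "s = min (1/2) (e / cmod (f x))"
      have fn: "f x \<noteq> 0" using fx0 False by auto
      have s: "0 < s" "s \<le> 1/2" "s * cmod (f x) \<le> e"
        using e fn by (auto simp: s_def field_simps min_def)
      have "dist (f x) (of_real (1-s) * f x) = cmod (of_real s * f x)" by (simp add: dist_norm algebra_simps)
      also have "\<dots> \<le> e" using s by (simp add: norm_mult)
      finally have "of_real (1-s) * f x \<in> f ` (U \<inter> C x) \<inter> f ` (V \<inter> C y)"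
        using e(2) by auto
      then obtain x' y' where x': "x' \<in> U" "x' \<in> C x" "f x' = of_real (1-s) * f x"
        and y': "y' \<in> V" "y' \<in> C y" "f y' = of_real (1-s) * f x" by (metis IntE image_iff)
      have "(x',y') \<in> Q" using x' y' UV C(3) by (auto simp: Q_def)
      moreover have "cmod (f x') = cmod (of_real (1-s)) * cmod (f x)" by (simp only: x' norm_mult)
      then have "cmod (f x') = (1-s) * cmod (f x)" using s by (simp only: norm_of_real)
      then have "cmod (f x') < cmod (f x)" using s fn by simp
      ultimately show False using smaller \<open>cmod (f x) \<le> m\<close> by force
    next
      case True
      have "deriv f x = 0"
      proof (rule ccontr)
        assume "deriv f x \<noteq> 0"
        then obtain \<rho> where \<rho>: "\<rho> > 0" "inj_on f (ball x \<rho>)"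
          using has_complex_derivative_locally_injective[OF holf xW W] by blast
        have "eventually (\<lambda>n. fst (P (r n)) \<in> ball x \<rho>) sequentially"
          using topological_tendstoD[OF lx, of "ball x \<rho>"] \<rho> by auto
        moreover have "eventually (\<lambda>n. snd (P (r n)) \<in> ball x \<rho>) sequentially"
          using topological_tendstoD[OF ly, of "ball x \<rho>"] \<rho> True by auto
        ultimately have "eventually (\<lambda>n. fst (P (r n)) \<in> ball x \<rho> \<and> snd (P (r n)) \<in> ball x \<rho>) sequentially"
          by (rule eventually_conj)
        then obtain n where n: "fst (P (r n)) \<in> ball x \<rho>" "snd (P (r n)) \<in> ball x \<rho>"
          using eventually_happens' trivial_limit_sequentially by blast
        have "f (fst (P (r n))) = f (snd (P (r n)))" "fst (P (r n)) \<noteq> snd (P (r n))"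
          using P(1)[of "r n"] by (auto simp: Q_def case_prod_beta)
        then show False using n inj_onD[OF \<rho>(2)] by blast
      qed
      then have "f x \<noteq> 0" using fx0 by blast
      obtain y0 y1 where "y0 \<in> C x" "y1 \<in> C x" "y0 \<noteq> y1" "f y0 = f y1" "cmod (f y0) < cmod (f x)"
        by (rule critical_point_imp_not_inj[OF holomorphic_on_subset[OF holf C(3)] C(1) C(2) xC[OF xW] nc[OF xW]
          \<open>deriv f x = 0\<close> \<open>f x \<noteq> 0\<close> C(1) xC[OF xW] subset_refl])
      then have "(y0,y1) \<in> Q" "cmod (f y0) < m" using C(3) \<open>cmod (f x) \<le> m\<close> by (auto simp: Q_def)
      then show False using smaller by force
    qed
  qed
  have "f ` W = ball 0 1"
  proof -
    have "f ` W \<subseteq> (\<Union>x\<in>W. f ` (C x))" using xC by blast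
    moreover have "(\<Union>x\<in>W. f ` (C x)) \<subseteq> f ` W" using C(3) by blast
    moreover have "open (\<Union>x\<in>W. f ` (C x))" by (intro open_UN ballI) (rule omap[OF C(1) _ subset_refl])
    ultimately have op: "open (f ` W)" by (simp add: subset_antisym)
    have "ball 0 1 \<inter> closure (f ` W) \<subseteq> f ` W"
    proof
      fix a assume a: "a \<in> ball 0 1 \<inter> closure (f ` W)"
      let ?s = "(1 + cmod a)/2"
      have s1: "?s < 1" "cmod a < ?s" using a by auto
      have K: "compact (f ` {x \<in> W. cmod (f x) \<le> ?s})"
        by (intro compact_continuous_image continuous_on_subset[OF contf] proper s1) auto
      have "a \<in> closure (ball 0 ?s \<inter> f ` W)"
        using open_Int_closure_subset[of "ball 0 ?s" "f ` W"] a s1 by auto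
      also have "\<dots> \<subseteq> closure (f ` {x \<in> W. cmod (f x) \<le> ?s})" by (intro closure_mono) auto
      also have "\<dots> = f ` {x \<in> W. cmod (f x) \<le> ?s}" using K by (simp add: compact_imp_closed)
      finally show "a \<in> f ` W" by auto
    qed
    then have eqW: "f ` W = ball 0 1 \<inter> closure (f ` W)" using into closure_subset[of "f ` W"] by auto
    have "closedin (top_of_set (ball 0 1)) (ball 0 1 \<inter> closure (f ` W))"
      by (rule closedin_closed_Int) simp
    then have "closedin (top_of_set (ball 0 1)) (f ` W)" using eqW by argo
    moreover have "openin (top_of_set (ball 0 1)) (f ` W)"
      using op into by (subst openin_open_eq) auto
    moreover have "\<And>T. openin (top_of_set (ball (0::complex) 1)) T \<Longrightarrow> closedin (top_of_set (ball 0 1)) T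
        \<Longrightarrow> T = {} \<or> T = ball 0 1"
      using connected_ball[of "0::complex" 1] unfolding connected_clopen by simp
    ultimately have "f ` W = {} \<or> f ` W = ball 0 1" by blast
    then show ?thesis using x0(1) by blast
  qed
  then show ?thesis using inj by (simp add: bij_betw_def)
qed

text \<open>The Schwarz lemma for a map with two simple zeros. The product of the Moebius factors
  divided by \<open>h\<close> has only removable singularities. Near the circle the factors are
  bounded by 1 and \<open>h\<close> is bounded below by any \<open>\<eta> < 1\<close>, so the
  maximum principle bounds the quotient by 1.\<close>

lemma Moebius_le_of_proper:
  fixes h :: "complex \<Rightarrow> complex"
  assumes holh: "h holomorphic_on ball 0 1"
    and bd: "\<And>\<eta>. \<eta> < 1 \<Longrightarrow> \<exists>r0<1. \<forall>z. r0 \<le> cmod z \<and> cmod z < 1 \<longrightarrow> \<eta> \<le> cmod (h z)"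
    and ab: "cmod a < 1" "cmod b < 1" "a \<noteq> b" and zeros: "h a = 0" "h b = 0" "deriv h a \<noteq> 0" "deriv h b \<noteq> 0"
    and only: "\<And>z. cmod z < 1 \<Longrightarrow> h z = 0 \<Longrightarrow> z = a \<or> z = b"
    and z: "cmod z < 1"
  shows "cmod (Moebius_function 0 a z) * cmod (Moebius_function 0 b z) \<le> cmod (h z)"
proof -
  define q where "q = (\<lambda>z. if z = a then deriv h a else (h z - h a)/(z-a))"
  define q2 where "q2 = (\<lambda>z. if z = b then deriv q b else (q z - q b)/(z-b))"
  have holq: "q holomorphic_on ball 0 1" unfolding q_def by (rule pole_lemma_open[OF holh]) auto
  have holq2: "q2 holomorphic_on ball 0 1" unfolding q2_def by (rule pole_lemma_open[OF holq]) auto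
  have qb: "q b = 0" using ab zeros by (auto simp: q_def)
  have hq: "h z = (z - a) * q z" for z using zeros by (auto simp: q_def)
  have qq: "q z = (z - b) * q2 z" for z using qb by (auto simp: q2_def)
  have hqq: "h z = (z - a) * (z - b) * q2 z" for z using hq qq by simp
  have dh: "deriv h z = (z - b) * q2 z + (z - a) * (q2 z + (z - b) * deriv q2 z)" if "cmod z < 1" for z
  proof -
    have "(q2 has_field_derivative deriv q2 z) (at z)"
      using holq2 that by (simp add: holomorphic_derivI)
    then have "((\<lambda>z. (z - a) * (z - b) * q2 z) has_field_derivative
        ((z - b) * q2 z + (z - a) * (q2 z + (z - b) * deriv q2 z))) (at z)"
      by (auto intro!: derivative_eq_intros simp: algebra_simps)
    moreover have "h = (\<lambda>z. (z - a) * (z - b) * q2 z)" using hqq by auto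
    ultimately show ?thesis by (metis DERIV_imp_deriv)
  qed
  have q2nz: "q2 z \<noteq> 0" if "cmod z < 1" for z
  proof
    assume q0: "q2 z = 0"
    then have "h z = 0" by (simp add: hqq)
    then have "z = a \<or> z = b" using only that by blast
    then show False using dh[of a] dh[of b] q0 ab zeros by auto
  qed
  \<comment> \<open>The quotient with both zeros already cancelled.\<close>
  define k where "k = (\<lambda>z. 1 / ((1 - cnj a * z) * (1 - cnj b * z) * q2 z))"
  have nz: "1 - cnj c * z \<noteq> 0" if "cmod c < 1" "cmod z < 1" for c z :: complex
  proof -
    have "cmod (cnj c * z) < 1" using that norm_mult_less[of "cnj c" 1 z 1] by simp
    then show ?thesis by auto
  qed
  have holk: "k holomorphic_on ball 0 1"
    unfolding k_def by (intro holomorphic_intros holq2) (use nz ab q2nz in auto)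
  have kM: "Moebius_function 0 a z * Moebius_function 0 b z = h z * k z" if "cmod z < 1" for z
    using q2nz[OF that] by (simp add: Moebius_function_simple hqq k_def)
  have "cmod (k z) \<le> 1"
  proof (rule field_le_epsilon)
    fix e :: real assume e: "e > 0"
    \<comment> \<open>Chosen so that the bound \<open>1 / \<eta>\<close> on a large circle is
      exactly \<open>1 + e\<close>.\<close>
    define \<eta> where "\<eta> = 1 / (1 + e)"
    have \<eta>: "0 < \<eta>" "\<eta> < 1" using e by (auto simp: \<eta>_def)
    obtain r0 where r0: "r0 < 1" "\<And>z. r0 \<le> cmod z \<Longrightarrow> cmod z < 1 \<Longrightarrow> \<eta> \<le> cmod (h z)"
      using bd[OF \<eta>(2)] by auto
    define r where "r = max (1/2 + cmod z/2) (1/2 + r0/2)"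
    have r: "cmod z < r" "r0 < r" "r < 1" "0 < r"
    proof -
      show "cmod z < r" using z unfolding r_def by linarith
      show "r0 < r" using r0(1) unfolding r_def by linarith
      show "r < 1" using r0(1) z unfolding r_def by linarith
      have "0 < 1/2 + cmod z/2" using norm_ge_zero[of z] by linarith
      then show "0 < r" unfolding r_def by linarith
    qed
    have "cmod (k z) \<le> 1 + e"
    proof (rule maximum_modulus_frontier[of k "cball 0 r"])
      show "k holomorphic_on interior (cball 0 r)"
        by (rule holomorphic_on_subset[OF holk]) (use r in auto)
      show "continuous_on (closure (cball 0 r)) k"
        by (rule holomorphic_on_imp_continuous_on, rule holomorphic_on_subset[OF holk]) (use r in auto)
      show "z \<in> cball 0 r" using r by auto
      fix w assume "w \<in> frontier (cball (0::complex) r)"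
      then have w: "cmod w = r" using r by (simp add: frontier_cball)
      then have w1: "cmod w < 1" using r by simp
      have "cmod (h w) * cmod (k w) = cmod (Moebius_function 0 a w) * cmod (Moebius_function 0 b w)"
        by (metis kM[OF w1] norm_mult)
      also have "\<dots> \<le> 1 * 1"
        by (intro mult_mono) (use Moebius_function_norm_lt_1[OF ab(1) w1] Moebius_function_norm_lt_1[OF ab(2) w1] in \<open>auto intro: less_imp_le\<close>)
      finally have "cmod (h w) * cmod (k w) \<le> 1" by simp
      moreover have "\<eta> * cmod (k w) \<le> cmod (h w) * cmod (k w)"
        using r0(2)[of w] w r by (intro mult_right_mono) auto
      ultimately have "\<eta> * cmod (k w) \<le> 1" by linarith
      then show "cmod (k w) \<le> 1 + e" using e by (simp add: \<eta>_def field_simps)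
    qed auto
    then show "cmod (k z) \<le> 1 + e" .
  qed
  then have "cmod (h z * k z) \<le> cmod (h z)" by (simp add: norm_mult mult_left_le)
  then show ?thesis using kM[OF z] by (metis norm_mult)
qed

text \<open>Without a zero, \<open>1 / h\<close> would be holomorphic and bounded by
  \<open>1 / \<eta>\<close> near the circle, although its modulus at the origin is larger.\<close>

lemma min_modulus_proper:
  fixes h :: "complex \<Rightarrow> complex"
  assumes holh: "h holomorphic_on ball 0 1"
    and bd: "\<And>\<eta>. \<eta> < 1 \<Longrightarrow> \<exists>r0<1. \<forall>z. r0 \<le> cmod z \<and> cmod z < 1 \<longrightarrow> \<eta> \<le> cmod (h z)"
    and h0: "cmod (h 0) < 1"
  shows "\<exists>z. cmod z < 1 \<and> h z = 0"
proof (rule ccontr)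
  assume n: "\<not> ?thesis"
  define \<eta> where "\<eta> = (1 + cmod (h 0))/2"
  have \<eta>: "\<eta> < 1" "cmod (h 0) < \<eta>" "0 < \<eta>" using h0 by (auto simp: \<eta>_def add_pos_nonneg)
  obtain r0 where r0: "r0 < 1" "\<And>z. r0 \<le> cmod z \<Longrightarrow> cmod z < 1 \<Longrightarrow> \<eta> \<le> cmod (h z)"
    using bd[OF \<eta>(1)] by auto
  define r where "r = max (1/2) (1/2 + r0/2)"
  have r: "r0 < r" "r < 1" "0 < r" using r0(1) by (auto simp: r_def)
  have "cmod (1 / h 0) \<le> 1 / \<eta>"
  proof (rule maximum_modulus_frontier[of "\<lambda>z. 1 / h z" "cball 0 r"])
    show "(\<lambda>z. 1 / h z) holomorphic_on interior (cball 0 r)"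
      by (intro holomorphic_intros holomorphic_on_subset[OF holh]) (use r n in auto)
    show "continuous_on (closure (cball 0 r)) (\<lambda>z. 1 / h z)"
      by (rule holomorphic_on_imp_continuous_on, intro holomorphic_intros holomorphic_on_subset[OF holh])
         (use r n in auto)
    fix w assume "w \<in> frontier (cball (0::complex) r)"
    then have w: "cmod w = r" using r by (simp add: frontier_cball)
    then have "\<eta> \<le> cmod (h w)" using r0(2)[of w] r by simp
    then show "cmod (1 / h w) \<le> 1 / \<eta>" using \<eta> by (simp add: norm_divide frac_le)
  qed (use r in auto)
  moreover have "h 0 \<noteq> 0" using n by (metis norm_zero zero_less_one)
  ultimately have "\<eta> \<le> cmod (h 0)" using \<eta> by (simp add: norm_divide field_simps)
  then show False using \<eta> by simp
qed

text \<open>The centre of each map lies outside almost all the images, so by Hurwitz a nonconstant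
  limit function is impossible.\<close>

lemma shrinking_discs:
  fixes F :: "nat \<Rightarrow> complex \<Rightarrow> complex"
  assumes hol: "\<And>j. F j holomorphic_on ball 0 1"
    and bdd: "\<And>j z. cmod z < 1 \<Longrightarrow> cmod (F j z) \<le> B"
    and avoid: "\<And>i. finite {j. F i 0 \<in> F j ` ball 0 1}"
    and \<sigma>: "\<sigma> < 1" and e: "e > 0"
  shows "\<exists>j. \<forall>z. cmod z \<le> \<sigma> \<longrightarrow> dist (F j z) (F j 0) < e"
proof (rule ccontr)
  assume "\<not> ?thesis"
  then obtain Z where Z: "\<And>j. cmod (Z j) \<le> \<sigma>" "\<And>j. e \<le> dist (F j (Z j)) (F j 0)"
    by (metis not_less)
  have "0 \<le> \<sigma>" using Z(1)[of 0] norm_ge_zero order_trans by blast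
  obtain g r where g: "g holomorphic_on ball 0 1" "strict_mono (r :: nat \<Rightarrow> nat)"
     and lim: "\<And>x. x \<in> ball 0 1 \<Longrightarrow> ((\<lambda>n. F (r n) x) \<longlongrightarrow> g x) sequentially"
     and ul: "\<And>K. \<lbrakk>compact K; K \<subseteq> ball 0 1\<rbrakk> \<Longrightarrow> uniform_limit K (F \<circ> r) g sequentially"
    by (rule Montel[of "ball 0 1" "range F" F]) (use hol bdd in \<open>auto intro!: exI[of _ B]\<close>)
  show False
  proof (cases "g constant_on ball 0 1")
    case True
    have K: "uniform_limit (cball 0 \<sigma>) (F \<circ> r) g sequentially" by (rule ul) (use \<sigma> in auto)
    have "eventually (\<lambda>n. \<forall>x\<in>cball 0 \<sigma>. dist ((F \<circ> r) n x) (g x) < e/2) sequentially"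
      using uniform_limitD[OF K, of "e/2"] e by simp
    then obtain n where "\<forall>x\<in>cball 0 \<sigma>. dist ((F \<circ> r) n x) (g x) < e/2"
      using eventually_happens' trivial_limit_sequentially by blast
    then have n: "\<And>x. x \<in> cball 0 \<sigma> \<Longrightarrow> dist (F (r n) x) (g x) < e/2" by (simp add: o_def)
    have "g (Z (r n)) = g 0" using True Z(1)[of "r n"] \<sigma> unfolding constant_on_def by force
    then have "dist (F (r n) (Z (r n))) (F (r n) 0) < e"
      using n[of "Z (r n)"] n[of 0] Z(1)[of "r n"] \<open>0 \<le> \<sigma>\<close> dist_triangle_half_l
      by (metis dist_commute mem_cball_0 norm_zero)
    then show False using Z(2)[of "r n"] by simp
  next
    case False
    have "open (g ` ball 0 1)" by (rule open_mapping_thm[OF g(1) _ _ _ _ False]) auto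
    moreover have "g 0 \<in> g ` ball 0 1" by auto
    moreover have "(\<lambda>n. F (r n) 0) \<longlonglongrightarrow> g 0" using lim by auto
    ultimately have "eventually (\<lambda>n. F (r n) 0 \<in> g ` ball 0 1) sequentially"
      by (metis topological_tendstoD)
    then obtain n0 where "F (r n0) 0 \<in> g ` ball 0 1"
      using eventually_happens' trivial_limit_sequentially by blast
    then obtain w where w: "w \<in> ball 0 1" "g w = F (r n0) 0" by auto
    define p where "p = F (r n0) 0"
    have fin: "finite {j. p \<in> F j ` ball 0 1}" using avoid p_def by simp
    then obtain N where N: "\<And>j. p \<in> F j ` ball 0 1 \<Longrightarrow> j < N"
      by (metis (mono_tags, lifting) finite_nat_set_iff_bounded mem_Collect_eq)
    have ge: "N \<le> r (n + N)" for n using seq_suble[OF g(2), of "n+N"] by linarith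
    \<comment> \<open>The limit takes the value \<open>p\<close> at \<open>w\<close>, while almost
      all maps of the subsequence omit \<open>p\<close>; Hurwitz excludes this.\<close>
    have "g w - p \<noteq> 0"
    proof (rule Hurwitz_no_zeros[of "ball 0 1" "\<lambda>n z. F (r (n + N)) z - p" "\<lambda>z. g z - p" w])
      show "\<And>n. (\<lambda>z. F (r (n + N)) z - p) holomorphic_on ball 0 1"
        by (intro holomorphic_intros hol)
      show "(\<lambda>z. g z - p) holomorphic_on ball 0 1" by (intro holomorphic_intros g)
      show "uniform_limit K (\<lambda>n z. F (r (n + N)) z - p) (\<lambda>z. g z - p) sequentially"
        if "compact K" "K \<subseteq> ball 0 1" for K
      proof -
        have "filterlim (\<lambda>n. n + N) sequentially sequentially"
          by (rule filterlim_add_const_nat_at_top)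
        then have "uniform_limit K (\<lambda>n. F (r (n + N))) g sequentially"
          using filterlim_compose[OF ul[OF that], of "\<lambda>n. n + N"] by (simp add: o_def)
        then show ?thesis by (simp add: uniform_limit_iff dist_norm)
      qed
      show "\<not> (\<lambda>z. g z - p) constant_on ball 0 1"
      proof
        assume "(\<lambda>z. g z - p) constant_on ball 0 1"
        then obtain c where "\<forall>z\<in>ball 0 1. g z - p = c" unfolding constant_on_def by blast
        then have "\<forall>z\<in>ball 0 1. g z = c + p" by (metis diff_add_cancel)
        then show False using False unfolding constant_on_def by blast
      qed
      show "F (r (n + N)) z - p \<noteq> 0" if "z \<in> ball 0 1" for n z
        using N[of "r (n+N)"] ge[of n] that by force
    qed (use w in auto)
    then show False using w p_def by simp
  qed
qed

section \<open>Simply connected domains and continuous roots\<close>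

text \<open>A loop in the component that winds around an omitted point surrounds a bounded region
  whose boundary lies on the loop. By the maximum principle \<open>p\<close> maps this region into
  the ball, so the region belongs to the component.\<close>

lemma simply_connected_component_preimage_ball:
  fixes p :: "complex \<Rightarrow> complex"
  assumes hol: "p holomorphic_on UNIV"
  shows "simply_connected (connected_component_set {t. p t \<in> ball x0 R} t0)"
proof -
  let ?S = "{t. p t \<in> ball x0 R}" 
  let ?O = "connected_component_set ?S t0"
  have cont: "continuous_on UNIV p" using hol holomorphic_on_imp_continuous_on by blast
  have "open (p -` ball x0 R)" using cont by (simp add: open_vimage continuous_on_eq_continuous_within)
  then have oS: "open ?S" by (simp add: vimage_def)
  then have oO: "open ?O" by (rule open_connected_component)
  show ?thesis
  proof (subst simply_connected_eq_winding_number_zero[OF oO], intro conjI allI impI)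
    show "connected ?O" by simp
    fix g z assume A: "path g \<and> path_image g \<subseteq> ?O \<and> pathfinish g = pathstart g \<and> z \<notin> ?O"
    show "winding_number g z = 0"
    proof (rule ccontr)
      assume wn: "winding_number g z \<noteq> 0"
      have zi: "z \<notin> path_image g" using A by auto
      define B where "B = connected_component_set (- path_image g) z"
      have cl: "closed (path_image g)" using A by (simp add: closed_path_image)
      have oB: "open B" unfolding B_def using cl by (intro open_connected_component) (simp add: open_Compl)
      have zB: "z \<in> B" using zi by (simp add: B_def connected_component_refl_eq)
      have "z \<notin> outside (path_image g)" using winding_number_zero_in_outside wn A by blast
      then have "z \<in> inside (path_image g)" using inside_Un_outside[of "path_image g"] zi by blast
      then have bB: "bounded B" unfolding B_def inside_def by auto
      have fr: "frontier B \<subseteq> path_image g"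
        unfolding B_def by (rule frontier_of_connected_component_subset[THEN subset_trans])
           (use cl in \<open>simp add: frontier_complement frontier_subset_closed\<close>)
      have sub: "B \<subseteq> ?S"
      proof
        fix w assume w: "w \<in> B"
        have comp: "compact (p ` path_image g)"
          using A cont by (intro compact_continuous_image continuous_on_subset[OF cont] compact_path_image) auto
        have pn: "p ` path_image g \<noteq> {}" by simp
        obtain u where u: "u \<in> path_image g" "\<And>v. v \<in> path_image g \<Longrightarrow> dist x0 (p v) \<le> dist x0 (p u)"
          using distance_attains_sup[OF comp pn, of x0] by auto
        have "cmod (p w - x0) \<le> dist x0 (p u)"
        proof (rule maximum_modulus_frontier[of "\<lambda>t. p t - x0" B "dist x0 (p u)" w])
          show "(\<lambda>t. p t - x0) holomorphic_on interior B"
            by (intro holomorphic_intros holomorphic_on_subset[OF hol]) auto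
          show "continuous_on (closure B) (\<lambda>t. p t - x0)"
            by (intro continuous_intros continuous_on_subset[OF cont]) auto
          fix v assume "v \<in> frontier B"
          then show "cmod (p v - x0) \<le> dist x0 (p u)" using u fr by (metis dist_commute dist_norm subsetD)
        qed (use bB w in auto)
        moreover have "dist x0 (p u) < R" using u(1) A connected_component_subset[of ?S t0] by auto
        ultimately show "w \<in> ?S" by (simp add: dist_norm norm_minus_commute)
      qed
      have frn: "frontier B \<noteq> {}" using bB zB frontier_eq_empty[of B] not_bounded_UNIV by auto
      then obtain v where v: "v \<in> frontier B" by blast
      then have "v \<in> ?O" using fr A by blast
      then have "?O \<inter> B \<noteq> {}"
        using v oO open_Int_closure_eq_empty[OF oO, of B] by (auto simp: frontier_def)
      then have cu: "connected (?O \<union> B)" by (intro connected_Un) (auto simp: B_def)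
      have "?O \<union> B \<subseteq> ?O"
      proof (rule connected_component_maximal[OF _ cu])
        show "?O \<union> B \<subseteq> ?S" using sub connected_component_subset by blast
        show "t0 \<in> ?O \<union> B" using \<open>v \<in> ?O\<close> connected_component_in[of ?S t0 v]
          by (simp add: connected_component_refl_eq)
      qed
      then show False using zB A by blast
    qed
  qed
qed

text \<open>Lifting over \<open>U \<times> UNIV\<close>, to which the parameter interval is retracted, avoids local
  connectedness of products.\<close>

lemma sqrt_lift:
  fixes F :: "complex \<times> real \<Rightarrow> complex"
  assumes U: "open U" "simply_connected U" and cont: "continuous_on (U \<times> {0..1}) F"
    and nz: "\<And>x. x \<in> U \<times> {0..1} \<Longrightarrow> F x \<noteq> 0" and x0: "x0 \<in> U \<times> {0..1}" "z0 ^ 2 = F x0"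
  obtains g where "continuous_on (U \<times> {0..1}) g" "\<And>x. x \<in> U \<times> {0..1} \<Longrightarrow> g x ^ 2 = F x" "g x0 = z0"
proof -
  define c where "c = (\<lambda>x::complex \<times> real. (fst x, max 0 (min 1 (snd x))))"
  have cc: "c ` (U \<times> UNIV) \<subseteq> U \<times> {0..1}" by (auto simp: c_def)
  have ccont: "continuous_on (U \<times> UNIV) c" unfolding c_def by (intro continuous_intros)
  have cid: "c x = x" if "x \<in> U \<times> {0..1}" for x using that by (cases x) (auto simp: c_def)
  have 1: "continuous_on (U \<times> UNIV) (F \<circ> c)"
    using continuous_on_compose[OF ccont continuous_on_subset[OF cont cc]] .
  have 2: "simply_connected (U \<times> (UNIV::real set))"
    by (intro simply_connected_Times U convex_imp_simply_connected convex_UNIV)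
  have 3: "locally path_connected (U \<times> (UNIV::real set))"
    using U by (intro open_imp_locally_path_connected open_Times) auto
  have 4: "\<And>x. x \<in> U \<times> UNIV \<Longrightarrow> (F \<circ> c) x \<noteq> 0"
  proof -
    fix x assume "x \<in> U \<times> (UNIV::real set)"
    then have "c x \<in> U \<times> {0..1}" using cc by blast
    then show "(F \<circ> c) x \<noteq> 0" using nz by simp
  qed
  obtain g where g: "continuous_on (U \<times> UNIV) g" "\<And>x. x \<in> U \<times> UNIV \<Longrightarrow> (F \<circ> c) x = (g x)^2"
    using continuous_sqrt_on_simply_connected[OF 1 2 3 4] by blast
  have cg: "continuous_on (U \<times> {0..1}) g" by (rule continuous_on_subset[OF g(1)]) auto
  have g2: "g x ^ 2 = F x" if "x \<in> U \<times> {0..1}" for x using g(2)[of x] cid[OF that] that by auto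
  have "g x0 ^ 2 = z0 ^ 2" using g2[OF x0(1)] x0(2) by simp
  then have "g x0 = z0 \<or> g x0 = - z0" by (simp add: power2_eq_iff)
  then show thesis
  proof
    assume "g x0 = z0"
    then show thesis using that[of g] g2 cg by simp
  next
    assume "g x0 = - z0"
    then show thesis using that[of "\<lambda>x. - g x"] g2 continuous_on_minus[OF cg] by simp
  qed
qed

text \<open>The quotient takes only the values 1 and -1. This is how a lift is identified with a
  known branch from its value at a single point.\<close>

lemma sqrt_unique:
  fixes g h :: "'a::topological_space \<Rightarrow> complex"
  assumes S: "connected S" and cont: "continuous_on S g" "continuous_on S h"
    and eq: "\<And>x. x \<in> S \<Longrightarrow> g x ^ 2 = h x ^ 2" and nz: "\<And>x. x \<in> S \<Longrightarrow> g x \<noteq> 0"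
    and x0: "x0 \<in> S" "g x0 = h x0" and x: "x \<in> S"
  shows "g x = h x"
proof -
  have "continuous_on S (\<lambda>x. h x / g x)" by (intro continuous_intros cont) (use nz in auto)
  moreover have fin: "finite ((\<lambda>x. h x / g x) ` S)"
  proof (rule finite_subset[of _ "{1,-1}"])
    have "h x / g x \<in> {1,-1}" if "x \<in> S" for x
      using eq[OF that] nz[OF that] by (auto simp: power2_eq_iff)
    then show "(\<lambda>x. h x / g x) ` S \<subseteq> {1,-1}" by blast
  qed auto
  ultimately have "(\<lambda>x. h x / g x) constant_on S"
    using continuous_finite_range_constant[OF S] by blast
  then have "h x / g x = h x0 / g x0" using x x0 unfolding constant_on_def by metis
  then show ?thesis using x0 nz[OF x] nz[OF x0(1)] by (simp add: field_simps)
qed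

lemma root_of_unity_constant:
  fixes f :: "'a::topological_space \<Rightarrow> complex"
  assumes S: "connected S" and cont: "continuous_on S f" and n: "n > 0"
    and eq: "\<And>x. x \<in> S \<Longrightarrow> f x ^ n = c" and x: "x \<in> S" "y \<in> S"
  shows "f x = f y"
proof -
  have "finite (f ` S)"
    by (rule finite_subset[of _ "{z. z ^ n = c}"]) (use eq n finite_roots_unity in \<open>auto simp: finite_nth_roots\<close>)
  then have "f constant_on S" using continuous_finite_range_constant[OF S cont] by blast
  then show ?thesis using x unfolding constant_on_def by metis
qed

section \<open>The exterior of the Mandelbrot set\<close>

definition orb :: "complex \<Rightarrow> nat \<Rightarrow> complex" where "orb t n = (quad t ^^ n) 0"

lemma orb_0 [simp]: "orb t 0 = 0" by (simp add: orb_def)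
lemma orb_Suc: "orb t (Suc n) = orb t n ^ 2 + t" by (simp add: orb_def quad_def)
lemma orb_1 [simp]: "orb t (Suc 0) = t" by (simp add: orb_Suc)

lemma holomorphic_orb: "(\<lambda>t. orb t n) holomorphic_on S"
  by (induction n) (auto simp: orb_Suc intro!: holomorphic_intros)

lemma continuous_on_orb: "continuous_on S (\<lambda>t. orb t n)"
  using holomorphic_orb holomorphic_on_imp_continuous_on by blast

lemma orb_cnj: "orb (cnj t) n = cnj (orb t n)"
  by (induction n) (auto simp: orb_Suc)

lemma orb_step:
  assumes "2 < cmod (orb t j)" "cmod t \<le> cmod (orb t j)"
  shows "cmod (orb t j) * (cmod (orb t j) - 1) \<le> cmod (orb t (Suc j))"
proof -
  have "cmod (orb t j ^ 2) - cmod t \<le> cmod (orb t j ^ 2 + t)" by (rule norm_diff_ineq)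
  moreover have "cmod (orb t j ^ 2) = cmod (orb t j) * cmod (orb t j)"
    by (simp add: power2_eq_square norm_mult)
  ultimately show ?thesis using assms by (simp add: orb_Suc right_diff_distrib)
qed

lemma orb_growth:
  assumes "2 < cmod (orb t j)" "cmod t \<le> cmod (orb t j)"
  shows "cmod (orb t j) * (cmod (orb t j) - 1) ^ m \<le> cmod (orb t (j + m))"
proof (induction m)
  case 0 then show ?case by simp
next
  case (Suc m)
  let ?q = "cmod (orb t j) - 1"
  have "1 \<le> ?q ^ m" using assms by (simp add: one_le_power)
  then have ge: "cmod (orb t j) \<le> cmod (orb t (j + m))"
    using Suc assms mult_left_mono[of 1 "?q ^ m" "cmod (orb t j)"] by simp
  have "cmod (orb t j) * ?q ^ Suc m = (cmod (orb t j) * ?q ^ m) * ?q" by simp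
  also have "\<dots> \<le> cmod (orb t (j+m)) * (cmod (orb t (j+m)) - 1)"
    using Suc ge assms(1) by (intro mult_mono) linarith+
  also have "\<dots> \<le> cmod (orb t (Suc (j+m)))" by (rule orb_step) (use ge assms in linarith)+
  finally show ?case by simp
qed

lemma orb_strict:
  assumes "2 < cmod (orb t j)" "cmod t \<le> cmod (orb t j)" "j < n"
  shows "cmod (orb t j) < cmod (orb t n)"
proof -
  obtain m where n: "n = j + Suc m" using less_imp_Suc_add[OF assms(3)] by auto
  let ?q = "cmod (orb t j) - 1"
  have "1 < ?q ^ Suc m" using assms by (intro one_less_power) auto
  then have "cmod (orb t j) * 1 < cmod (orb t j) * ?q ^ Suc m"
    by (rule mult_strict_left_mono) (use assms in linarith)
  then have "cmod (orb t j) < cmod (orb t j) * ?q ^ Suc m" by (simp only: mult_1_right)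
  also have "\<dots> \<le> cmod (orb t n)" unfolding n by (rule orb_growth[OF assms(1,2)])
  finally show ?thesis .
qed

lemma param_le_orb:
  assumes "2 < cmod (orb t n)" shows "cmod t \<le> cmod (orb t n)"
proof (cases "cmod t \<le> 2 \<or> n = 1")
  case False
  then have "1 < n" using assms by (cases n) (auto simp: not_le)
  then show ?thesis using orb_strict[of t 1 n] False by auto
qed (use assms in auto)

lemma orb_less:
  assumes "2 < cmod (orb t n)" "j < n" shows "cmod (orb t j) < cmod (orb t n)"
proof (cases "2 < cmod (orb t j)")
  case True then show ?thesis using orb_strict[OF True param_le_orb[OF True] assms(2)] by simp
qed (use assms in auto)

text \<open>These sets increase and exhaust the complement of the Mandelbrot set, so every
  construction there can be done at a finite stage of escape.\<close>

definition V :: "nat \<Rightarrow> complex set" where "V n = {t. 2 < cmod (orb t n)}"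

lemma open_V: "open (V n)"
proof -
  have "open ((\<lambda>t. cmod (orb t n)) -` {2<..})"
    by (intro open_vimage continuous_intros continuous_on_orb)
  then show ?thesis by (simp add: V_def vimage_def greaterThan_def)
qed

lemma V_mono: assumes "m \<le> n" shows "V m \<subseteq> V n"
proof
  fix t assume t: "t \<in> V m"
  show "t \<in> V n"
  proof (cases "m = n")
    case False
    then have "m < n" using assms by simp
    then show ?thesis using t orb_strict[of t m n] param_le_orb[of t m] unfolding V_def by auto
  qed (use t in simp)
qed

lemma orb_tends_to_infinity:
  assumes "t \<in> V n" shows "filterlim (\<lambda>m. cmod (orb t m)) at_top sequentially"
proof -
  let ?q = "cmod (orb t n) - 1"
  have 2: "2 < cmod (orb t n)" using assms by (simp add: V_def)
  have *: "\<exists>M. \<forall>m\<ge>M. Z \<le> cmod (orb t (n + m))" for Z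
  proof -
    obtain M where M: "Z < ?q ^ M" using real_arch_pow[of ?q Z] 2 by auto
    have "Z \<le> cmod (orb t (n + m))" if "m \<ge> M" for m
    proof -
      have "?q ^ M \<le> ?q ^ m" using 2 that by (intro power_increasing) auto
      moreover have "1 * ?q ^ m \<le> cmod (orb t n) * ?q ^ m" using 2 by (intro mult_right_mono) auto
      ultimately show ?thesis using M orb_growth[OF 2 param_le_orb[OF 2], of m] by linarith
    qed
    then show ?thesis by blast
  qed
  have "\<exists>M. \<forall>m\<ge>M. Z \<le> cmod (orb t m)" for Z
  proof -
    obtain M where M: "\<And>m. m \<ge> M \<Longrightarrow> Z \<le> cmod (orb t (n + m))" using * by blast
    have "Z \<le> cmod (orb t m)" if "m \<ge> n + M" for m using M[of "m - n"] that by simp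
    then show ?thesis by blast
  qed
  then show ?thesis by (simp add: filterlim_at_top eventually_sequentially)
qed

lemma mandelbrot_iff_bounded: "t \<in> mandelbrot \<longleftrightarrow> (\<exists>B. \<forall>n. cmod (orb t n) \<le> B)"
  unfolding mandelbrot_def bounded_iff orb_def by simp

lemma notin_mandelbrot_iff: "t \<notin> mandelbrot \<longleftrightarrow> (\<exists>n. t \<in> V n)"
proof
  assume "t \<notin> mandelbrot"
  then have "\<not> (\<forall>n. cmod (orb t n) \<le> 2)" unfolding mandelbrot_iff_bounded by blast
  then show "\<exists>n. t \<in> V n" by (simp add: V_def not_le)
next
  assume "\<exists>n. t \<in> V n"
  then obtain n where n: "t \<in> V n" by blast
  show "t \<notin> mandelbrot"
  proof
    assume "t \<in> mandelbrot"
    then obtain B where B: "\<forall>m. cmod (orb t m) \<le> B" unfolding mandelbrot_iff_bounded by blast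
    have "eventually (\<lambda>m. B + 1 \<le> cmod (orb t m)) sequentially"
      using orb_tends_to_infinity[OF n] by (simp add: filterlim_at_top)
    then obtain m where "B + 1 \<le> cmod (orb t m)"
      using eventually_happens' trivial_limit_sequentially by blast
    then show False using spec[OF B, of m] by linarith
  qed
qed

lemma V_subset: "V n \<subseteq> - mandelbrot" using notin_mandelbrot_iff by blast

lemma V_large: "2 < cmod t \<Longrightarrow> 1 \<le> n \<Longrightarrow> t \<in> V n"
  using V_mono[of 1 n] by (auto simp: V_def)

text \<open>The orbit value \<open>orb t N\<close> is pushed out along its radius and the path is pulled back along the
  orbit. In the coordinate \<open>v = (orb t N / z)\<^bsup>1/2^(N-1)\<^esup>\<close> the pulled back paths, multiplied by
  the appropriate power of \<open>v\<close>, extend continuously to \<open>v = 0\<close>.\<close>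

definition achain :: "nat \<Rightarrow> complex \<Rightarrow> (nat \<Rightarrow> real \<Rightarrow> complex) \<Rightarrow> bool" where
  "achain N t Y \<longleftrightarrow> (\<forall>i\<in>{1..N}. continuous_on {0..1} (Y i)) \<and> (\<forall>v\<in>{0..1}. Y N v = orb t N) \<and>
     (\<forall>i\<in>{1..<N}. \<forall>v\<in>{0..1}. Y i v ^ 2 = Y (Suc i) v - t * of_real v ^ (2^i)) \<and>
     (\<forall>i\<in>{1..N}. Y i 1 = orb t i)"

text \<open>If the radicand vanished, the chain after index \<open>i\<close> would be a rescaled
  copy of the critical orbit started afresh, so \<open>orb t N\<close> would have modulus at most
  that of the earlier value \<open>orb t (N - i)\<close>, against \<open>orb_less\<close>.\<close>

lemma chain_nonzero:
  assumes N: "2 < cmod (orb t N)" and i: "1 \<le> i" "i < N" and v: "0 \<le> v" "v \<le> (1::real)"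
    and z: "z N = orb t N" "\<And>j. i < j \<Longrightarrow> j < N \<Longrightarrow> z j ^ 2 = z (Suc j) - t * of_real v ^ (2^j)"
  shows "z (Suc i) - t * of_real v ^ (2^i) \<noteq> 0"
proof
  assume 0: "z (Suc i) - t * of_real v ^ (2^i) = 0"
  have "Suc i \<le> j \<Longrightarrow> j \<le> N \<Longrightarrow> z j = orb t (j - i) * of_real v ^ (2^(j-1))" for j
  proof (induction j rule: dec_induct)
    case base then show ?case using 0 by simp
  next
    case (step j)
    have "z (Suc j) = z j ^ 2 + t * of_real v ^ (2^j)" using z(2)[of j] step by auto
    also have "z j ^ 2 = orb t (j-i) ^ 2 * of_real v ^ (2^j)"
    proof -
      have e: "2^(j-1) * 2 = (2::nat)^j" using step by (cases j) auto
      have "z j ^ 2 = orb t (j-i)^2 * (of_real v ^ (2^(j-1)))^2" using step by (simp add: power_mult_distrib)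
      also have "(of_real v ^ (2^(j-1)))^2 = (of_real v :: complex) ^ (2^j)"
        by (simp only: power_mult[symmetric] e)
      finally show ?thesis .
    qed
    finally show ?case using step by (simp add: Suc_diff_le orb_Suc algebra_simps)
  qed
  from this[of N] have "orb t N = orb t (N - i) * of_real v ^ (2^(N-1))" using z i by simp
  then have "cmod (orb t N) = cmod (orb t (N-i)) * v ^ (2^(N-1))"
    using v by (metis abs_of_nonneg norm_mult norm_of_real norm_power)
  also have "\<dots> \<le> cmod (orb t (N-i))" using v by (simp add: mult_left_le power_le_one)
  also have "\<dots> < cmod (orb t N)" using orb_less[OF N, of "N-i"] i by auto
  finally show False by simp
qed

lemma achain_family:
  assumes U: "open U" "simply_connected U" "U \<subseteq> V N" and N: "1 \<le> N"
  shows "\<exists>Y. (\<forall>i\<in>{1..N}. continuous_on (U \<times> {0..1}) (Y i)) \<and> (\<forall>t\<in>U. achain N t (\<lambda>i v. Y i (t,v)))"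
proof (cases "U = {}")
  case True then show ?thesis by auto
next
  case False
  then obtain t0 where t0: "t0 \<in> U" by blast
  \<comment> \<open>The chain built from index \<open>N\<close> down to \<open>m\<close>; each
    further entry is a square root over \<open>U\<close>, normalised at \<open>v = 1\<close> by the
    orbit.\<close>
  define P where "P m Y \<longleftrightarrow> (\<forall>i\<in>{m..N}. continuous_on (U \<times> {0..1}) (Y i)) \<and>
     (\<forall>x\<in>U \<times> {0..1}. Y N x = orb (fst x) N) \<and>
     (\<forall>i\<in>{m..<N}. \<forall>x\<in>U \<times> {0..1}. Y i x ^ 2 = Y (Suc i) x - fst x * of_real (snd x) ^ (2^i)) \<and>
     (\<forall>i\<in>{m..N}. \<forall>t\<in>U. Y i (t,1) = orb t i)" for m and Y :: "nat \<Rightarrow> complex \<times> real \<Rightarrow> complex"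
  have cU: "connected U" using U simply_connected_imp_connected by blast
  have "\<exists>Y. P m Y" if "m \<le> N" "1 \<le> m" for m
    using that
  proof (induction m rule: inc_induct)
    case base
    have "P N (\<lambda>i x. orb (fst x) N)"
      unfolding P_def by (auto intro!: continuous_on_compose2[OF continuous_on_orb[of UNIV]] continuous_intros)
    then show ?case by blast
  next
    case (step m)
    then obtain Y where Y: "P (Suc m) Y" by auto
    have mN: "1 \<le> m" "m < N" using step by auto
    define F where "F = (\<lambda>x. Y (Suc m) x - fst x * of_real (snd x) ^ (2^m))"
    have cF: "continuous_on (U \<times> {0..1}) F"
      using Y mN unfolding F_def P_def by (intro continuous_intros) auto
    have nz: "F x \<noteq> 0" if x: "x \<in> U \<times> {0..1}" for x
      unfolding F_def
      by (rule chain_nonzero[of "fst x" N m "snd x" "\<lambda>j. Y j x"])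
         (use x U mN Y in \<open>auto simp: P_def V_def\<close>)
    have F1: "F (t,1) = orb t m ^ 2" if "t \<in> U" for t
      using Y that mN by (auto simp: F_def P_def orb_Suc)
    obtain g where g: "continuous_on (U \<times> {0..1}) g" "\<And>x. x \<in> U \<times> {0..1} \<Longrightarrow> g x ^ 2 = F x" "g (t0,1) = orb t0 m"
      using sqrt_lift[OF U(1,2) cF nz, of "(t0,1)" "orb t0 m"] t0 F1 by auto
    have g1: "g (t,1) = orb t m" if "t \<in> U" for t
    proof (rule sqrt_unique[OF cU, of "\<lambda>t. g (t,1)" "\<lambda>t. orb t m" t0])
      show "continuous_on U (\<lambda>t. g (t,1))"
        by (rule continuous_on_compose2[OF g(1)]) (auto intro!: continuous_intros)
      show "g (x,1) ^ 2 = orb x m ^ 2" if "x \<in> U" for x using g(2)[of "(x,1)"] F1 that by auto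
      show "g (x,1) \<noteq> 0" if "x \<in> U" for x using g(2)[of "(x,1)"] nz[of "(x,1)"] that by auto
    qed (use t0 g that continuous_on_orb in auto)
    have "P m (Y(m := g))"
      unfolding P_def
    proof (intro conjI ballI)
      fix i assume "i \<in> {m..N}" 
      then show "continuous_on (U \<times> {0..1}) ((Y(m := g)) i)" using Y g by (auto simp: P_def)
    next
      fix x assume "x \<in> U \<times> {0..1::real}" then show "(Y(m := g)) N x = orb (fst x) N" using Y mN by (auto simp: P_def)
    next
      fix i x assume "i \<in> {m..<N}" "x \<in> U \<times> {0..1::real}"
      then show "(Y(m := g)) i x ^ 2 = (Y(m := g)) (Suc i) x - fst x * of_real (snd x) ^ (2^i)"
        using Y g(2)[of x] by (cases "i = m") (auto simp: P_def F_def)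
    next
      fix i t assume "i \<in> {m..N}" "t \<in> U"
      then show "(Y(m := g)) i (t,1) = orb t i" using Y g1 by (cases "i = m") (auto simp: P_def)
    qed
    then show ?case by blast
  qed
  then obtain Y where Y: "P 1 Y" using N by blast
  have "achain N t (\<lambda>i v. Y i (t,v))" if t: "t \<in> U" for t
  proof -
    have "continuous_on {0..1} (\<lambda>v. Y i (t,v))" if "i \<in> {1..N}" for i
      by (rule continuous_on_compose2[of "U \<times> {0..1}" "Y i"]) (use Y that t in \<open>auto simp: P_def intro!: continuous_intros\<close>)
    then show ?thesis using Y t unfolding achain_def P_def by auto
  qed
  then show ?thesis using Y unfolding P_def by blast
qed

lemma achain_unique:
  assumes Y: "achain N t Y" and Z: "achain N t Z" and t: "t \<in> V N" and i: "1 \<le> i" "i \<le> N" and v: "v \<in> {0..1}"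
  shows "Y i v = Z i v"
  using i(2,1) v
proof (induction i arbitrary: v rule: inc_induct)
  case base then show ?case using Y Z by (auto simp: achain_def)
next
  case (step m)
  show ?case
  proof (rule sqrt_unique[of "{0..1::real}" "Y m" "Z m" 1])
    fix x :: real assume x: "x \<in> {0..1}"
    show "Y m x ^ 2 = Z m x ^ 2" using Y Z step x by (auto simp: achain_def)
    have "Y (Suc m) x - t * of_real x ^ (2^m) \<noteq> 0"
      by (rule chain_nonzero[of t N m x "\<lambda>j. Y j x"]) (use Y t x step in \<open>auto simp: achain_def V_def\<close>)
    moreover have "Y m x ^ 2 = Y (Suc m) x - t * of_real x ^ (2^m)"
      using Y step x by (simp add: achain_def)
    ultimately show "Y m x \<noteq> 0" by fastforce
  qed (use Y Z step in \<open>auto simp: achain_def\<close>)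
qed

text \<open>A branch of the root of order \<open>2^(N-1)\<close> of \<open>orb t N\<close>, namely
  the one asymptotic to \<open>t\<close> at infinity. These are the finite approximations of the
  Boettcher coordinate; \<open>achain_unique\<close> makes the choice unambiguous on
  \<open>V N\<close>.\<close>

definition A :: "nat \<Rightarrow> complex \<Rightarrow> complex" where "A N t = (SOME a. \<exists>Y. achain N t Y \<and> a = Y 1 0)"

lemma A_eq: assumes "achain N t Y" "t \<in> V N" "1 \<le> N" shows "A N t = Y 1 0"
proof -
  have "\<exists>Z. achain N t Z \<and> A N t = Z 1 0"
    unfolding A_def by (rule someI_ex) (use assms in blast)
  then obtain Z where Z: "achain N t Z" "A N t = Z 1 0" by blast
  then show ?thesis using achain_unique[OF Z(1) assms(1,2), of 1 0] assms by simp
qed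

lemma achain_ex: assumes "t \<in> V N" "1 \<le> N" obtains Y where "achain N t Y"
proof -
  obtain e where e: "e > 0" "ball t e \<subseteq> V N" using open_V assms openE by blast
  have sc: "simply_connected (ball t e)" by (intro convex_imp_simply_connected convex_ball)
  obtain Y where "\<forall>t'\<in>ball t e. achain N t' (\<lambda>i v. Y i (t',v))"
    using achain_family[OF open_ball sc e(2) assms(2)] by blast
  then show thesis using that[of "\<lambda>i v. Y i (t,v)"] e by auto
qed

lemma achain_at_0:
  assumes Y: "achain N t Y" and i: "1 \<le> i" "i \<le> N"
  shows "Y i 0 = Y 1 0 ^ (2^(i-1))"
  using i
proof (induction i rule: dec_induct)
  case (step m)
  have m: "m \<in> {1..<N}" using step by auto
  have "Y m 0 ^ 2 = Y (Suc m) 0 - t * of_real 0 ^ (2^m)" using Y m unfolding achain_def by simp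
  then have "Y (Suc m) 0 = (Y 1 0 ^ (2^(m-1))) ^ 2" using step by simp
  also have "\<dots> = Y 1 0 ^ (2^(m-1) * 2)" by (simp only: power_mult)
  also have "2^(m-1) * 2 = (2::nat) ^ m" using step by (cases m) auto
  finally show ?case by simp
qed auto

lemma A_power: assumes "t \<in> V N" "1 \<le> N" shows "A N t ^ (2^(N-1)) = orb t N"
proof -
  obtain Y where Y: "achain N t Y" using achain_ex assms by blast
  then show ?thesis using achain_at_0[OF Y, of N] A_eq[OF Y assms] assms by (auto simp: achain_def)
qed

lemma continuous_on_A: assumes "1 \<le> N" shows "continuous_on (V N) (A N)"
proof (rule continuous_at_imp_continuous_on, rule ballI)
  fix t assume t: "t \<in> V N"
  obtain e where e: "e > 0" "ball t e \<subseteq> V N" using open_V t openE by blast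
  have sc: "simply_connected (ball t e)" by (intro convex_imp_simply_connected convex_ball)
  obtain Y where Y: "\<forall>i\<in>{1..N}. continuous_on (ball t e \<times> {0..1}) (Y i)"
      "\<forall>t'\<in>ball t e. achain N t' (\<lambda>i v. Y i (t',v))"
    using achain_family[OF open_ball sc e(2) assms] by blast
  have "continuous_on (ball t e) (\<lambda>s. Y 1 (s,0))"
    by (rule continuous_on_compose2[of "ball t e \<times> {0..1}" "Y 1"]) (use Y assms in \<open>auto intro!: continuous_intros\<close>)
  moreover have "Y 1 (s,0) = A N s" if s: "s \<in> ball t e" for s
  proof -
    have "achain N s (\<lambda>i v. Y i (s,v))" using Y(2) s by blast
    from A_eq[OF this] show ?thesis using s e assms by auto
  qed
  ultimately have "continuous_on (ball t e) (A N)" by (rule continuous_on_eq)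
  then show "isCont (A N) t" using e by (simp add: continuous_on_eq_continuous_at)
qed

text \<open>Locally the continuous root differs from a holomorphic one by a root of unity, which is
  constant.\<close>

lemma holomorphic_root:
  assumes S: "open S" and cont: "continuous_on S f" and n: "n > 0" and hol: "h holomorphic_on S"
    and eq: "\<And>z. z \<in> S \<Longrightarrow> f z ^ n = h z" and nz: "\<And>z. z \<in> S \<Longrightarrow> h z \<noteq> 0"
  shows "f holomorphic_on S"
proof -
  have "\<exists>e>0. ball z e \<subseteq> S \<and> f holomorphic_on ball z e" if z: "z \<in> S" for z
  proof -
    obtain e where e: "e > 0" "ball z e \<subseteq> S" using S z openE by blast
    have sc: "simply_connected (ball z e)" by (intro convex_imp_simply_connected convex_ball)
    have "\<forall>f. f holomorphic_on ball z e \<and> (\<forall>w\<in>ball z e. f w \<noteq> 0) \<longrightarrow>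
        (\<exists>g. g holomorphic_on ball z e \<and> (\<forall>w\<in>ball z e. f w = exp (g w)))"
      using sc unfolding simply_connected_eq_holomorphic_log[OF open_ball] by blast
    moreover have "h holomorphic_on ball z e" using hol e(2) by (rule holomorphic_on_subset)
    moreover have "\<forall>w\<in>ball z e. h w \<noteq> 0" using nz e by blast
    ultimately obtain g where g: "g holomorphic_on ball z e" "\<And>w. w \<in> ball z e \<Longrightarrow> h w = exp (g w)" by blast
    define k where "k = (\<lambda>w. exp (g w / of_nat n))"
    have kh: "k holomorphic_on ball z e" unfolding k_def by (intro holomorphic_intros g) (use n in auto)
    have kn: "k w ^ n = h w" if "w \<in> ball z e" for w
      using g(2)[OF that] n by (simp add: k_def exp_of_nat_mult[symmetric])
    have knz: "k w \<noteq> 0" for w by (simp add: k_def)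
    have "f w / k w = f z / k z" if "w \<in> ball z e" for w
    proof (rule root_of_unity_constant[of "ball z e" "\<lambda>w. f w / k w" n 1])
      show "continuous_on (ball z e) (\<lambda>w. f w / k w)"
        by (intro continuous_intros continuous_on_subset[OF cont e(2)] holomorphic_on_imp_continuous_on kh) (use knz in auto)
      show "(f x / k x) ^ n = 1" if "x \<in> ball z e" for x
        using eq[of x] kn[OF that] nz[of x] that e by (auto simp: power_divide)
    qed (use n that e in auto)
    then have "f w = f z / k z * k w" if "w \<in> ball z e" for w
      using that knz[of w] by (metis nonzero_divide_eq_eq)
    moreover have "(\<lambda>w. f z / k z * k w) holomorphic_on ball z e" by (intro holomorphic_intros kh)
    ultimately have "f holomorphic_on ball z e" by (metis holomorphic_cong)
    then show ?thesis using e by blast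
  qed
  then have "f analytic_on S" unfolding analytic_on_def by blast
  then show ?thesis by (rule analytic_imp_holomorphic)
qed

lemma holomorphic_A: "1 \<le> N \<Longrightarrow> A N holomorphic_on V N"
  by (rule holomorphic_root[OF open_V continuous_on_A _ holomorphic_orb[of N] A_power]) (auto simp: V_def)

text \<open>The square stays in a disc about 1 that avoids the negative axis, so \<open>f\<close>,
  being 1 at the end point 1, never meets the imaginary axis. In the right half plane
  \<open>f v + 1\<close> has modulus at least 1, and \<open>f v ^ 2 - 1\<close> factors.\<close>

lemma sqrt_close:
  fixes f :: "real \<Rightarrow> complex"
  assumes cont: "continuous_on {0..1} f" and f1: "f 1 = 1" and b: "\<beta> < 1"
    and le: "\<And>v. v \<in> {0..1} \<Longrightarrow> cmod (f v ^ 2 - 1) \<le> \<beta>" and v: "v \<in> {0..1}"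
  shows "cmod (f v - 1) \<le> \<beta>"
proof -
  have Re0: "Re (f w) \<noteq> 0" if "w \<in> {0..1}" for w
  proof
    assume "Re (f w) = 0"
    then have "f w ^ 2 = - of_real (Im (f w) ^ 2)" by (simp add: complex_eq_iff power2_eq_square)
    then have "cmod (f w ^ 2 - 1) = cmod (of_real (- (Im (f w) ^ 2) - 1))" by simp
    also have "\<dots> = Im (f w) ^ 2 + 1"
      using zero_le_power2[of "Im (f w)"] unfolding norm_of_real by linarith
    finally show False using le[OF that] b zero_le_power2[of "Im (f w)"] by linarith
  qed
  have pos: "0 < Re (f v)"
  proof (rule ccontr)
    assume "\<not> 0 < Re (f v)"
    then have "\<exists>x\<ge>v. x \<le> 1 \<and> Re (f x) = 0"
      using v f1 by (intro IVT') (auto intro!: continuous_intros continuous_on_subset[OF cont])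
    then show False using Re0 v by auto
  qed
  have "1 \<le> Re (f v + 1)" using pos by simp
  also have "\<dots> \<le> cmod (f v + 1)" by (rule complex_Re_le_cmod)
  finally have "cmod (f v - 1) * 1 \<le> cmod (f v - 1) * cmod (f v + 1)" by (intro mult_left_mono) auto
  also have "\<dots> = cmod (f v ^ 2 - 1)" by (simp add: norm_mult[symmetric] power2_eq_square algebra_simps)
  also have "\<dots> \<le> \<beta>" using le[OF v] .
  finally show ?thesis by simp
qed

lemma orb_large:
  assumes "10 \<le> cmod t" "1 \<le> i" 
  shows "cmod t \<le> cmod (orb t i)" "9 * cmod (orb t i) \<le> cmod (orb t (Suc i))"
proof -
  have 2: "2 < cmod (orb t i)" using V_large[of t i] assms by (auto simp: V_def)
  show ge: "cmod t \<le> cmod (orb t i)" by (rule param_le_orb[OF 2])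
  have "cmod (orb t i) * 9 \<le> cmod (orb t i) * (cmod (orb t i) - 1)"
    using ge assms by (intro mult_left_mono) auto
  also have "\<dots> \<le> cmod (orb t (Suc i))" by (rule orb_step[OF 2 ge])
  finally show "9 * cmod (orb t i) \<le> cmod (orb t (Suc i))" by simp
qed

text \<open>The exponential form of the bound reproduces itself under a square root. With
  \<open>a\<close> and \<open>b\<close> the moduli at consecutive times, the subtracted multiple of
  \<open>t\<close> costs a factor \<open>exp (1 / a)\<close>, and \<open>2 / b \<le> 1 / a\<close>
  because the orbit grows at least ninefold.\<close>

lemma achain_close:
  assumes t: "10 \<le> cmod t" and Y: "achain N t Y" and i: "1 \<le> i" "i \<le> N" and v: "v \<in> {0..1}"
  shows "cmod (Y i v / orb t i - 1) \<le> exp (2 / cmod (orb t i)) - 1"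
  using i(2,1) v
proof (induction i arbitrary: v rule: inc_induct)
  case base
  have "orb t N \<noteq> 0" using orb_large(1)[OF t, of N] base t by auto
  then show ?case using Y base by (simp add: achain_def)
next
  case (step m)
  define a where "a = cmod (orb t m)"
  define b where "b = cmod (orb t (Suc m))"
  have m: "m \<in> {1..<N}" "m \<in> {1..N}" "Suc m \<in> {1..N}" using step by auto
  have a: "cmod t \<le> a" "10 \<le> a" and b: "9 * a \<le> b"
    using orb_large[OF t, of m] step t by (auto simp: a_def b_def)
  have cn: "orb t m \<noteq> 0" "orb t (Suc m) \<noteq> 0" using a b by (auto simp: a_def b_def)
  have exb: "exp (2 / a) - 1 < 1"
  proof -
    have "2 / a \<le> 1/5" using a by (simp add: field_simps)
    then have "exp (2/a) \<le> exp (1/5)" by simp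
    also have "exp (1/5::real) \<le> 1 + 1/5 + (1/5)^2" by (rule exp_bound) auto
    finally show ?thesis by (simp add: power2_eq_square)
  qed
  show ?case
  proof (rule sqrt_close[of "\<lambda>v. Y m v / orb t m" "exp (2 / cmod (orb t m)) - 1"])
    show "continuous_on {0..1} (\<lambda>v. Y m v / orb t m)"
      using Y m by (intro continuous_intros) (auto simp: achain_def cn)
    show "Y m 1 / orb t m = 1" using Y m cn by (simp add: achain_def)
    show "exp (2 / cmod (orb t m)) - 1 < 1" using exb by (simp add: a_def)
    fix w :: real assume w: "w \<in> {0..1}"
    define \<kappa> where "\<kappa> = cmod t / a^2"
    have k0: "0 \<le> \<kappa>" by (simp add: \<kappa>_def)
    have k: "\<kappa> \<le> 1/a"
    proof -
      have "cmod t / a^2 \<le> a / a^2" using a by (intro divide_right_mono) auto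
      then show ?thesis using a by (simp add: \<kappa>_def power2_eq_square)
    qed
    have IH: "cmod (Y (Suc m) w / orb t (Suc m) - 1) \<le> exp (2 / b) - 1"
      using step.IH[of w] w step.hyps by (auto simp: b_def)
    have eq: "(Y m w / orb t m)^2 - 1 = (orb t (Suc m) * (Y (Suc m) w / orb t (Suc m) - 1) + t * of_real (1 - w ^ (2^m))) / orb t m ^ 2"
    proof -
      have "Y m w ^ 2 = Y (Suc m) w - t * of_real w ^ (2^m)" using Y m w by (auto simp: achain_def)
      moreover have "orb t (Suc m) * (Y (Suc m) w / orb t (Suc m) - 1) = Y (Suc m) w - orb t (Suc m)"
        using cn by (simp add: algebra_simps)
      ultimately have "orb t (Suc m) * (Y (Suc m) w / orb t (Suc m) - 1) + t * of_real (1 - w ^ (2^m))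
          = Y m w ^ 2 - orb t m ^ 2" by (simp add: orb_Suc algebra_simps)
      then show ?thesis using cn(1) by (simp add: power_divide diff_divide_distrib)
    qed
    have "cmod ((Y m w / orb t m)^2 - 1) \<le> (b * (exp (2/b) - 1) + cmod t * 1) / a^2"
    proof -
      have "cmod (orb t (Suc m) * (Y (Suc m) w / orb t (Suc m) - 1) + t * of_real (1 - w ^ (2^m))) 
           \<le> b * (exp (2/b) - 1) + cmod t * 1"
      proof (rule norm_triangle_le, rule add_mono)
        show "cmod (orb t (Suc m) * (Y (Suc m) w / orb t (Suc m) - 1)) \<le> b * (exp (2/b) - 1)"
          using IH by (simp add: norm_mult b_def mult_left_mono)
        have "w ^ (2^m) \<le> 1" "0 \<le> w ^ (2^m)" using w by (auto intro!: power_le_one)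
        then have "\<bar>1 - w ^ (2^m)\<bar> \<le> 1" by linarith
        then show "cmod (t * of_real (1 - w ^ (2^m))) \<le> cmod t * 1"
          unfolding norm_mult norm_of_real by (intro mult_left_mono) auto
      qed
      then show ?thesis unfolding eq norm_divide norm_power a_def by (intro divide_right_mono) auto
    qed
    also have "\<dots> \<le> (1 + \<kappa>) * (exp (2/b) - 1) + \<kappa>"
    proof -
      have "b \<le> a^2 + cmod t" unfolding a_def b_def orb_Suc by (metis norm_power norm_triangle_ineq)
      then have "b * (exp (2/b) - 1) \<le> (a^2 + cmod t) * (exp (2/b) - 1)"
        using b a by (intro mult_right_mono) auto
      then have "(b * (exp (2/b) - 1) + cmod t * 1) / a^2 \<le> ((a^2 + cmod t) * (exp (2/b) - 1) + cmod t) / a^2"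
        by (intro divide_right_mono) auto
      also have "\<dots> = (1 + \<kappa>) * (exp (2/b) - 1) + \<kappa>" using a by (simp add: \<kappa>_def field_simps)
      finally show ?thesis .
    qed
    also have "\<dots> = (1 + \<kappa>) * exp (2/b) - 1" by (simp add: algebra_simps)
    also have "\<dots> \<le> exp (1/a) * exp (2/b) - 1"
    proof -
      have "1 + \<kappa> \<le> exp (1/a)" using exp_ge_add_one_self[of "1/a"] k by linarith
      then show ?thesis by (simp add: mult_right_mono)
    qed
    also have "\<dots> = exp (1/a + 2/b) - 1" by (simp add: exp_add)
    also have "\<dots> \<le> exp (2/a) - 1"
    proof -
      have "2/b \<le> 2/(9*a)" using a b by (intro divide_left_mono) auto
      also have "\<dots> \<le> 1/a" using a by (simp add: field_simps)
      finally show ?thesis by simp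
    qed
    finally show "cmod ((Y m w / orb t m)^2 - 1) \<le> exp (2 / cmod (orb t m)) - 1" by (simp add: a_def)
  qed (use step in auto)
qed

lemma A_asymp:
  assumes "10 \<le> cmod t" "1 \<le> N" shows "cmod (A N t / t - 1) \<le> exp (2 / cmod t) - 1"
proof -
  have t: "t \<in> V N" using assms V_large by auto
  obtain Y where Y: "achain N t Y" using achain_ex[OF t assms(2)] by blast
  show ?thesis using achain_close[OF assms(1) Y, of 1 0] A_eq[OF Y t assms(2)] assms by auto
qed

section \<open>Exterior maps tangent to the identity at infinity\<close>

lemma tendsto_1_at_infinity:
  fixes G :: "complex \<Rightarrow> complex"
  assumes "\<And>t. 10 \<le> cmod t \<Longrightarrow> cmod (G t - 1) \<le> exp (C / cmod t) - 1"
  shows "(G \<longlongrightarrow> 1) at_infinity"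
proof -
  have "((\<lambda>t. C / cmod t) \<longlongrightarrow> 0) (at_infinity :: complex filter)"
    by (intro tendsto_divide_0[OF tendsto_const] filterlim_at_top_imp_at_infinity filterlim_norm_at_top)
  then have "((\<lambda>t. exp (C / cmod t) - 1) \<longlongrightarrow> exp 0 - 1) (at_infinity :: complex filter)"
    by (intro tendsto_intros)
  then have "((\<lambda>t. exp (C / cmod t) - 1) \<longlongrightarrow> 0) (at_infinity :: complex filter)" by simp
  then have "((\<lambda>t. G t - 1) \<longlongrightarrow> 0) at_infinity"
    by (rule Lim_null_comparison[rotated]) (use assms in \<open>auto simp: eventually_at_infinity\<close>)
  then show ?thesis by (simp add: LIM_zero_iff)
qed

lemma holomorphic_at_puncture:
  assumes W: "open W" and hol: "f holomorphic_on (W - {p})" and df: "(f has_field_derivative f') (at p)"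
  shows "f holomorphic_on W"
proof (subst holomorphic_on_open[OF W], intro ballI)
  fix u assume u: "u \<in> W"
  show "\<exists>f'. (f has_field_derivative f') (at u)"
  proof (cases "u = p")
    case True then show ?thesis using df by blast
  next
    case False
    then show ?thesis using hol u open_Diff[OF W closed_singleton, of p] by (auto simp: holomorphic_on_open)
  qed
qed

text \<open>Inversion turns infinity into a simple zero at the origin: the asymptotics give the
  derivative \<open>r\<close> there, and closed superlevel sets give the compactness that
  \<open>proper_simple_zero_imp_bij\<close> asks for.\<close>

lemma exterior_bij:
  fixes G :: "complex \<Rightarrow> complex"
  assumes U: "open U" "\<And>t. 10 < cmod t \<Longrightarrow> t \<in> U" "0 \<notin> U" and r: "r > 0"
    and hol: "G holomorphic_on U" and gt: "\<And>t. t \<in> U \<Longrightarrow> r < cmod (G t)"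
    and lim: "((\<lambda>t. G t / t) \<longlongrightarrow> 1) at_infinity"
    and closed: "\<And>s. r < s \<Longrightarrow> closed {t \<in> U. s \<le> cmod (G t)}"
  shows "bij_betw G U {y. r < cmod y}"
proof -
  define W where "W = {x. x = 0 \<or> inverse x \<in> U}"
  define f where "f = (\<lambda>x. if x = 0 then 0 else of_real r / G (inverse x))"
  have Gnz: "G t \<noteq> 0" if "t \<in> U" for t using gt[OF that] r by auto
  have W0: "W - {0} = {x. x \<noteq> 0 \<and> inverse x \<in> U}" by (auto simp: W_def)
  have oW0: "open (W - {0})"
  proof -
    have "open ((- {0::complex}) \<inter> inverse -` U)"
      by (rule continuous_open_preimage) (auto intro!: continuous_intros U)
    moreover have "W - {0} = (- {0}) \<inter> inverse -` U" by (auto simp: W_def)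
    ultimately show ?thesis by simp
  qed
  have bW: "ball 0 (1/10) \<subseteq> W"
  proof
    fix x :: complex assume "x \<in> ball 0 (1/10)"
    then have "cmod x < 1/10" by simp
    then have "x = 0 \<or> 10 < cmod (inverse x)"
      using less_imp_inverse_less[of "cmod x" "1/10"] by (cases "x = 0") (auto simp: norm_inverse)
    then show "x \<in> W" using U(2) by (auto simp: W_def)
  qed
  have "W = (W - {0}) \<union> ball 0 (1/10)" using bW by (auto simp: W_def)
  then have oW: "open W" using oW0 by (metis open_Un open_ball)
  have hol0: "f holomorphic_on (W - {0})"
  proof (rule holomorphic_transform[of "\<lambda>x. of_real r / G (inverse x)"])
    have "(G \<circ> inverse) holomorphic_on (W - {0})"
      by (rule holomorphic_on_compose_gen[OF _ hol]) (auto intro!: holomorphic_intros simp: W_def)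
    then show "(\<lambda>x. of_real r / G (inverse x)) holomorphic_on (W - {0})"
      by (intro holomorphic_intros) (auto simp: o_def W_def Gnz)
  qed (auto simp: f_def)
  have "((\<lambda>x. G (inverse x) / inverse x) \<longlongrightarrow> 1) (at 0)"
    by (rule filterlim_compose[OF lim filterlim_inverse_at_infinity])
  then have "((\<lambda>x. of_real r / (G (inverse x) / inverse x)) \<longlongrightarrow> of_real r / 1) (at 0)"
    by (intro tendsto_intros) auto
  then have "((\<lambda>x. of_real r / (G (inverse x) / inverse x)) \<longlongrightarrow> of_real r) (at 0)" by simp
  then have "((\<lambda>x. (f x - f 0) / (x - 0)) \<longlongrightarrow> of_real r) (at 0)"
    by (rule Lim_transform_eventually) (simp add: f_def eventually_at_filter divide_simps)
  then have df: "(f has_field_derivative of_real r) (at 0)" by (simp add: has_field_derivative_iff)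
  have holf: "f holomorphic_on W" by (rule holomorphic_at_puncture[OF oW hol0 df])
  have bij: "bij_betw f W (ball 0 1)"
  proof (rule proper_simple_zero_imp_bij[OF oW holf, of 0])
    show "cmod (f x) < 1" if "x \<in> W" for x
    proof (cases "x = 0")
      case False
      then have "r < cmod (G (inverse x))" using gt that by (auto simp: W_def)
      moreover then have "0 < cmod (G (inverse x))" using r by linarith
      ultimately show ?thesis using r False by (simp add: f_def norm_divide divide_less_eq)
    qed (simp add: f_def)
    show "compact {x \<in> W. cmod (f x) \<le> s}" if s: "s < 1" for s
    proof (cases "s \<le> 0")
      case True
      have "{x \<in> W. cmod (f x) \<le> s} \<subseteq> {0}"
      proof
        fix x assume "x \<in> {x \<in> W. cmod (f x) \<le> s}"
        then have "x \<in> W" "cmod (f x) \<le> s" by auto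
        moreover then have "cmod (f x) = 0" using True norm_ge_zero[of "f x"] by linarith
        ultimately have "x \<in> W" "f x = 0" by auto
        then show "x \<in> {0}" using Gnz[of "inverse x"] r by (auto simp: f_def W_def split: if_splits)
      qed
      then show ?thesis by (metis finite.emptyI finite_imp_compact finite_insert finite_subset)
    next
      case False
      then have s0: "0 < s" by simp
      define T where "T = {t \<in> U. r / s \<le> cmod (G t)}"
      have rs: "r < r / s" using s s0 r by (simp add: field_simps)
      have cT: "closed T" unfolding T_def by (rule closed[OF rs])
      have "0 \<notin> T" using U by (auto simp: T_def)
      then obtain \<eta> where \<eta>: "\<eta> > 0" "ball 0 \<eta> \<subseteq> - T"
        using cT by (metis ComplI open_Compl openE)
      have eq: "{x \<in> W. cmod (f x) \<le> s} = {x. x = 0 \<or> inverse x \<in> T}"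
      proof -
        have "cmod (f x) \<le> s \<longleftrightarrow> r / s \<le> cmod (G (inverse x))" if "x \<noteq> 0" "inverse x \<in> U" for x
        proof -
          have "0 < cmod (G (inverse x))" using gt[OF that(2)] r by linarith
          then show ?thesis using r s0 that(1) by (simp add: f_def norm_divide pos_divide_le_eq mult.commute)
        qed
        then show ?thesis using s0 by (auto simp: W_def T_def f_def)
      qed
      have bdd: "cmod x \<le> 1/\<eta>" if "x = 0 \<or> inverse x \<in> T" for x
      proof (cases "x = 0")
        case False
        then have "inverse x \<notin> ball 0 \<eta>" using \<eta> that by auto
        then have "\<eta> \<le> inverse (cmod x)" by (simp add: norm_inverse)
        then have "inverse (inverse (cmod x)) \<le> inverse \<eta>" using \<eta>(1) by (intro le_imp_inverse_le)
        then show ?thesis by (simp add: inverse_eq_divide)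
      qed (use \<eta> in auto)
      have "closed {x. x = 0 \<or> inverse x \<in> T}"
        unfolding closed_sequential_limits
      proof (intro allI impI, elim conjE)
        fix X l assume X: "\<forall>n. X n \<in> {x. x = 0 \<or> inverse x \<in> T}" and l: "X \<longlonglongrightarrow> l"
        show "l \<in> {x. x = 0 \<or> inverse x \<in> T}"
        proof (cases "l = 0")
          case False
          then have "eventually (\<lambda>n. X n \<noteq> 0) sequentially" using tendsto_imp_eventually_ne[OF l] by blast
          then have "eventually (\<lambda>n. inverse (X n) \<in> T) sequentially"
            by (rule eventually_mono) (use X in auto)
          then have "inverse l \<in> T"
            by (rule Lim_in_closed_set[OF cT]) (auto intro!: tendsto_intros l False)
          then show ?thesis by simp
        qed simp
      qed
      moreover have "bounded {x. x = 0 \<or> inverse x \<in> T}" using bdd by (intro boundedI[of _ "1/\<eta>"]) blast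
      ultimately show ?thesis unfolding eq compact_eq_bounded_closed by blast
    qed
    show "deriv f 0 \<noteq> 0" using DERIV_imp_deriv[OF df] r by simp
    show "x = 0" if "x \<in> W" "f x = 0" for x
      using that Gnz[of "inverse x"] r by (auto simp: f_def W_def split: if_splits)
  qed (auto simp: W_def f_def)
  show ?thesis
  proof (rule bij_betw_imageI)
    show "inj_on G U"
    proof (rule inj_onI)
      fix a b assume ab: "a \<in> U" "b \<in> U" "G a = G b"
      have nz: "a \<noteq> 0" "b \<noteq> 0" using U ab by auto
      then have "f (inverse a) = f (inverse b)" using ab by (simp add: f_def)
      then have "inverse a = inverse b"
        using inj_onD[OF bij_betw_imp_inj_on[OF bij], of "inverse a" "inverse b"] ab by (simp add: W_def)
      then show "a = b" by simp
    qed
    show "G ` U = {y. r < cmod y}"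
    proof (intro equalityI subsetI)
      fix y assume y: "y \<in> {y. r < cmod y}"
      then have "0 < cmod y" using r unfolding mem_Collect_eq by linarith
      then have "of_real r / y \<in> ball 0 1" using r y by (simp add: norm_divide divide_less_eq)
      then have "of_real r / y \<in> f ` W" using bij by (simp add: bij_betw_def)
      then obtain x where x: "x \<in> W" "f x = of_real r / y" by auto
      have ynz: "y \<noteq> 0" using y r by auto
      then have "x \<noteq> 0" using x r by (auto simp: f_def)
      then have "G (inverse x) = y" "inverse x \<in> U"
        using x r ynz Gnz[of "inverse x"] by (auto simp: f_def W_def field_simps)
      then show "y \<in> G ` U" by blast
    qed (use gt in auto)
  qed
qed

definition E :: "nat \<Rightarrow> complex set" where "E N = {y. 2 < cmod y ^ (2^(N-1))}"

lemma norm_A: assumes "t \<in> V N" "1 \<le> N" shows "cmod (A N t) ^ (2^(N-1)) = cmod (orb t N)"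
  using A_power[OF assms] by (metis norm_power)

lemma E_alt: "E N = {y. root (2^(N-1)) 2 < cmod y}"
proof -
  have "2 < cmod y ^ (2^(N-1)) \<longleftrightarrow> root (2^(N-1)) 2 < cmod y" for y
    by (metis norm_ge_zero pos2 real_root_less_iff real_root_power_cancel zero_less_power)
  then show ?thesis by (simp add: E_def)
qed

text \<open>A power of \<open>A N\<close> is a polynomial, which gives the closed superlevel sets.
  The bijection makes \<open>V N\<close> connected and lets a parameter be recognised by its value
  under \<open>A N\<close>.\<close>

lemma A_bij: assumes "1 \<le> N" shows "bij_betw (A N) (V N) (E N)"
  unfolding E_alt
proof (rule exterior_bij)
  show "0 \<notin> V N"
  proof -
    have "orb 0 n = 0" for n by (induction n) (auto simp: orb_Suc)
    then show ?thesis by (simp add: V_def)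
  qed
  show "root (2^(N-1)) 2 < cmod (A N t)" if "t \<in> V N" for t
    using norm_A[OF that assms] that E_alt[of N] by (auto simp: E_def V_def)
  show "closed {t \<in> V N. s \<le> cmod (A N t)}" if s: "root (2^(N-1)) 2 < s" for s
  proof -
    have s0: "0 < s" using s by (smt (verit) real_root_gt_zero zero_less_numeral zero_less_power pos2)
    have 2: "2 < s ^ (2^(N-1))"
    proof -
      have "cmod (of_real s) = s" using s0 by simp
      then show ?thesis using E_alt[of N] s by (metis (mono_tags, lifting) E_def mem_Collect_eq)
    qed
    have "{t \<in> V N. s \<le> cmod (A N t)} = {t. s ^ (2^(N-1)) \<le> cmod (orb t N)}"
    proof (intro equalityI subsetI)
      fix t assume "t \<in> {t \<in> V N. s \<le> cmod (A N t)}"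
      then show "t \<in> {t. s ^ (2^(N-1)) \<le> cmod (orb t N)}"
        using norm_A[of t N] assms power_mono[of s "cmod (A N t)" "2^(N-1)"] s0 by simp
    next
      fix t assume t: "t \<in> {t. s ^ (2^(N-1)) \<le> cmod (orb t N)}"
      then have tV: "t \<in> V N" using 2 by (simp add: V_def)
      then have "s ^ (2^(N-1)) \<le> cmod (A N t) ^ (2^(N-1))" using t norm_A[OF tV assms] by simp
      then have "s \<le> cmod (A N t)" using s0 by (metis norm_ge_zero pos2 power_mono_iff less_imp_le zero_less_power)
      then show "t \<in> {t \<in> V N. s \<le> cmod (A N t)}" using tV by simp
    qed
    moreover have "closed {t. s ^ (2^(N-1)) \<le> cmod (orb t N)}"
      by (intro closed_Collect_le continuous_intros continuous_on_orb)
    ultimately show ?thesis by simp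
  qed
  show "((\<lambda>t. A N t / t) \<longlongrightarrow> 1) at_infinity"
    by (rule tendsto_1_at_infinity[of _ 2]) (use A_asymp assms in auto)
qed (use open_V V_large holomorphic_A assms in auto)

lemma connected_exterior: "connected {y::complex. r < cmod y}"
proof -
  have "connected (- cball (0::complex) r)" by (rule connected_complement_bounded_convex) auto
  moreover have "- cball (0::complex) r = {y. r < cmod y}" by auto
  ultimately show ?thesis by simp
qed

lemma A_inverse:
  assumes "1 \<le> N"
  obtains g where "continuous_on (E N) g" "\<And>t. t \<in> V N \<Longrightarrow> g (A N t) = t" 
    "\<And>y. y \<in> E N \<Longrightarrow> g y \<in> V N \<and> A N (g y) = y"
proof -
  have b: "inj_on (A N) (V N)" "A N ` V N = E N" using A_bij[OF assms] by (auto simp: bij_betw_def)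
  obtain g where g: "g holomorphic_on (A N ` V N)" "\<And>z. z \<in> V N \<Longrightarrow> g (A N z) = z"
    using holomorphic_has_inverse[OF holomorphic_A[OF assms] open_V b(1)] by metis
  have "g y \<in> V N \<and> A N (g y) = y" if "y \<in> E N" for y
    using that b(2) g(2) by (metis imageE)
  then show thesis using that[of g] g b holomorphic_on_imp_continuous_on by metis
qed

lemma connected_V: assumes "1 \<le> N" shows "connected (V N)"
proof -
  obtain g where g: "continuous_on (E N) g" "\<And>t. t \<in> V N \<Longrightarrow> g (A N t) = t" 
    "\<And>y. y \<in> E N \<Longrightarrow> g y \<in> V N \<and> A N (g y) = y" using A_inverse[OF assms] by blast
  have "V N = g ` E N"
  proof
    show "V N \<subseteq> g ` E N" using g(2) A_bij[OF assms] by (metis bij_betwE image_iff subsetI)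
    show "g ` E N \<subseteq> V N" using g(3) by blast
  qed
  moreover have "connected (E N)" unfolding E_alt by (rule connected_exterior)
  ultimately show ?thesis using connected_continuous_image[OF g(1)] by simp
qed

lemma deriv_A_nonzero: assumes "1 \<le> N" "t \<in> V N" shows "deriv (A N) t \<noteq> 0"
  using holomorphic_injective_imp_regular[OF holomorphic_A[OF assms(1)] open_V _ assms(2)] A_bij[OF assms(1)]
  by (simp add: bij_betw_def)

text \<open>Makes the centre of the disc a simple value, as the two-zero estimate requires.\<close>

lemma deriv_orb_nonzero:
  assumes "1 \<le> N" "t \<in> V N" shows "deriv (\<lambda>t. orb t N) t \<noteq> 0"
proof -
  let ?D = "2^(N-1) :: nat"
  have "(A N has_field_derivative deriv (A N) t) (at t)"
    using holomorphic_A[OF assms(1)] assms(2) open_V by (simp add: holomorphic_derivI)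
  then have "((\<lambda>t. A N t ^ ?D) has_field_derivative (of_nat ?D * (deriv (A N) t * A N t ^ (?D - 1)))) (at t)"
    using DERIV_power[of "A N" "deriv (A N) t" t UNIV ?D] by (simp add: mult.commute mult.left_commute)
  then have "((\<lambda>t. orb t N) has_field_derivative (of_nat ?D * (deriv (A N) t * A N t ^ (?D - 1)))) (at t)"
    by (rule has_field_derivative_transform_within_open[OF _ open_V[of N] assms(2)])
       (use A_power assms in auto)
  then have "deriv (\<lambda>t. orb t N) t = of_nat ?D * (deriv (A N) t * A N t ^ (?D - 1))" by (rule DERIV_imp_deriv)
  moreover have "A N t \<noteq> 0" using norm_A[OF assms(2,1)] assms(2) by (auto simp: V_def power_0_left)
  ultimately show ?thesis using deriv_A_nonzero[OF assms] by simp
qed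

section \<open>The Boettcher coordinate of the parameter plane\<close>

text \<open>Since \<open>orb t (Suc m) = orb t m ^ 2 * exp (L m t)\<close> on \<open>V m\<close>,
  the series \<open>S\<close> below is the logarithm of the infinite product that corrects
  \<open>orb t n\<close> to a power of the Boettcher coordinate.\<close>

definition L :: "nat \<Rightarrow> complex \<Rightarrow> complex" where "L m t = Ln (1 + t / orb t m ^ 2)"
definition S :: "nat \<Rightarrow> complex \<Rightarrow> complex" where "S n t = (\<Sum>j. L (n + j) t / 2 ^ Suc j)"

lemma ratio_bound:
  assumes t: "t \<in> V n" and m: "n \<le> m"
  shows "cmod (t / orb t m ^ 2) \<le> cmod t / cmod (orb t n) ^ 2" "cmod t / cmod (orb t n) ^ 2 \<le> 1 / cmod (orb t n)"
    "1 / cmod (orb t n) < 1/2"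
proof -
  have 2: "2 < cmod (orb t n)" using t by (simp add: V_def)
  then show "1 / cmod (orb t n) < 1/2" by (simp add: divide_less_eq)
  have "cmod (orb t n) \<le> cmod (orb t m)"
    using m orb_strict[OF 2 param_le_orb[OF 2], of m] by (cases "m = n") auto
  then have "cmod (orb t n) ^ 2 \<le> cmod (orb t m) ^ 2" by (rule power_mono) simp
  then show "cmod (t / orb t m ^ 2) \<le> cmod t / cmod (orb t n) ^ 2"
    unfolding norm_divide norm_power using 2 \<open>cmod (orb t n) \<le> cmod (orb t m)\<close>
    by (intro divide_left_mono mult_pos_pos zero_less_power norm_ge_zero) linarith+
  have "cmod t / cmod (orb t n) ^ 2 \<le> cmod (orb t n) / cmod (orb t n) ^ 2"
    using param_le_orb[OF 2] by (rule divide_right_mono) simp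
  also have "\<dots> = 1 / cmod (orb t n)" by (simp add: power2_eq_square)
  finally show "cmod t / cmod (orb t n) ^ 2 \<le> 1 / cmod (orb t n)" .
qed

lemma L_bound:
  assumes "t \<in> V n" "n \<le> m"
  shows "cmod (L m t) \<le> 2 * (cmod t / cmod (orb t n) ^ 2)" "cmod (L m t) \<le> 1"
proof -
  have "cmod (L m t) \<le> 2 * cmod (t / orb t m ^ 2)"
    unfolding L_def by (rule norm_Ln_le) (use ratio_bound[OF assms] in linarith)
  then show "cmod (L m t) \<le> 2 * (cmod t / cmod (orb t n) ^ 2)" "cmod (L m t) \<le> 1"
    using ratio_bound[OF assms] by linarith+
qed

lemma exp_L: assumes "t \<in> V n" "n \<le> m" shows "exp (L m t) = 1 + t / orb t m ^ 2"
proof -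
  have "1 + t / orb t m ^ 2 \<noteq> 0"
  proof
    assume "1 + t / orb t m ^ 2 = 0"
    then have "t / orb t m ^ 2 = - 1" by (simp add: eq_neg_iff_add_eq_0 add.commute)
    then have "cmod (t / orb t m ^ 2) = 1" by simp
    then show False using ratio_bound[OF assms] by linarith
  qed
  then show ?thesis unfolding L_def by (rule exp_Ln)
qed

lemma holomorphic_L: assumes "n \<le> m" shows "L m holomorphic_on V n"
proof -
  have nz: "orb t m \<noteq> 0" if "t \<in> V n" for t using that V_mono[OF assms] by (auto simp: V_def)
  have np: "1 + t / orb t m ^ 2 \<notin> \<real>\<^sub>\<le>\<^sub>0" if t: "t \<in> V n" for t
  proof
    assume "1 + t / orb t m ^ 2 \<in> \<real>\<^sub>\<le>\<^sub>0"
    then have "Re (1 + t / orb t m ^ 2) \<le> 0" by (simp add: complex_nonpos_Reals_iff)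
    then have "1 \<le> \<bar>Re (t / orb t m ^ 2)\<bar>" unfolding plus_complex.sel one_complex.sel by linarith
    also have "\<dots> \<le> cmod (t / orb t m ^ 2)" by (rule abs_Re_le_cmod)
    finally show False using ratio_bound[OF t assms] by linarith
  qed
  have "(\<lambda>t. Ln (1 + t / orb t m ^ 2)) holomorphic_on V n"
    by (intro holomorphic_intros holomorphic_orb) (use nz np in auto)
  then show ?thesis by (simp add: L_def [abs_def])
qed

lemma S_sums: assumes "t \<in> V n" "n \<le> m" shows "(\<lambda>j. L (m + j) t / 2 ^ Suc j) sums S m t"
proof -
  have "summable (\<lambda>j. L (m + j) t / 2 ^ Suc j)"
  proof (rule summable_comparison_test')
    show "summable (\<lambda>j. (1/2::real) ^ Suc j)" using power_half_series sums_summable by blast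
    show "norm (L (m + j) t / 2 ^ Suc j) \<le> (1/2) ^ Suc j" if "j \<ge> 0" for j
      using L_bound(2)[OF assms(1), of "m + j"] assms(2)
      by (simp add: norm_divide norm_power power_divide divide_right_mono del: power_Suc)
  qed
  then show ?thesis unfolding S_def by (rule summable_sums)
qed

lemma S_bound:
  assumes "t \<in> V n" shows "cmod (S n t) \<le> 2 * (cmod t / cmod (orb t n) ^ 2)"
proof -
  let ?b = "2 * (cmod t / cmod (orb t n) ^ 2)"
  have s: "(\<lambda>j. ?b * (1/2) ^ Suc j) sums (?b * 1)" by (intro sums_mult power_half_series)
  have "norm (L (n + j) t / 2 ^ Suc j) \<le> ?b * (1/2) ^ Suc j" for j
  proof -
    have "norm (L (n + j) t / 2 ^ Suc j) = cmod (L (n + j) t) * (1/2) ^ Suc j"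
      by (simp add: norm_divide norm_power power_divide del: power_Suc)
    also have "\<dots> \<le> ?b * (1/2) ^ Suc j" using L_bound(1)[OF assms, of "n+j"] by (intro mult_right_mono) auto
    finally show ?thesis .
  qed
  then have "cmod (S n t) \<le> (\<Sum>j. ?b * (1/2) ^ Suc j)"
    unfolding S_def by (rule norm_suminf_le[OF _ sums_summable[OF s]])
  then show ?thesis using sums_unique[OF s] by simp
qed

lemma S_step: assumes "t \<in> V n" shows "S n t = L n t / 2 + S (Suc n) t / 2"
proof -
  have "(\<lambda>j. L (n + Suc j) t / 2 ^ Suc (Suc j)) sums (S (Suc n) t / 2)"
    using sums_divide[OF S_sums[OF assms, of "Suc n"], of 2] by (simp add: mult.commute mult.left_commute)
  from sums_Suc[OF this] have "(\<lambda>j. L (n + j) t / 2 ^ Suc j) sums (S (Suc n) t / 2 + L n t / 2)" by simp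
  then show ?thesis using S_sums[OF assms, of n] sums_unique2 by (metis add.commute order_refl)
qed

lemma holomorphic_S: "S n holomorphic_on V n"
proof (rule holomorphic_uniform_sequence[OF open_V])
  show "(\<lambda>t. \<Sum>j<k. L (n + j) t / 2 ^ Suc j) holomorphic_on V n" for k
    by (intro holomorphic_intros holomorphic_L) auto
  fix t assume "t \<in> V n"
  then obtain d where d: "0 < d" "cball t d \<subseteq> V n" using open_V open_contains_cball by metis
  have "uniform_limit (cball t d) (\<lambda>k t. \<Sum>j<k. L (n + j) t / 2 ^ Suc j) (\<lambda>t. \<Sum>j. L (n + j) t / 2 ^ Suc j) sequentially"
  proof (rule Weierstrass_m_test)
    show "summable (\<lambda>j. (1/2::real) ^ Suc j)" using power_half_series sums_summable by blast
    show "norm (L (n + j) x / 2 ^ Suc j) \<le> (1/2) ^ Suc j" if "x \<in> cball t d" for j x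
      using L_bound(2)[of x n "n + j"] d that
      by (auto simp: norm_divide norm_power power_divide divide_right_mono simp del: power_Suc)
  qed
  then show "\<exists>d>0. cball t d \<subseteq> V n \<and> uniform_limit (cball t d) (\<lambda>k t. \<Sum>j<k. L (n + j) t / 2 ^ Suc j) (S n) sequentially"
    using d unfolding S_def[abs_def] by blast
qed

text \<open>Both sides are roots of order \<open>2^N\<close> of \<open>orb t (Suc N)\<close>, so
  their quotient is constant on the connected set \<open>V N\<close>, and it tends to 1 at
  infinity.\<close>

lemma A_Suc_eq:
  assumes N: "1 \<le> N" and t: "t \<in> V N"
  shows "A (Suc N) t = A N t * exp (L N t / 2 ^ N)"
proof -
  have VS: "V N \<subseteq> V (Suc N)" by (rule V_mono) simp
  define g where "g = (\<lambda>t. A (Suc N) t / (A N t * exp (L N t / 2 ^ N)))"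
  have Anz: "A N x \<noteq> 0" if "x \<in> V N" for x using norm_A[OF that N] that by (auto simp: V_def power_0_left)
  have gp: "g x ^ (2^N) = 1" if x: "x \<in> V N" for x
  proof -
    have 2: "2 ^ (N-1) * 2 = (2::nat)^N" using N by (cases N) auto
    have xnz: "orb x N \<noteq> 0" using x by (auto simp: V_def)
    have "(A N x * exp (L N x / 2 ^ N)) ^ (2^N) = A N x ^ (2^N) * exp (L N x / 2^N) ^ (2^N)" by (simp add: power_mult_distrib)
    also have "exp (L N x / 2^N) ^ (2^N) = exp (L N x)"
      by (simp add: exp_of_nat_mult[symmetric])
    also have "A N x ^ (2^N) = orb x N ^ 2" by (simp only: 2[symmetric] power_mult A_power[OF x N])
    also have "orb x N ^ 2 * exp (L N x) = orb x (Suc N)"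
      using exp_L[OF x order_refl] xnz by (simp add: orb_Suc distrib_left)
    also have "\<dots> = A (Suc N) x ^ (2^N)" using A_power[of x "Suc N"] x VS by auto
    finally have "(A N x * exp (L N x / 2 ^ N)) ^ (2^N) = A (Suc N) x ^ (2^N)" .
    moreover have "A N x * exp (L N x / 2 ^ N) \<noteq> 0" using Anz[OF x] by simp
    moreover have "A (Suc N) x \<noteq> 0" using norm_A[of x "Suc N"] x VS by (auto simp: V_def power_0_left)
    ultimately show ?thesis by (simp add: g_def power_divide) 
  qed
  have cg: "continuous_on (V N) g" unfolding g_def
    by (intro continuous_intros continuous_on_A N continuous_on_subset[OF continuous_on_A VS]
        holomorphic_on_imp_continuous_on[OF holomorphic_L]) (use Anz in auto)
  have const: "g x = g t" if "x \<in> V N" for x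
    by (rule root_of_unity_constant[OF connected_V[OF N] cg _ gp that t]) simp_all
  have lim: "(g \<longlongrightarrow> 1) at_infinity"
  proof -
    have l1: "((\<lambda>x. A m x / x) \<longlongrightarrow> 1) at_infinity" if "1 \<le> m" for m
      by (rule tendsto_1_at_infinity[of _ 2]) (use A_asymp that in auto)
    have l2: "(L N \<longlongrightarrow> 0) at_infinity"
    proof (rule Lim_null_comparison)
      have "cmod (L N x) \<le> 2 / cmod x" if "10 \<le> cmod x" for x
      proof -
        have x: "x \<in> V 1" "x \<in> V N" using that N V_large[of x 1] V_large[of x N] by auto
        have "cmod (L N x) \<le> 2 * (1 / cmod x)" using L_bound(1)[OF x(1) N] ratio_bound(2)[OF x(1) order_refl] by simp
        then show ?thesis by simp
      qed
      then show "\<forall>\<^sub>F x in at_infinity. norm (L N x) \<le> 2 / cmod x" by (auto simp: eventually_at_infinity)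
      show "((\<lambda>t. 2 / cmod t) \<longlongrightarrow> 0) (at_infinity :: complex filter)"
        by (intro tendsto_divide_0[OF tendsto_const] filterlim_at_top_imp_at_infinity filterlim_norm_at_top)
    qed
    have "((\<lambda>x. (A (Suc N) x / x) / ((A N x / x) * exp (L N x / 2 ^ N))) \<longlongrightarrow> 1 / (1 * exp (0 / 2^N))) at_infinity"
      by (intro tendsto_intros l1 l2 N) auto
    then have "((\<lambda>x. (A (Suc N) x / x) / ((A N x / x) * exp (L N x / 2 ^ N))) \<longlongrightarrow> 1) at_infinity" by simp
    then show ?thesis
    proof (rule Lim_transform_eventually)
      have "(A (Suc N) x / x) / ((A N x / x) * exp (L N x / 2 ^ N)) = g x" if "1 \<le> cmod x" for x
        using that by (auto simp: g_def)
      then show "\<forall>\<^sub>F x in at_infinity. (A (Suc N) x / x) / ((A N x / x) * exp (L N x / 2 ^ N)) = g x"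
        unfolding eventually_at_infinity by blast
    qed
  qed
  have "(g \<longlongrightarrow> g t) at_infinity"
  proof (rule Lim_transform_eventually[OF tendsto_const])
    have "g t = g x" if "10 \<le> cmod x" for x using const[of x] V_large[of x N] that N by auto
    then show "\<forall>\<^sub>F x in at_infinity. g t = g x" unfolding eventually_at_infinity by blast
  qed
  then have "g t = 1" using lim tendsto_unique trivial_limit_at_infinity by blast
  then show ?thesis using Anz[OF t] by (simp add: g_def)
qed

text \<open>The exterior coordinate of Douady and Hubbard. The least escape time only fixes a
  choice: by \<open>Phi_eq\<close> every \<open>n \<ge> 1\<close> with \<open>t \<in> V n\<close>
  gives the same value.\<close>

definition Phi :: "complex \<Rightarrow> complex" where
  "Phi t = (let n = LEAST n. 1 \<le> n \<and> t \<in> V n in A n t * exp (S n t / 2 ^ (n-1)))"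

lemma Phi_eq: assumes "1 \<le> n" "t \<in> V n" shows "Phi t = A n t * exp (S n t / 2 ^ (n-1))"
proof -
  define m where "m = (LEAST n. 1 \<le> n \<and> t \<in> V n)"
  have m: "1 \<le> m" "t \<in> V m" using LeastI[of "\<lambda>n. 1 \<le> n \<and> t \<in> V n" n] assms by (auto simp: m_def)
  have "m \<le> n" unfolding m_def by (rule Least_le) (use assms in simp)
  then have "A n t * exp (S n t / 2 ^ (n-1)) = A m t * exp (S m t / 2 ^ (m-1))"
  proof (induction n rule: dec_induct)
    case (step k)
    then have k: "1 \<le> k" "t \<in> V k" using m V_mono by auto
    have e: "S k t / 2 ^ (k-1) = L k t / 2 ^ k + S (Suc k) t / 2 ^ k"
      unfolding S_step[OF k(2)] using k(1) by (cases k) (auto simp: add_divide_distrib)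
    show ?case using A_Suc_eq[OF k] step e by (simp add: exp_add mult.assoc)
  qed simp
  then show ?thesis by (simp add: Phi_def m_def Let_def)
qed

lemma Phi_power: assumes "1 \<le> n" "t \<in> V n" shows "Phi t ^ (2^(n-1)) = orb t n * exp (S n t)"
proof -
  have "exp (S n t / 2^(n-1)) ^ (2^(n-1)) = exp (S n t)" by (simp add: exp_of_nat_mult[symmetric])
  then show ?thesis using Phi_eq[OF assms] A_power[OF assms(2,1)] by (simp add: power_mult_distrib)
qed

lemma Phi_bounds:
  assumes "1 \<le> n" "t \<in> V n"
  shows "cmod (orb t n) \<le> 3 * cmod (Phi t) ^ (2^(n-1))" "cmod (Phi t) ^ (2^(n-1)) \<le> 3 * cmod (orb t n)"
proof -
  have "cmod (S n t) \<le> 1" using S_bound[OF assms(2)] ratio_bound[OF assms(2) order_refl] by linarith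
  then have "\<bar>Re (S n t)\<bar> \<le> 1" using abs_Re_le_cmod[of "S n t"] by linarith
  then have R: "- 1 \<le> Re (S n t)" "Re (S n t) \<le> 1" by linarith+
  have e3: "exp (1::real) \<le> 3" using exp_le by simp
  have "exp (Re (S n t)) \<le> exp 1" using R by simp
  then have u: "exp (Re (S n t)) \<le> 3" using e3 by linarith
  have "exp (- Re (S n t)) \<le> exp 1" using R by simp
  then have "exp (- Re (S n t)) \<le> 3" using e3 by linarith
  then have l: "1 \<le> 3 * exp (Re (S n t))" by (simp add: exp_minus field_simps)
  have eq: "cmod (Phi t) ^ (2^(n-1)) = cmod (orb t n) * exp (Re (S n t))"
    unfolding norm_power[symmetric] Phi_power[OF assms] by (simp add: norm_mult)
  show "cmod (Phi t) ^ (2^(n-1)) \<le> 3 * cmod (orb t n)"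
    unfolding eq using mult_left_mono[OF u, of "cmod (orb t n)"] by simp
  show "cmod (orb t n) \<le> 3 * cmod (Phi t) ^ (2^(n-1))"
    unfolding eq using mult_left_mono[OF l, of "cmod (orb t n)"] by simp
qed

text \<open>Here the orbit need not have escaped by time \<open>n\<close>. The bound
  \<open>4 ^ (2^j)\<close> on later values squares at each step, as does the power of
  \<open>Phi t\<close>, so the two are compared at a time of escape and the root of order
  \<open>2^j\<close> is taken.\<close>

lemma Phi_small:
  assumes t: "t \<notin> mandelbrot" and n: "1 \<le> n" "cmod (orb t n) \<le> 2"
  shows "cmod (Phi t) ^ (2^(n-1)) \<le> 12"
proof -
  have "t \<notin> V n" using n by (simp add: V_def)
  then have "t \<notin> V 1" using V_mono[OF n(1)] by blast
  then have t2: "cmod t \<le> 2" by (simp add: V_def)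
  have b: "cmod (orb t (n + j)) + 2 \<le> 4 ^ (2^j)" for j
  proof (induction j)
    case (Suc j)
    have "cmod (orb t (n + Suc j)) + 2 \<le> cmod (orb t (n+j)) ^ 2 + cmod t + 2"
      using norm_triangle_ineq[of "orb t (n+j) ^ 2" t] by (simp add: orb_Suc norm_power)
    also have "\<dots> \<le> (cmod (orb t (n+j)) + 2) ^ 2" using t2 norm_ge_zero[of "orb t (n+j)"] unfolding power2_sum power2_eq_square[of 2] by linarith
    also have "\<dots> \<le> (4 ^ (2^j)) ^ 2" by (rule power_mono[OF Suc]) simp
    also have "\<dots> = 4 ^ (2^Suc j)" by (simp add: power_mult[symmetric] mult.commute)
    finally show ?case .
  qed (use n in simp)
  obtain m0 where m0: "t \<in> V m0" using t notin_mandelbrot_iff by blast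
  define j where "j = m0"
  have tV: "t \<in> V (n + j)" using m0 V_mono[of m0 "n+j"] by (auto simp: j_def)
  have e: "2^(n+j-1) = 2^(n-1) * (2::nat)^j" using n(1) by (simp add: power_add[symmetric])
  have "(cmod (Phi t) ^ (2^(n-1))) ^ (2^j) \<le> 3 * cmod (orb t (n+j))"
    using Phi_bounds(2)[OF _ tV] n(1) unfolding e power_mult by simp
  also have "\<dots> \<le> 3 * 4 ^ (2^j)" using b[of j] by simp
  also have "\<dots> \<le> 3 ^ (2^j) * 4 ^ (2^j)"
  proof -
    have "(3::real) ^ 1 \<le> 3 ^ (2^j)" by (rule power_increasing) auto
    then show ?thesis by (intro mult_right_mono) auto
  qed
  also have "\<dots> = (3 * 4) ^ (2^j)" by (rule power_mult_distrib[symmetric])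
  also have "\<dots> = 12 ^ (2^j)" by simp
  finally show ?thesis using power_mono_iff[of "cmod (Phi t) ^ (2^(n-1))" 12 "2^j"] by simp
qed

text \<open>The number 36 exceeds the bound 12 of \<open>Phi_small\<close>, and divided by the
  factor 3 of \<open>Phi_bounds\<close> it still leaves 12.\<close>

lemma orb_ge_of_Phi:
  assumes t: "t \<notin> mandelbrot" and n: "1 \<le> n" and ge: "36 \<le> cmod (Phi t) ^ (2^(n-1))"
  shows "12 \<le> cmod (orb t n)" "t \<in> V n"
proof -
  show tV: "t \<in> V n" using Phi_small[OF t n] ge by (auto simp: V_def not_le[symmetric])
  show "12 \<le> cmod (orb t n)" using Phi_bounds(2)[OF n tV] ge by linarith
qed

lemma Phi_gt_1: assumes t: "t \<notin> mandelbrot" shows "1 < cmod (Phi t)"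
proof (rule ccontr)
  assume "\<not> 1 < cmod (Phi t)"
  then have le: "cmod (Phi t) \<le> 1" by simp
  obtain n0 where n0: "t \<in> V n0" using t notin_mandelbrot_iff by blast
  have "eventually (\<lambda>m. 4 \<le> cmod (orb t m)) sequentially"
    using orb_tends_to_infinity[OF n0] by (simp add: filterlim_at_top)
  moreover have "eventually (\<lambda>m. 1 \<le> m) sequentially" by (rule eventually_ge_at_top)
  ultimately have "eventually (\<lambda>m. 4 \<le> cmod (orb t m) \<and> 1 \<le> m) sequentially" by (rule eventually_conj)
  then obtain m where m: "4 \<le> cmod (orb t m)" "1 \<le> m"
    using eventually_happens' trivial_limit_sequentially by blast
  have "t \<in> V m" using m by (simp add: V_def)
  then have "cmod (orb t m) \<le> 3 * cmod (Phi t) ^ (2^(m-1))" by (rule Phi_bounds(1)[OF m(2)])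
  moreover have "cmod (Phi t) ^ (2^(m-1)) \<le> 1" using le by (simp add: power_le_one)
  ultimately show False using m by linarith
qed

lemma holomorphic_Phi_V: assumes "1 \<le> n" shows "Phi holomorphic_on V n"
proof -
  have "(\<lambda>t. A n t * exp (S n t / 2 ^ (n-1))) holomorphic_on V n"
    by (intro holomorphic_intros holomorphic_A holomorphic_S assms) simp
  then show ?thesis by (rule holomorphic_transform) (use Phi_eq[OF assms] in auto)
qed

lemma exterior_eq_UN: "- mandelbrot = (\<Union>n. V (Suc n))"
proof
  show "- mandelbrot \<subseteq> (\<Union>n. V (Suc n))"
  proof
    fix t assume "t \<in> - mandelbrot"
    then obtain n where "t \<in> V n" using notin_mandelbrot_iff by blast
    then show "t \<in> (\<Union>n. V (Suc n))" using V_mono[of n "Suc n"] by auto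
  qed
qed (use V_subset in blast)

lemma open_exterior: "open (- mandelbrot)"
  unfolding exterior_eq_UN by (intro open_UN ballI open_V)

lemma holomorphic_Phi: "Phi holomorphic_on - mandelbrot"
  unfolding exterior_eq_UN by (rule holomorphic_on_UN_open) (auto intro: holomorphic_Phi_V open_V)

lemma zero_in_mandelbrot: "0 \<in> mandelbrot"
proof -
  have "orb 0 n = 0" for n by (induction n) (auto simp: orb_Suc)
  then show ?thesis unfolding mandelbrot_iff_bounded by auto
qed

lemma large_notin_mandelbrot: "2 < cmod t \<Longrightarrow> t \<notin> mandelbrot"
  using V_large[of t 1] notin_mandelbrot_iff by blast

lemma A_1: "t \<in> V 1 \<Longrightarrow> A 1 t = t" using A_power[of t 1] by simp

lemma Phi_asymp: "((\<lambda>t. Phi t / t) \<longlongrightarrow> 1) at_infinity"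
proof -
  have b: "cmod (S 1 t) \<le> 2 / cmod t" if "10 \<le> cmod t" for t
  proof -
    have t: "t \<in> V 1" using that V_large[of t 1] by auto
    have "cmod (S 1 t) \<le> 2 * (1 / cmod t)" using S_bound[OF t] ratio_bound(2)[OF t order_refl] by simp
    then show ?thesis by simp
  qed
  have "(S 1 \<longlongrightarrow> 0) at_infinity"
  proof (rule Lim_null_comparison)
    show "\<forall>\<^sub>F x in at_infinity. norm (S 1 x) \<le> 2 / cmod x" using b by (auto simp: eventually_at_infinity)
    show "((\<lambda>t. 2 / cmod t) \<longlongrightarrow> 0) (at_infinity :: complex filter)"
      by (intro tendsto_divide_0[OF tendsto_const] filterlim_at_top_imp_at_infinity filterlim_norm_at_top)
  qed
  then have "((\<lambda>t. exp (S 1 t)) \<longlongrightarrow> exp 0) at_infinity" by (intro tendsto_intros)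
  then have "((\<lambda>t. exp (S 1 t)) \<longlongrightarrow> 1) at_infinity" by simp
  then show ?thesis
  proof (rule Lim_transform_eventually)
    have "exp (S 1 t) = Phi t / t" if "10 \<le> cmod t" for t
    proof -
      have t: "t \<in> V 1" "t \<noteq> 0" using that V_large[of t 1] by auto
      then show ?thesis using Phi_eq[OF _ t(1)] A_1[OF t(1)] by simp
    qed
    then show "\<forall>\<^sub>F t in at_infinity. exp (S 1 t) = Phi t / t" unfolding eventually_at_infinity by blast
  qed
qed

text \<open>Once \<open>s ^ (2^(n-1)) \<ge> 36\<close>, the set is cut out of a closed set on which
  the \<open>n\<close>-th orbit value has modulus at least 12 and \<open>Phi\<close> is
  continuous.\<close>

lemma closed_Phi_ge: assumes s: "1 < s" shows "closed {t \<in> - mandelbrot. s \<le> cmod (Phi t)}"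
proof -
  obtain m where m: "36 < s ^ m" using real_arch_pow[OF s] by blast
  define n where "n = Suc m"
  have n: "1 \<le> n" by (simp add: n_def)
  have "s ^ m \<le> s ^ (2^(n-1))" using s less_imp_le[OF less_exp[of m]] by (intro power_increasing) (auto simp: n_def)
  then have sn: "36 \<le> s ^ (2^(n-1))" using m by linarith
  define C where "C = {t. 12 \<le> cmod (orb t n)}"
  have CV: "C \<subseteq> V n" by (auto simp: C_def V_def)
  have clC: "closed C" unfolding C_def by (intro closed_Collect_le continuous_intros continuous_on_orb)
  have "continuous_on C Phi"
    by (rule holomorphic_on_imp_continuous_on[OF holomorphic_on_subset[OF holomorphic_Phi_V[OF n] CV]])
  then have "closed (C \<inter> Phi -` (- ball 0 s))"
    by (rule continuous_closed_preimage[OF _ clC]) (simp add: closed_Compl)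
  moreover have "{t \<in> - mandelbrot. s \<le> cmod (Phi t)} = C \<inter> Phi -` (- ball 0 s)"
  proof (intro equalityI subsetI)
    fix t assume t: "t \<in> {t \<in> - mandelbrot. s \<le> cmod (Phi t)}"
    then have "s ^ (2^(n-1)) \<le> cmod (Phi t) ^ (2^(n-1))" using s by (intro power_mono) auto
    then have "36 \<le> cmod (Phi t) ^ (2^(n-1))" using sn by linarith
    then have "12 \<le> cmod (orb t n)" using orb_ge_of_Phi(1)[of t n] t n by blast
    then show "t \<in> C \<inter> Phi -` (- ball 0 s)" using t by (simp add: C_def)
  next
    fix t assume t: "t \<in> C \<inter> Phi -` (- ball 0 s)"
    then have "t \<in> - mandelbrot" using CV V_subset by blast
    then show "t \<in> {t \<in> - mandelbrot. s \<le> cmod (Phi t)}" using t by simp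
  qed
  ultimately show ?thesis by simp
qed

lemma Phi_bij: "bij_betw Phi (- mandelbrot) {y. 1 < cmod y}"
  by (rule exterior_bij)
     (use open_exterior holomorphic_Phi Phi_gt_1 Phi_asymp closed_Phi_ge zero_in_mandelbrot large_notin_mandelbrot in auto)

lemma Phi_inverse:
  obtains g where "g holomorphic_on {y. 1 < cmod y}" "\<And>t. t \<notin> mandelbrot \<Longrightarrow> g (Phi t) = t" 
    "\<And>y. 1 < cmod y \<Longrightarrow> g y \<notin> mandelbrot \<and> Phi (g y) = y"
proof -
  have b: "inj_on Phi (- mandelbrot)" "Phi ` (- mandelbrot) = {y. 1 < cmod y}" using Phi_bij by (auto simp: bij_betw_def)
  obtain g where g: "g holomorphic_on (Phi ` (- mandelbrot))" "\<And>z. z \<in> - mandelbrot \<Longrightarrow> g (Phi z) = z"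
    using holomorphic_has_inverse[OF holomorphic_Phi open_exterior b(1)] by metis
  have "g y \<notin> mandelbrot \<and> Phi (g y) = y" if "1 < cmod y" for y
  proof -
    have "y \<in> Phi ` (- mandelbrot)" using that b(2) by blast
    then obtain z where "z \<in> - mandelbrot" "y = Phi z" by blast
    then show ?thesis using g(2)[of z] by simp
  qed
  then show thesis using that[of g] g b(2) by simp
qed

lemma riemann_map_properties:
  "riemann_map holomorphic_on (- mandelbrot) \<and> bij_betw riemann_map (- mandelbrot) (- cball 0 1) \<and>
   ((\<lambda>z. riemann_map z / z) \<longlongrightarrow> 1) at_infinity"
proof -
  have "- cball (0::complex) 1 = {y. 1 < cmod y}" by auto
  then have "Phi holomorphic_on (- mandelbrot) \<and> bij_betw Phi (- mandelbrot) (- cball 0 1) \<and>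
   ((\<lambda>z. Phi z / z) \<longlongrightarrow> 1) at_infinity" using holomorphic_Phi Phi_bij Phi_asymp by simp
  then show ?thesis unfolding riemann_map_def by (rule someI[where P = "\<lambda>f. f holomorphic_on (- mandelbrot) \<and>
    bij_betw f (- mandelbrot) (- cball 0 1) \<and> ((\<lambda>z. f z / z) \<longlongrightarrow> 1) at_infinity"])
qed

lemma Phi_norm_le: assumes "t \<notin> mandelbrot" shows "cmod (Phi t) \<le> 12 + 3 * cmod t"
proof (cases "cmod t \<le> 2")
  case True
  then show ?thesis using Phi_small[of t 1] assms norm_ge_zero[of t] by (simp del: norm_ge_zero)
next
  case False
  then have "t \<in> V 1" by (simp add: V_def)
  then show ?thesis using Phi_bounds(2)[of 1 t] by simp
qed

text \<open>In the coordinate \<open>inverse (Phi t)\<close> the chosen conformal isomorphism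
  becomes a self-map of the disc that fixes 0 with derivative 1, so the Schwarz lemma makes it the
  identity.\<close>

lemma riemann_map_eq: assumes "t \<notin> mandelbrot" shows "riemann_map t = Phi t"
proof -
  let ?R = riemann_map
  note R = riemann_map_properties
  obtain g where g: "g holomorphic_on {y. 1 < cmod y}" "\<And>t. t \<notin> mandelbrot \<Longrightarrow> g (Phi t) = t" 
    "\<And>y. 1 < cmod y \<Longrightarrow> g y \<notin> mandelbrot \<and> Phi (g y) = y" using Phi_inverse by blast
  have R1: "1 < cmod (?R (g y))" if "1 < cmod y" for y
  proof -
    have "?R (g y) \<in> - cball 0 1" using R g(3)[OF that] bij_betwE by blast
    then show ?thesis by simp
  qed
  define h where "h = (\<lambda>x. if x = 0 then 0 else inverse (?R (g (inverse x))))"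
  have ge: "filterlim g at_infinity at_infinity"
    unfolding filterlim_at_infinity_conv_norm_at_top filterlim_at_top
  proof
    fix Z
    have "Z \<le> cmod (g y)" if "2 + 12 + 3 * \<bar>Z\<bar> \<le> cmod y" for y
    proof -
      have "1 < cmod y" using that by linarith
      then have "cmod y \<le> 12 + 3 * cmod (g y)" using Phi_norm_le[of "g y"] g(3)[of y] by simp
      then show ?thesis using that by linarith
    qed
    then show "\<forall>\<^sub>F y in at_infinity. Z \<le> cmod (g y)" unfolding eventually_at_infinity by blast
  qed
  have l1: "((\<lambda>y. ?R (g y) / g y) \<longlongrightarrow> 1) at_infinity" using R ge filterlim_compose[of "\<lambda>z. ?R z / z"] by blast
  have l2: "((\<lambda>y. Phi (g y) / g y) \<longlongrightarrow> 1) at_infinity" using ge filterlim_compose[OF Phi_asymp] by blast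
  have "((\<lambda>y. (Phi (g y) / g y) / (?R (g y) / g y)) \<longlongrightarrow> 1 / 1) at_infinity"
    by (intro tendsto_divide l1 l2) simp
  then have "((\<lambda>y. (Phi (g y) / g y) / (?R (g y) / g y)) \<longlongrightarrow> 1) at_infinity" by simp
  then have l3: "((\<lambda>y. y / ?R (g y)) \<longlongrightarrow> 1) at_infinity"
  proof (rule Lim_transform_eventually)
    have "(Phi (g y) / g y) / (?R (g y) / g y) = y / ?R (g y)" if "2 \<le> cmod y" for y
    proof -
      have y: "g y \<notin> mandelbrot" "Phi (g y) = y" using g(3)[of y] that by auto
      then have "g y \<noteq> 0" using zero_in_mandelbrot by auto
      then show ?thesis using y by simp
    qed
    then show "\<forall>\<^sub>F y in at_infinity. (Phi (g y) / g y) / (?R (g y) / g y) = y / ?R (g y)"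
      unfolding eventually_at_infinity by blast
  qed
  have "((\<lambda>x. inverse x / ?R (g (inverse x))) \<longlongrightarrow> 1) (at 0)"
    by (rule filterlim_compose[OF l3 filterlim_inverse_at_infinity])
  then have "((\<lambda>x. (h x - h 0) / (x - 0)) \<longlongrightarrow> 1) (at 0)"
    by (rule Lim_transform_eventually) (simp add: h_def eventually_at_filter divide_simps)
  then have dh: "(h has_field_derivative 1) (at 0)" by (simp add: has_field_derivative_iff)
  have inv1: "1 < cmod (inverse x)" if "cmod x < 1" "x \<noteq> 0" for x :: complex
    using less_imp_inverse_less[of "cmod x" 1] that by (simp add: norm_inverse)
  have h0: "h holomorphic_on (ball 0 1 - {0})"
  proof (rule holomorphic_transform[of "\<lambda>x. inverse (?R (g (inverse x)))"])
    have "((?R \<circ> g) \<circ> inverse) holomorphic_on (ball 0 1 - {0})"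
    proof (rule holomorphic_on_compose_gen[where t = "{y. 1 < cmod y}"])
      show "(?R \<circ> g) holomorphic_on {y. 1 < cmod y}"
        by (rule holomorphic_on_compose_gen[OF g(1), where t = "- mandelbrot"]) (use R g(3) in auto)
    qed (use inv1 in \<open>auto intro!: holomorphic_intros\<close>)
    then show "(\<lambda>x. inverse (?R (g (inverse x)))) holomorphic_on (ball 0 1 - {0})"
      by (intro holomorphic_intros) (use R1 inv1 in \<open>fastforce simp: o_def\<close>)+
  qed (auto simp: h_def)
  have hh: "h holomorphic_on ball 0 1" by (rule holomorphic_at_puncture[OF open_ball h0 dh])
  have hn: "cmod (h z) < 1" if "cmod z < 1" for z
  proof (cases "z = 0")
    case False
    then have "1 < cmod (?R (g (inverse z)))" using R1 inv1 that by blast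
    then show ?thesis using less_imp_inverse_less[of 1] False by (simp add: h_def norm_inverse)
  qed (simp add: h_def)
  have d1: "deriv h 0 = 1" using DERIV_imp_deriv[OF dh] .
  then obtain \<alpha> where al: "\<And>z. cmod z < 1 \<Longrightarrow> h z = \<alpha> * z"
    using Schwarz_Lemma(3)[OF hh _ hn, of 0] by (auto simp: h_def)
  have "((\<lambda>z. \<alpha> * z) has_field_derivative 1) (at 0)"
    by (rule has_field_derivative_transform_within_open[OF dh open_ball[of 0 1]]) (use al in auto)
  moreover have "((\<lambda>z. \<alpha> * z) has_field_derivative \<alpha>) (at 0)" by (auto intro!: derivative_eq_intros)
  ultimately have "\<alpha> = 1" using DERIV_unique by blast
  have y: "1 < cmod (Phi t)" using Phi_gt_1[OF assms] .
  define x where "x = inverse (Phi t)"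
  have x: "cmod x < 1" "x \<noteq> 0" "inverse x = Phi t"
    using y less_imp_inverse_less[of 1 "cmod (Phi t)"] by (auto simp: x_def norm_inverse)
  have "h x = x" using al[OF x(1)] \<open>\<alpha> = 1\<close> by simp
  then have "inverse (?R t) = inverse (Phi t)" using x g(2)[OF assms] by (simp add: h_def x_def)
  then show ?thesis by simp
qed

lemma parameter_ray_properties:
  assumes "1 < r"
  shows "parameter_ray \<theta> r \<notin> mandelbrot" "Phi (parameter_ray \<theta> r) = of_real r * cis (2 * pi * \<theta>)"
proof -
  let ?y = "of_real r * exp (2 * of_real pi * \<i> * of_real \<theta>) :: complex"
  have y: "?y = of_real r * cis (2 * pi * \<theta>)" by (simp add: cis_conv_exp mult_ac)
  have "cmod ?y = r" using assms unfolding y by (simp add: norm_mult)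
  then have "?y \<in> - cball 0 1" using assms by simp
  then have "?y \<in> riemann_map ` (- mandelbrot)" using riemann_map_properties by (simp add: bij_betw_def)
  then have "parameter_ray \<theta> r \<in> - mandelbrot" "riemann_map (parameter_ray \<theta> r) = ?y"
    unfolding parameter_ray_def by (rule inv_into_into, rule f_inv_into_f)
  then show "parameter_ray \<theta> r \<notin> mandelbrot" "Phi (parameter_ray \<theta> r) = of_real r * cis (2 * pi * \<theta>)"
    using riemann_map_eq[of "parameter_ray \<theta> r"] y by auto
qed

lemma continuous_on_parameter_ray: "continuous_on {1<..} (parameter_ray \<theta>)"
proof -
  obtain g where g: "g holomorphic_on {y. 1 < cmod y}" "\<And>t. t \<notin> mandelbrot \<Longrightarrow> g (Phi t) = t" 
    "\<And>y. 1 < cmod y \<Longrightarrow> g y \<notin> mandelbrot \<and> Phi (g y) = y" using Phi_inverse by blast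
  have "continuous_on {1<..} (\<lambda>r. g (of_real r * cis (2 * pi * \<theta>)))"
    by (rule continuous_on_compose2[OF holomorphic_on_imp_continuous_on[OF g(1)]])
       (auto intro!: continuous_intros simp: norm_mult)
  then show ?thesis
    by (rule continuous_on_eq) (use parameter_ray_properties g(2) in \<open>metis greaterThan_iff\<close>)
qed

section \<open>The rotation coding\<close>

lemma floor_diff_frac:
  fixes y g :: real
  assumes "0 < g" "g < 1"
  shows "\<lfloor>y\<rfloor> - \<lfloor>y - g\<rfloor> = (if frac y < g then 1 else 0)"
proof (cases "frac y < g")
  case True
  then have "\<lfloor>y - g\<rfloor> = \<lfloor>y\<rfloor> - 1" using assms unfolding floor_eq_iff frac_def
    by (auto simp: le_floor_iff) linarith+
  then show ?thesis using True by simp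
next
  case False
  then have "\<lfloor>y - g\<rfloor> = \<lfloor>y\<rfloor>" using assms unfolding floor_eq_iff frac_def by linarith
  then show ?thesis using False by simp
qed

locale rotation =
  fixes \<gamma> :: real
  assumes pos: "0 < \<gamma>" and half: "\<gamma> < 1/2" and irrational: "\<gamma> \<notin> \<rat>"
begin

text \<open>The index is shifted so that \<open>x 1 = 0\<close> is the position of the critical
  value. The arc of type \<open>Q2\<close> is the one on which the rotation wraps around, and the
  arc of type \<open>Q3\<close> is its image.\<close>

definition x :: "nat \<Rightarrow> real" where "x n = frac ((real n - 1) * \<gamma>)"

definition Q1 :: "nat \<Rightarrow> bool" where "Q1 n \<longleftrightarrow> \<gamma> \<le> x n \<and> x n < 1 - \<gamma>"
definition Q2 :: "nat \<Rightarrow> bool" where "Q2 n \<longleftrightarrow> 1 - \<gamma> \<le> x n"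
definition Q3 :: "nat \<Rightarrow> bool" where "Q3 n \<longleftrightarrow> x n < \<gamma>"

lemma x_bounds: "0 \<le> x n" "x n < 1" by (auto simp: x_def frac_lt_1)

lemma x_1: "x (Suc 0) = 0" by (simp add: x_def)

lemma x_Suc: "x (Suc n) = (if Q2 n then x n + \<gamma> - 1 else x n + \<gamma>)"
proof -
  have "frac \<gamma> = \<gamma>" using pos half by (simp add: frac_eq)
  moreover have "(real (Suc n) - 1) * \<gamma> = (real n - 1) * \<gamma> + \<gamma>" by (simp add: algebra_simps)
  ultimately show ?thesis unfolding x_def Q2_def by (simp only: frac_add) auto
qed

lemma type_cases: obtains "Q1 n" | "Q2 n" | "Q3 n" unfolding Q1_def Q2_def Q3_def by linarith

lemma type_disjoint: "\<not> (Q1 n \<and> Q2 n)" "\<not> (Q1 n \<and> Q3 n)" "\<not> (Q2 n \<and> Q3 n)"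
  using half unfolding Q1_def Q2_def Q3_def by auto

lemma Q2_Suc: "Q2 n \<Longrightarrow> Q3 (Suc n)" using x_Suc[of n] x_bounds(2)[of n] by (auto simp: Q3_def)

lemma not_Q2_Suc: "\<not> Q2 n \<Longrightarrow> \<not> Q3 (Suc n)" using x_Suc[of n] x_bounds(1)[of n] by (auto simp: Q3_def)

lemma Q3_1: "Q3 (Suc 0)" using pos by (simp add: Q3_def x_1)

lemma x_nonzero: assumes "n \<ge> 2" shows "x n \<noteq> 0"
proof
  assume "x n = 0"
  then have "(real n - 1) * \<gamma> \<in> \<int>" by (simp add: x_def)
  then have "(real n - 1) * \<gamma> \<in> \<rat>" using Ints_subset_Rats by blast
  moreover have "real n - 1 \<in> \<rat>" by simp
  ultimately have "(real n - 1) * \<gamma> / (real n - 1) \<in> \<rat>" by (rule Rats_divide)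
  then show False using irrational assms by simp
qed

section \<open>Closest returns and mismatches of itineraries\<close>

definition same_type :: "nat \<Rightarrow> nat \<Rightarrow> bool" where
  "same_type m n \<longleftrightarrow> (Q1 m \<longleftrightarrow> Q1 n) \<and> (Q2 m \<longleftrightarrow> Q2 n) \<and> (Q3 m \<longleftrightarrow> Q3 n)"

text \<open>A new minimal distance to \<open>x 1 = 0\<close> from the right. The two further bounds
  fix the types \<open>Q2\<close>, \<open>Q3\<close>, \<open>Q1\<close> at \<open>k\<close>,
  \<open>Suc k\<close> and \<open>Suc (Suc k)\<close>.\<close>

definition closest_return :: "nat \<Rightarrow> bool" where
  "closest_return k \<longleftrightarrow> 1 \<le> k \<and> x (Suc k) < \<gamma> \<and> x (Suc k) < 1 - 2 * \<gamma> \<and> (\<forall>j. 1 \<le> j \<longrightarrow> j < k \<longrightarrow> x (Suc k) < x (Suc j))"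

lemma closest_return_types: assumes "closest_return k" shows "Q2 k" "Q3 (Suc k)" "Q1 (Suc (Suc k))"
proof -
  show 3: "Q3 (Suc k)" using assms by (simp add: closest_return_def Q3_def)
  then show 2: "Q2 k" using not_Q2_Suc by blast
  have "x (Suc (Suc k)) = x (Suc k) + \<gamma>" using x_Suc[of "Suc k"] 3 type_disjoint(3)[of "Suc k"] by auto
  then show "Q1 (Suc (Suc k))" using assms x_bounds(1)[of "Suc k"] by (auto simp: closest_return_def Q1_def)
qed

lemma closest_return_exists: obtains k where "N < k" "closest_return k"
proof -
  \<comment> \<open>A threshold not exceeding the positions at the indices 2 to
    \<open>Suc N\<close>, so a smaller position can occur only later; its first occurrence is a
    closest return.\<close>
  define e where "e = Min ({\<gamma>, 1 - 2 * \<gamma>} \<union> (\<lambda>j. x (Suc j)) ` {1..N})"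
  have e: "e \<le> \<gamma>" "e \<le> 1 - 2 * \<gamma>" "\<And>j. 1 \<le> j \<Longrightarrow> j \<le> N \<Longrightarrow> e \<le> x (Suc j)"
    unfolding e_def by (rule Min_le; force)+
  have "0 < x (Suc j)" if "1 \<le> j" for j using x_bounds(1)[of "Suc j"] x_nonzero[of "Suc j"] that by simp
  then have e0: "0 < e" unfolding e_def using pos half by (subst Min_gr_iff) auto
  obtain m where m: "m > 0" "\<bar>frac (real m * \<gamma>) - 0\<bar> < e"
    using Kronecker_approx_1_explicit[OF irrational, of 0 e] e0 by auto
  define P where "P = (\<lambda>k. 1 \<le> k \<and> x (Suc k) < e)"
  have "P m" using m by (simp add: P_def x_def)
  define k where "k = (LEAST k. P k)"
  have k: "P k" unfolding k_def using \<open>P m\<close> by (rule LeastI)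
  have "x (Suc k) < x (Suc j)" if "1 \<le> j" "j < k" for j
    using not_less_Least[of j P] that k by (auto simp: k_def P_def)
  then have "closest_return k" using k e(1,2) by (auto simp: closest_return_def P_def)
  moreover have "N < k" using e(3)[of k] k by (auto simp: P_def not_le[symmetric])
  ultimately show thesis using that by blast
qed

text \<open>While the types agree, the two orbits move in parallel at distance
  \<open>x (Suc n)\<close>. Agreement up to \<open>k\<close> would give
  \<open>x (Suc (k - n)) \<le> x (Suc k)\<close>, against the minimality at \<open>k\<close>. At the
  first mismatch the shifted orbit lies to the right, which leaves only \<open>Q2\<close> against
  \<open>Q1\<close>.\<close>

lemma first_mismatch:
  assumes k: "closest_return k" and n: "1 \<le> n" "n < k" "Q2 n"
  obtains j where "1 \<le> j" "n + j \<le> k" "\<And>i. 1 \<le> i \<Longrightarrow> i < j \<Longrightarrow> same_type (n + i) i" "Q2 (n + j)" "Q1 j"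
proof -
  let ?u = "x (Suc n)"
  have agree: "x (n + Suc i) = x (Suc i) + ?u" if "\<And>l. 1 \<le> l \<Longrightarrow> l \<le> i \<Longrightarrow> same_type (n + l) l" for i
    using that
  proof (induction i)
    case 0 then show ?case by (simp add: x_1)
  next
    case (Suc i)
    have "x (n + Suc i) = x (Suc i) + ?u" by (rule Suc.IH) (use Suc.prems in simp)
    moreover have "Q2 (n + Suc i) \<longleftrightarrow> Q2 (Suc i)" using Suc.prems[of "Suc i"] by (simp add: same_type_def)
    ultimately show ?case using x_Suc[of "n + Suc i"] x_Suc[of "Suc i"] by auto
  qed
  define P where "P = (\<lambda>j. 1 \<le> j \<and> \<not> same_type (n + j) j)"
  have ex: "\<exists>j. P j \<and> n + j \<le> k"
  proof (rule ccontr)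
    assume "\<not> ?thesis"
    then have "x (n + Suc (k - n)) = x (Suc (k - n)) + ?u" by (intro agree) (use n in \<open>auto simp: P_def\<close>)
    then have "x (Suc (k - n)) \<le> x (Suc k)" using n x_bounds(1)[of "Suc n"] by simp
    moreover have "x (Suc k) < x (Suc (k - n))" using k n unfolding closest_return_def by simp
    ultimately show False by simp
  qed
  define j where "j = (LEAST j. P j)"
  have j: "P j" "n + j \<le> k"
    using ex LeastI[of P] Least_le[of P] unfolding j_def by (blast, metis add_le_cancel_left order_trans)
  have before: "same_type (n + i) i" if "1 \<le> i" "i < j" for i
    using not_less_Least[of i P] that by (auto simp: j_def P_def)
  have j1: "1 \<le> j" "\<not> same_type (n + j) j" using j by (auto simp: P_def)
  have xj: "x (n + j) = x j + ?u" using agree[of "j - 1"] before j1 by simp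
  \<comment> \<open>Type \<open>Q3\<close> is decided by the preceding type, on which the two orbits
    still agree.\<close>
  have nQ3: "\<not> Q3 j"
  proof
    assume 3: "Q3 j"
    have "Q3 (n + j)"
    proof (cases "j = 1")
      case True then show ?thesis using Q2_Suc[OF n(3)] by simp
    next
      case False
      then have "same_type (n + (j - 1)) (j - 1)" using j1 by (intro before) auto
      moreover have "Q2 (j - 1)" using not_Q2_Suc[of "j - 1"] 3 j1 by auto
      ultimately show ?thesis using Q2_Suc[of "n + (j-1)"] j1 by (simp add: same_type_def)
    qed
    then show False using 3 j1 type_disjoint unfolding same_type_def by blast
  qed
  have "\<not> Q2 j"
  proof
    assume 2: "Q2 j"
    then have "Q2 (n + j)" using xj x_bounds(1)[of "Suc n"] by (simp add: Q2_def)
    then show False using 2 j1 type_disjoint unfolding same_type_def by blast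
  qed
  then have Q1: "Q1 j" using nQ3 type_cases by blast
  then have "\<not> Q3 (n + j)" using xj x_bounds(1)[of "Suc n"] by (simp add: Q3_def Q1_def)
  then have "Q2 (n + j)" using Q1 j1 type_disjoint type_cases[of "n + j"] unfolding same_type_def by blast
  then show thesis using that[of j] j1 j before Q1 by blast
qed

section \<open>The binary expansion of the angle\<close>

definition d :: "nat \<Rightarrow> real" where "d n = (if Q3 n then 1 else 0)"

lemma s_rot_eq: "real_of_int (s_rot \<gamma> n) = d (Suc (Suc n))"
proof -
  have "real n * \<gamma> = real (n + 1) * \<gamma> - \<gamma>" by (simp add: algebra_simps)
  then have "s_rot \<gamma> n = \<lfloor>real (n + 1) * \<gamma>\<rfloor> - \<lfloor>real (n + 1) * \<gamma> - \<gamma>\<rfloor>" by (simp add: s_rot_def)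
  also have "\<dots> = (if frac (real (n + 1) * \<gamma>) < \<gamma> then 1 else 0)"
    by (rule floor_diff_frac) (use pos half in auto)
  finally show ?thesis by (simp add: d_def Q3_def x_def add.commute)
qed

text \<open>In turns, the angle of the \<open>n\<close>-th orbit value on the ray, up to the factor
  \<open>exp (- S n (ray r))\<close>: shifting the digits is doubling the angle.\<close>

definition a :: "nat \<Rightarrow> real" where "a n = (\<Sum>j. d (n + j) / 2 ^ Suc j)"

lemma a_sums: "(\<lambda>j. d (n + j) / 2 ^ Suc j) sums a n"
proof -
  have "summable (\<lambda>j. d (n + j) / 2 ^ Suc j)"
  proof (rule summable_comparison_test')
    show "summable (\<lambda>j. (1/2::real) ^ Suc j)" using power_half_series sums_summable by blast
    show "norm (d (n + j) / 2 ^ Suc j) \<le> (1/2) ^ Suc j" if "j \<ge> 0" for j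
      by (simp add: d_def power_divide)
  qed
  then show ?thesis unfolding a_def by (rule summable_sums)
qed

lemma a_step: "a n = (d n + a (Suc n)) / 2"
proof -
  have "(\<lambda>j. d (n + Suc j) / 2 ^ Suc (Suc j)) sums (a (Suc n) / 2)"
    using sums_divide[OF a_sums[of "Suc n"], of 2] by (simp add: mult.commute mult.left_commute)
  from sums_Suc[OF this] have "(\<lambda>j. d (n + j) / 2 ^ Suc j) sums (a (Suc n) / 2 + d n / 2)" by simp
  then have "a n = a (Suc n) / 2 + d n / 2" using a_sums[of n] sums_unique2 by blast
  then show ?thesis by (simp add: add_divide_distrib)
qed

text \<open>\<open>T_ble\<close> prefixes the binary digits 1 and 0, which are \<open>d 1\<close>
  and \<open>d 2\<close>; the digits of \<open>theta_rot\<close> start with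
  \<open>d 3\<close>.\<close>

lemma theta_rot_eq: "T_ble (theta_rot \<gamma>) = a (Suc 0)"
proof -
  have "theta_rot \<gamma> = a 3" unfolding theta_rot_def s_rot_eq a_def by (simp add: numeral_3_eq_3)
  moreover have "d (Suc 0) = 1" using Q3_1 by (simp add: d_def)
  moreover have "d (Suc (Suc 0)) = 0"
    using not_Q2_Suc[of "Suc 0"] Q3_1 type_disjoint(3)[of "Suc 0"] by (auto simp: d_def)
  ultimately show ?thesis using a_step[of "Suc 0"] a_step[of "Suc (Suc 0)"]
    by (simp add: T_ble_def numeral_3_eq_3)
qed

lemma a_nonneg: "0 \<le> a n" unfolding a_def by (rule suminf_nonneg[OF sums_summable[OF a_sums]]) (simp add: d_def)

lemma a_le_1: "a n \<le> 1"
proof -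
  have "a n \<le> (\<Sum>j. (1/2) ^ Suc j)" unfolding a_def
    by (rule suminf_le[OF _ sums_summable[OF a_sums] sums_summable[OF power_half_series]]) (simp add: d_def power_divide)
  then show ?thesis using sums_unique[OF power_half_series] by simp
qed

lemma Q3_step: "Q3 n \<Longrightarrow> d n = 1 \<and> d (Suc n) = 0"
  using not_Q2_Suc type_disjoint(3) by (auto simp: d_def)

text \<open>Two consecutive digits are never both 1, so the largest conceivable binary expansion is
  0.101010..., that is 2/3. The induction improves the trivial bound 1 digit by digit.\<close>

lemma a_le: "a n \<le> 2/3"
proof -
  have "a n \<le> 2/3 + (1/2) ^ k" for k n
  proof (induction k arbitrary: n)
    case 0 then show ?case using a_le_1[of n] by simp
  next
    case (Suc k)
    have p: "0 < (1/2::real) ^ k" by simp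
    show ?case
    proof (cases "Q3 n")
      case True
      then have "a n = 1/2 + a (Suc (Suc n)) / 4" using a_step[of n] a_step[of "Suc n"] Q3_step[of n] by simp
      then show ?thesis using Suc[of "Suc (Suc n)"] p unfolding power_Suc by linarith
    next
      case False
      then have "a n = a (Suc n) / 2" using a_step[of n] by (simp add: d_def)
      then show ?thesis using Suc[of "Suc n"] p unfolding power_Suc by linarith
    qed
  qed
  moreover have "(\<lambda>k. 2/3 + (1/2) ^ k) \<longlonglongrightarrow> 2/3 + (0::real)" by (intro tendsto_intros LIMSEQ_power_zero) auto
  ultimately have "a n \<le> 2/3 + 0" by (intro LIMSEQ_le_const) blast+
  then show ?thesis by simp
qed

lemma a_Q1: assumes "Q1 n" shows "a n \<le> 1/6"
proof -
  have "d n = 0" "d (Suc n) = 0" using assms type_disjoint not_Q2_Suc by (auto simp: d_def)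
  then show ?thesis using a_step[of n] a_step[of "Suc n"] a_le[of "Suc (Suc n)"] by simp
qed

lemma a_Q3: assumes "Q3 n" shows "1/2 \<le> a n"
  using Q3_step[OF assms] a_step[of n] a_nonneg[of "Suc n"] by simp

lemma cis_a: "cis (2 * pi * a (Suc 0)) ^ (2^n) = cis (2 * pi * a (Suc n))"
proof (induction n)
  case (Suc n)
  have "cis (2 * pi * a (Suc 0)) ^ (2^Suc n) = cis (2 * pi * a (Suc n)) ^ 2"
    unfolding Suc[symmetric] by (simp add: power_mult[symmetric] mult.commute)
  also have "\<dots> = cis (2 * pi * a (Suc n) * 2)" by (simp add: Complex.DeMoivre mult.commute)
  also have "2 * pi * a (Suc n) * 2 = 2 * pi * a (Suc (Suc n)) + 2 * pi * d (Suc n)"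
    using a_step[of "Suc n"] by (simp add: algebra_simps)
  also have "cis \<dots> = cis (2 * pi * a (Suc (Suc n)))"
    by (simp add: d_def cis_mult[symmetric])
  finally show ?case .
qed simp

end

section \<open>Orbits along the parameter ray\<close>

text \<open>If \<open>Re z = 0\<close>, then \<open>z ^ 2 + t\<close> lies horizontally to the left
  of \<open>t\<close>, and moving left from \<open>t\<close> only raises the real part of the next
  image above \<open>Re (t ^ 2 + t)\<close>. The rest is a perturbation estimate for
  \<open>\<bar>Re z\<bar> = \<delta>\<close>.\<close>

lemma no_crossing:
  fixes t z :: complex
  assumes \<delta>: "0 < \<delta>" "\<delta> \<le> 1/30" and t: "Re t \<le> 0" "- 10 \<le> Re t" "\<delta> \<le> Re (t ^ 2 + t)" and z: "\<bar>Re z\<bar> = \<delta>"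
  shows "Re (z ^ 2 + t) < - \<delta>" "- \<delta> < Re ((z ^ 2 + t) ^ 2 + t)"
proof -
  define p where "p = - Re t"
  define q where "q = Im t"
  define s where "s = Im z"
  have Re2: "Re (w ^ 2) = Re w ^ 2 - Im w ^ 2" for w by (simp add: power2_eq_square)
  have Im2: "Im (w ^ 2) = 2 * Re w * Im w" for w by (simp add: power2_eq_square)
  have c2: "\<delta> \<le> p ^ 2 - q ^ 2 - p" using t(3) by (simp add: Re2 p_def q_def)
  have p0: "0 \<le> p" "p \<le> 10" using t by (auto simp: p_def)
  have p1: "1 \<le> p"
  proof (rule ccontr)
    assume "\<not> 1 \<le> p"
    then have "p * p \<le> p * 1" using p0 by (intro mult_left_mono) auto
    then show False using c2 \<delta> zero_le_power2[of q] unfolding power2_eq_square by linarith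
  qed
  have z2: "Re z ^ 2 = \<delta> ^ 2" using z by (metis power2_abs)
  have d2: "\<delta> ^ 2 \<le> \<delta> / 30" using mult_left_mono[OF \<delta>(2), of \<delta>] \<delta> by (simp add: power2_eq_square)
  have R1: "Re (z ^ 2 + t) = \<delta> ^ 2 - s ^ 2 - p" using z2 by (simp add: Re2 p_def s_def)
  show "Re (z ^ 2 + t) < - \<delta>" using R1 p1 d2 \<delta> zero_le_power2[of s] by linarith
  define u where "u = \<bar>s\<bar>"
  have u: "0 \<le> u" "u ^ 2 = s ^ 2" by (auto simp: u_def)
  define y where "y = Re z * s"
  have y2: "y ^ 2 = \<delta> ^ 2 * u ^ 2" unfolding y_def power_mult_distrib z2 u(2) ..
  have yle: "\<bar>y\<bar> = \<delta> * u" by (simp add: y_def abs_mult z u_def)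
  have qp: "\<bar>q\<bar> \<le> p"
  proof -
    have "q ^ 2 \<le> p ^ 2" using c2 \<delta> p0 by linarith
    then show ?thesis using abs_le_square_iff[of q p] p0 by simp
  qed
  have "Im (z ^ 2 + t) = 2 * y + q" by (simp add: Im2 q_def y_def s_def)
  then have R2: "Re ((z ^ 2 + t) ^ 2 + t) = (\<delta> ^ 2 - u ^ 2 - p) ^ 2 - (2 * y + q) ^ 2 - p"
    unfolding plus_complex.sel(1)[of "(z^2+t)^2"] Re2[of "z^2+t"] R1 by (simp add: p_def u)
  have yq: "y * q \<le> \<delta> * u * p"
  proof -
    have "y * q \<le> \<bar>y\<bar> * \<bar>q\<bar>" by (metis abs_mult abs_ge_self)
    also have "\<dots> \<le> \<delta> * u * p" unfolding yle using qp \<delta> u by (intro mult_left_mono) auto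
    finally show ?thesis .
  qed
  have "(\<delta> ^ 2 - u ^ 2 - p) ^ 2 - (2 * y + q) ^ 2 - p =
     (p ^ 2 - q ^ 2 - p) + 2 * p * u ^ 2 - 2 * p * \<delta> ^ 2 + (u ^ 2) ^ 2 - 2 * \<delta> ^ 2 * u ^ 2 + (\<delta> ^ 2) ^ 2 - 4 * y ^ 2 - 4 * (y * q)"
    by (simp add: power2_eq_square algebra_simps)
  also have "\<dots> \<ge> \<delta> + 2 * p * u ^ 2 - 2 * p * \<delta> ^ 2 - 6 * \<delta> ^ 2 * u ^ 2 - 4 * (\<delta> * u * p)"
    using c2 yq y2 zero_le_power2[of "u ^ 2"] zero_le_power2[of "\<delta> ^ 2"] by linarith
  finally have R3: "Re ((z ^ 2 + t) ^ 2 + t) \<ge> \<delta> + 2 * p * u ^ 2 - 2 * p * \<delta> ^ 2 - 6 * \<delta> ^ 2 * u ^ 2 - 4 * (\<delta> * u * p)"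
    unfolding R2 .
  have "6 * (\<delta> ^ 2 * u ^ 2) \<le> (1/100) * (p * u ^ 2)"
  proof -
    have "\<delta> * \<delta> \<le> (1/30) * (1/30)" using \<delta> by (intro mult_mono) auto
    then have "6 * \<delta> ^ 2 \<le> (1/100) * p" using p1 by (simp add: power2_eq_square)
    then have "6 * \<delta> ^ 2 * u ^ 2 \<le> (1/100) * p * u ^ 2" by (rule mult_right_mono) simp
    then show ?thesis by (simp only: mult.assoc)
  qed
  \<comment> \<open>The weights produce the cross term \<open>4 * (\<delta> * u * p)\<close> and
    keep the total coefficient 49/25 + 1/100 of \<open>p * u ^ 2\<close> below 2. What remains is a
    multiple of \<open>\<delta> ^ 2\<close> that is less than \<open>2 * \<delta>\<close> for
    \<open>p \<le> 10\<close> and \<open>\<delta> \<le> 1/30\<close>.\<close>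
  moreover have "0 \<le> p * (7/5 * u - 10/7 * \<delta>) ^ 2" using p0 by simp
  then have "4 * (\<delta> * u * p) \<le> 49/25 * (p * u ^ 2) + 100/49 * (p * \<delta> ^ 2)"
    by (simp add: power2_eq_square algebra_simps)
  moreover have "p * \<delta> ^ 2 \<le> 10 * \<delta> ^ 2" using p0 by (intro mult_right_mono) auto
  moreover have "0 \<le> p * u ^ 2" using p0 by simp
  moreover have "Re ((z ^ 2 + t) ^ 2 + t) \<ge> \<delta> + 2 * (p * u ^ 2) - 2 * (p * \<delta> ^ 2) - 6 * (\<delta> ^ 2 * u ^ 2) - 4 * (\<delta> * u * p)"
    using R3 by (simp only: mult.assoc)
  ultimately show "- \<delta> < Re ((z ^ 2 + t) ^ 2 + t)" using d2 \<delta> by linarith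
qed

context rotation begin

text \<open>There is no condition at type \<open>Q2\<close>, where the imaginary axis may be
  crossed. The strict form is open and the weak form below is closed, as the continuation argument
  requires.\<close>

definition sep :: "real \<Rightarrow> nat \<Rightarrow> complex \<Rightarrow> bool" where
  "sep \<delta> n w \<longleftrightarrow> (Q1 n \<longrightarrow> \<delta> < Re w) \<and> (Q3 n \<longrightarrow> Re w < - \<delta>)"

definition weak_sep :: "real \<Rightarrow> nat \<Rightarrow> complex \<Rightarrow> bool" where
  "weak_sep \<delta> n w \<longleftrightarrow> (Q1 n \<longrightarrow> \<delta> \<le> Re w) \<and> (Q3 n \<longrightarrow> Re w \<le> - \<delta>)"

lemma sep_imp_weak: "sep \<delta> n w \<Longrightarrow> weak_sep \<delta> n w" by (auto simp: sep_def weak_sep_def)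
lemma sep_mono: "sep \<delta> n w \<Longrightarrow> \<delta>' \<le> \<delta> \<Longrightarrow> sep \<delta>' n w" by (auto simp: sep_def)

lemma Q1_2: "Q1 (Suc (Suc 0))"
proof -
  have "\<not> Q2 (Suc 0)" using Q3_1 type_disjoint(3) by blast
  then have "x (Suc (Suc 0)) = \<gamma>" using x_Suc[of "Suc 0"] x_1 by simp
  then show ?thesis using half by (simp add: Q1_def)
qed

lemma closest_return_ge_3: assumes "closest_return k" shows "3 \<le> k"
proof -
  have "Q2 k" by (rule closest_return_types[OF assms])
  then have "k \<noteq> 1" "k \<noteq> 2" using Q3_1 Q1_2 type_disjoint by (auto simp: numeral_2_eq_2)
  moreover have "1 \<le> k" using assms by (simp add: closest_return_def)
  ultimately show ?thesis by simp
qed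

text \<open>On the boundary \<open>no_crossing\<close> controls the next two images. The successor
  is not of type \<open>Q3\<close>; type \<open>Q1\<close> contradicts the first image, and type
  \<open>Q2\<close>, which is followed by \<open>Q3\<close>, contradicts the second.\<close>

lemma weak_sep_imp_sep:
  assumes \<delta>: "0 < \<delta>" "\<delta> \<le> 1/30" and t: "- 10 \<le> Re t" "weak_sep \<delta> 1 t" "weak_sep \<delta> 2 (t ^ 2 + t)"
    and z: "weak_sep \<delta> n z" "weak_sep \<delta> (Suc n) (z ^ 2 + t)" "Q2 (Suc n) \<Longrightarrow> weak_sep \<delta> (Suc (Suc n)) ((z ^ 2 + t) ^ 2 + t)"
  shows "sep \<delta> n z"
proof (rule ccontr)
  assume neg: "\<not> sep \<delta> n z"
  then have 13: "Q1 n \<or> Q3 n" and "\<bar>Re z\<bar> = \<delta>" using z(1) \<delta> by (auto simp: sep_def weak_sep_def)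
  moreover have "Re t \<le> 0" using t(2) Q3_1 \<delta> by (auto simp: weak_sep_def)
  moreover have "\<delta> \<le> Re (t ^ 2 + t)" using t(3) Q1_2 by (simp add: weak_sep_def numeral_2_eq_2)
  ultimately have nc: "Re (z ^ 2 + t) < - \<delta>" "- \<delta> < Re ((z ^ 2 + t) ^ 2 + t)"
    using no_crossing[OF \<delta> _ t(1)] by blast+
  have "\<not> Q3 (Suc n)" using 13 not_Q2_Suc type_disjoint by blast
  then consider "Q1 (Suc n)" | "Q2 (Suc n)" using type_cases by blast
  then show False
  proof cases
    case 1 then show False using z(2) nc(1) \<delta> by (simp add: weak_sep_def)
  next
    case 2 then show False using z(3) Q2_Suc[OF 2] nc(2) by (simp add: weak_sep_def)
  qed
qed

text \<open>By \<open>step\<close>, the weak conditions together imply the strict ones, so the set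
  where all of them hold is both closed and open.\<close>

lemma sep_connected:
  assumes T: "connected T" "t0 \<in> T" and I: "finite I" and cont: "\<And>n. n \<in> I \<Longrightarrow> continuous_on T (f n)"
    and t0: "\<And>n. n \<in> I \<Longrightarrow> sep \<delta> n (f n t0)"
    and step: "\<And>t n. t \<in> T \<Longrightarrow> (\<And>m. m \<in> I \<Longrightarrow> weak_sep \<delta> m (f m t)) \<Longrightarrow> n \<in> I \<Longrightarrow> sep \<delta> n (f n t)"
    and t: "t \<in> T" and n: "n \<in> I"
  shows "sep \<delta> n (f n t)"
proof -
  define B where "B = {t \<in> T. \<forall>n\<in>I. sep \<delta> n (f n t)}"
  have "openin (top_of_set T) (T \<inter> f n -` {w. sep \<delta> n w})" if "n \<in> I" for n
  proof (rule continuous_openin_preimage_gen[OF cont[OF that]])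
    have "{w. sep \<delta> n w} = {w. Q1 n \<longrightarrow> \<delta> < Re w} \<inter> {w. Q3 n \<longrightarrow> Re w < - \<delta>}" by (auto simp: sep_def)
    moreover have "open {w. Q1 n \<longrightarrow> \<delta> < Re w}" by (cases "Q1 n") (auto simp: open_halfspace_Re_gt)
    moreover have "open {w. Q3 n \<longrightarrow> Re w < - \<delta>}" by (cases "Q3 n") (auto simp: open_halfspace_Re_lt)
    ultimately show "open {w. sep \<delta> n w}" by auto
  qed
  then have "openin (top_of_set T) ((\<Inter>n\<in>I. T \<inter> f n -` {w. sep \<delta> n w}) \<inter> topspace (top_of_set T))"
    by (intro openin_INT I)
  moreover have "(\<Inter>n\<in>I. T \<inter> f n -` {w. sep \<delta> n w}) \<inter> topspace (top_of_set T) = B" by (auto simp: B_def)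
  ultimately have o: "openin (top_of_set T) B" by simp
  have "closedin (top_of_set T) (T \<inter> f n -` {w. weak_sep \<delta> n w})" if "n \<in> I" for n
  proof (rule continuous_closedin_preimage[OF cont[OF that]])
    have "{w. weak_sep \<delta> n w} = {w. Q1 n \<longrightarrow> \<delta> \<le> Re w} \<inter> {w. Q3 n \<longrightarrow> Re w \<le> - \<delta>}" by (auto simp: weak_sep_def)
    moreover have "closed {w. Q1 n \<longrightarrow> \<delta> \<le> Re w}" by (cases "Q1 n") (auto simp: closed_halfspace_Re_ge)
    moreover have "closed {w. Q3 n \<longrightarrow> Re w \<le> - \<delta>}" by (cases "Q3 n") (auto simp: closed_halfspace_Re_le)
    ultimately show "closed {w. weak_sep \<delta> n w}" by auto
  qed
  then have "closedin (top_of_set T) (\<Inter>((\<lambda>n. T \<inter> f n -` {w. weak_sep \<delta> n w}) ` I))"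
    by (intro closedin_Inter) (use n in auto)
  moreover have "(\<Inter>((\<lambda>n. T \<inter> f n -` {w. weak_sep \<delta> n w}) ` I)) = B"
  proof (intro equalityI subsetI)
    fix s assume "s \<in> (\<Inter>((\<lambda>n. T \<inter> f n -` {w. weak_sep \<delta> n w}) ` I))"
    then have "\<forall>m\<in>I. s \<in> T \<inter> f m -` {w. weak_sep \<delta> m w}" by blast
    then have "s \<in> T" "\<And>m. m \<in> I \<Longrightarrow> weak_sep \<delta> m (f m s)" using n by blast+
    then show "s \<in> B" using step[of s] by (simp add: B_def)
  next
    fix s assume "s \<in> B" then show "s \<in> (\<Inter>((\<lambda>n. T \<inter> f n -` {w. weak_sep \<delta> n w}) ` I))"
      using sep_imp_weak by (auto simp: B_def)
  qed
  ultimately have c: "closedin (top_of_set T) B" by simp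
  have "t0 \<in> B" using t0 T by (simp add: B_def)
  then have "B = T" using T(1) o c unfolding connected_clopen by blast
  then show ?thesis using t n by (auto simp: B_def)
qed

abbreviation "ray \<equiv> parameter_ray (a (Suc 0))"

lemma ray_orb:
  assumes "1 < r" "1 \<le> n" "ray r \<in> V n"
  shows "orb (ray r) n = of_real (r ^ (2^(n-1))) * cis (2 * pi * a n) * exp (- S n (ray r))"
proof -
  have "orb (ray r) n * exp (S n (ray r)) = Phi (ray r) ^ (2^(n-1))" using Phi_power[OF assms(2,3)] by simp
  also have "\<dots> = of_real (r ^ (2^(n-1))) * cis (2 * pi * a (Suc (n-1)))"
    unfolding parameter_ray_properties[OF assms(1)] power_mult_distrib cis_a by simp
  finally show ?thesis using assms(2) by (simp add: exp_minus field_simps)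
qed

lemma norm_exp_minus_1: assumes "cmod w \<le> 1/5" shows "cmod (exp w - 1) \<le> 1/4"
proof -
  have "cmod (exp w - 1) \<le> exp \<bar>Re w\<bar> * cmod w" using Taylor_exp[of w 0] by simp
  also have "\<dots> \<le> (1 + 1/5 + (1/5)^2) * (1/5)"
  proof (intro mult_mono)
    have "exp \<bar>Re w\<bar> \<le> exp (1/5)" using assms abs_Re_le_cmod[of w] by simp
    also have "exp (1/5::real) \<le> 1 + 1/5 + (1/5)^2" by (rule exp_bound) auto
    finally show "exp \<bar>Re w\<bar> \<le> 1 + 1/5 + (1/5)^2" .
  qed (use assms in auto)
  finally show ?thesis by (simp add: power2_eq_square)
qed

lemma orb_ray_large:
  assumes r: "1 < r" and n: "1 \<le> n" and ge: "10 \<le> cmod (orb (ray r) n)"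
  shows "cmod (exp (- S n (ray r)) - 1) \<le> 1/4" "10 \<le> 3 * r ^ (2^(n-1))"
proof -
  have tV: "ray r \<in> V n" using ge by (simp add: V_def)
  have "cmod (S n (ray r)) \<le> 2 * (1 / cmod (orb (ray r) n))" using S_bound[OF tV] ratio_bound(2)[OF tV order_refl] by simp
  also have "\<dots> \<le> 2 * (1 / 10)" using ge by (intro mult_left_mono divide_left_mono) auto
  finally have "cmod (- S n (ray r)) \<le> 1/5" by simp
  then show "cmod (exp (- S n (ray r)) - 1) \<le> 1/4" by (rule norm_exp_minus_1)
  have "cmod (Phi (ray r)) = r" using r by (simp add: parameter_ray_properties(2)[OF r] norm_mult)
  then show "10 \<le> 3 * r ^ (2^(n-1))" using Phi_bounds(1)[OF n tV] ge by simp
qed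

lemma cos_a: "Q1 n \<Longrightarrow> 1/2 \<le> cos (2 * pi * a n)" "Q3 n \<Longrightarrow> cos (2 * pi * a n) \<le> - 1/2"
proof -
  assume "Q1 n"
  then have b: "0 \<le> 2 * pi * a n" "2 * pi * a n \<le> pi / 3" using a_Q1[of n] a_nonneg[of n] by (auto simp: field_simps)
  then have "cos (pi/3) \<le> cos (2 * pi * a n)" by (intro cos_monotone_0_pi_le) auto
  then show "1/2 \<le> cos (2 * pi * a n)" by (simp add: cos_60)
next
  assume "Q3 n"
  then have b: "0 \<le> 2 * pi * a n - pi" "2 * pi * a n - pi \<le> pi / 3" using a_Q3[of n] a_le[of n] by (auto simp: field_simps)
  then have "cos (pi/3) \<le> cos (2 * pi * a n - pi)" by (intro cos_monotone_0_pi_le) auto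
  then show "cos (2 * pi * a n) \<le> - 1/2" by (simp add: cos_60)
qed

text \<open>The angle bounds give a cosine of modulus at least 1/2, and the factor
  \<open>exp (- S n (ray r))\<close> changes it by at most 1/4.\<close>

lemma Re_orb_ray_large:
  assumes r: "1 < r" and n: "1 \<le> n" and ge: "10 \<le> cmod (orb (ray r) n)"
  shows "Q1 n \<Longrightarrow> r ^ (2^(n-1)) / 4 \<le> Re (orb (ray r) n)" "Q3 n \<Longrightarrow> Re (orb (ray r) n) \<le> - (r ^ (2^(n-1)) / 4)"
proof -
  have tV: "ray r \<in> V n" using ge by (simp add: V_def)
  define R where "R = r ^ (2^(n-1))"
  define e where "e = exp (- S n (ray r)) - 1"
  have e: "cmod e \<le> 1/4" and R: "10 \<le> 3 * R" using orb_ray_large[OF assms] by (auto simp: e_def R_def)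
  have "orb (ray r) n = of_real R * cis (2 * pi * a n) + of_real R * (cis (2 * pi * a n) * e)"
    unfolding ray_orb[OF r n tV] e_def R_def by (simp add: algebra_simps)
  then have Re: "Re (orb (ray r) n) = R * cos (2 * pi * a n) + R * Re (cis (2 * pi * a n) * e)" by simp
  have "\<bar>Re (cis (2 * pi * a n) * e)\<bar> \<le> cmod (cis (2 * pi * a n) * e)" by (rule abs_Re_le_cmod)
  also have "\<dots> \<le> 1/4" using e by (simp add: norm_mult)
  finally have "R * \<bar>Re (cis (2 * pi * a n) * e)\<bar> \<le> R * (1/4)" using R by (intro mult_left_mono) auto
  then have b: "\<bar>R * Re (cis (2 * pi * a n) * e)\<bar> \<le> R / 4" using R by (simp add: abs_mult)
  show "r ^ (2^(n-1)) / 4 \<le> Re (orb (ray r) n)" if "Q1 n"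
  proof -
    have "R * (1/2) \<le> R * cos (2 * pi * a n)" using cos_a that R by (intro mult_left_mono) auto
    then show ?thesis using Re b R unfolding R_def[symmetric] by linarith
  qed
  show "Re (orb (ray r) n) \<le> - (r ^ (2^(n-1)) / 4)" if "Q3 n"
  proof -
    have "R * cos (2 * pi * a n) \<le> R * (-1/2)" using cos_a that R by (intro mult_left_mono) auto
    then show ?thesis using Re b R unfolding R_def[symmetric] by linarith
  qed
qed

lemma sep_ray_large:
  assumes "1 < r" "1 \<le> n" "10 \<le> cmod (orb (ray r) n)"
  shows "sep (1/30) n (orb (ray r) n)"
proof -
  have "10 \<le> 3 * r ^ (2^(n-1))" by (rule orb_ray_large(2)[OF assms])
  then show ?thesis using Re_orb_ray_large[OF assms] unfolding sep_def by linarith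
qed

text \<open>For all \<open>r \<ge> r0\<close> at once, the indices beyond some \<open>m\<close> are
  settled by the Boettcher coordinate. Only finitely many indices are left to continuation, which
  starts so far out on the ray that every value is large.\<close>

lemma sep_ray:
  assumes r0: "1 < r0" and n: "1 \<le> n"
  shows "sep (1/30) n (orb (ray r0) n)"
proof -
  obtain m where m: "36 < r0 ^ m" using real_arch_pow[OF r0] by blast
  have ge: "12 \<le> cmod (orb (ray r) n)" if "1 < r" "36 \<le> r ^ (2^(n-1))" "1 \<le> n" for r n
  proof -
    have "cmod (Phi (ray r)) = r" using that by (simp add: parameter_ray_properties(2)[OF that(1)] norm_mult)
    then show ?thesis using orb_ge_of_Phi(1)[OF parameter_ray_properties(1)[OF that(1)] that(3)] that(2) by simp
  qed
  have tail: "sep (1/30) n (orb (ray r) n)" if "r0 \<le> r" "m < n" for r n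
  proof -
    have "m \<le> 2 ^ (n-1)" using less_exp[of "n-1"] that by linarith
    then have "r0 ^ m \<le> r0 ^ (2^(n-1))" using r0 by (intro power_increasing) auto
    also have "\<dots> \<le> r ^ (2^(n-1))" using that r0 by (intro power_mono) auto
    finally have "12 \<le> cmod (orb (ray r) n)" using that m r0 by (intro ge) auto
    then show ?thesis using that r0 by (intro sep_ray_large) auto
  qed
  have "sep (1/30) n (orb (ray r0) n)" if n: "n \<in> {1..m}"
  proof (rule sep_connected[of "{r0..}" "max r0 36" "{1..m}" "\<lambda>n r. orb (ray r) n" "1/30"])
    show "continuous_on {r0..} (\<lambda>r. orb (ray r) n)" for n
      by (rule continuous_on_compose2[OF continuous_on_orb[of UNIV] continuous_on_subset[OF continuous_on_parameter_ray]])
         (use r0 in auto)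
    show "sep (1/30) n (orb (ray (max r0 36)) n)" if "n \<in> {1..m}" for n
    proof -
      have "(36::real) ^ 1 \<le> 36 ^ (2^(n-1))" by (rule power_increasing) auto
      also have "\<dots> \<le> max r0 36 ^ (2^(n-1))" by (rule power_mono) auto
      finally have "12 \<le> cmod (orb (ray (max r0 36)) n)" using that r0 by (intro ge) auto
      then show ?thesis using that r0 by (intro sep_ray_large) auto
    qed
    fix r n assume r: "r \<in> {r0..}" and w: "\<And>n. n \<in> {1..m} \<Longrightarrow> weak_sep (1/30) n (orb (ray r) n)" and n: "n \<in> {1..m}"
    have w': "weak_sep (1/30) n (orb (ray r) n)" if "1 \<le> n" for n
      using w[of n] sep_imp_weak[OF tail[of r n]] r that by (cases "n \<le> m") auto
    show "sep (1/30) n (orb (ray r) n)"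
    proof (cases "10 \<le> cmod (ray r)")
      case True
      then have "10 \<le> cmod (orb (ray r) n)" using orb_large(1)[OF True, of n] n by auto
      then show ?thesis using r r0 n by (intro sep_ray_large) auto
    next
      case False
      then have "- 10 \<le> Re (ray r)" using abs_Re_le_cmod[of "ray r"] by linarith
      then show ?thesis using w'[of 1] w'[of 2] w'[of n] w'[of "Suc n"] w'[of "Suc (Suc n)"] n
        by (intro weak_sep_imp_sep[of "1/30" "ray r" n]) (auto simp: orb_Suc numeral_2_eq_2)
    qed
  qed (use n in auto)
  then show ?thesis using tail[of r0 n] n by (cases "n \<le> m") auto
qed

end

section \<open>Lifting along a component of large orbit values\<close>

context rotation begin

text \<open>The margin 1/30 exceeds the margin 1/60 kept on \<open>Om\<close>. The sign at type
  \<open>Q2\<close> makes sense because the orbit is real; it selects the real branches in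
  \<open>central_chain\<close>.\<close>

definition tuned :: "real \<Rightarrow> bool" where
  "tuned t \<longleftrightarrow> - 2 \<le> t \<and> (\<forall>n\<ge>1. sep (1/30) n (orb (of_real t) n) \<and> (Q2 n \<longrightarrow> Re (orb (of_real t) n) < 0))"

end

text \<open>Any large value would do: the disc of radius \<open>x0 - 1/50\<close> about \<open>x0\<close> has to contain all points of
  modulus at most 108 and real part at least 1/30.\<close>

abbreviation "x0 \<equiv> 1000000 :: real"

lemma orb_real: "Im (orb (of_real t) n) = 0"
  by (induction n) (auto simp: orb_Suc power2_eq_square)

lemma orb_real_bound:
  assumes "- 2 \<le> t" "t \<le> 0"
  shows "cmod (orb (of_real t) n) \<le> 2"
proof -
  have *: "\<bar>Re (orb (of_real t) (Suc n))\<bar> \<le> - t" for n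
  proof (induction n)
    case (Suc n)
    have "Re (orb (of_real t) (Suc (Suc n))) = Re (orb (of_real t) (Suc n)) ^ 2 + t"
      using orb_real[of t "Suc n"] by (simp add: orb_Suc[of _ "Suc n"] power2_eq_square)
    moreover have "Re (orb (of_real t) (Suc n)) ^ 2 \<le> (- t) ^ 2" using Suc assms by (intro power2_le_iff_abs_le[THEN iffD2]) auto
    moreover have "(- t) ^ 2 \<le> 2 * (- t)" using assms unfolding power2_eq_square by (intro mult_right_mono) auto
    ultimately show ?case using zero_le_power2[of "Re (orb (of_real t) (Suc n))"] assms by linarith
  qed (use assms in auto)
  have "cmod (orb (of_real t) n) = \<bar>Re (orb (of_real t) n)\<bar>" using orb_real[of t n] by (simp add: cmod_def)
  then show ?thesis using *[of "n-1"] assms by (cases n) auto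
qed

locale core = rotation +
  fixes k :: nat and ts :: real
  assumes k: "closest_return k" and ts: "tuned ts"
begin

abbreviation "K \<equiv> Suc (Suc k)"
text \<open>The ball of radius \<open>R\<close> about \<open>x0\<close> is tangent to the line of
  real part \<open>\<delta>\<close>. Three margins are nested: 1/30 for the tuned parameter, 1/50
  for the smaller disc, 1/60 for the disc that defines \<open>Om\<close>.\<close>

abbreviation "\<delta> \<equiv> 1/60 :: real"
abbreviation "R \<equiv> x0 - 1/60"

definition Om :: "complex set" where
  "Om = connected_component_set {t. orb t K \<in> ball (of_real x0) R} (of_real ts)"

lemma Qk: "Q2 k" "Q3 (Suc k)" "Q1 K" using closest_return_types[OF k] by auto

lemma k_ge_3: "3 \<le> k" by (rule closest_return_ge_3[OF k])

lemma ts_bounds: "- 2 \<le> ts" "ts < 0"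
  using ts Q3_1 unfolding tuned_def by (auto simp: sep_def dest: spec[of _ 1])

lemma sep_ts: "1 \<le> n \<Longrightarrow> sep (1/30) n (orb (of_real ts) n)" using ts by (simp add: tuned_def)

lemma orb_ts_in_core: "cmod (orb (of_real ts) K - of_real x0) \<le> x0 - 1/30"
proof -
  let ?c = "orb (of_real ts) K"
  have c: "1/30 < Re ?c" using sep_ts[of K] Qk by (simp add: sep_def)
  have "\<bar>Re ?c\<bar> \<le> 2" using orb_real_bound[of ts K] ts_bounds abs_Re_le_cmod[of ?c] by linarith
  then show ?thesis using c orb_real[of ts K] by (simp add: cmod_def)
qed

lemma Om_subset: "Om \<subseteq> {t. orb t K \<in> ball (of_real x0) R}" unfolding Om_def by (rule connected_component_subset)

lemma ts_in_Om: "of_real ts \<in> Om"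
  using orb_ts_in_core unfolding Om_def mem_Collect_eq
  by (intro connected_component_refl) (simp add: dist_norm norm_minus_commute)

lemma open_preimage: "open {t. orb t K \<in> ball (of_real x0) R}"
proof -
  have "open ((\<lambda>t. orb t K) -` ball (of_real x0) R)" by (intro open_vimage continuous_on_orb) auto
  then show ?thesis by (simp add: vimage_def)
qed

lemma open_Om: "open Om" unfolding Om_def by (rule open_connected_component[OF open_preimage])
lemma connected_Om: "connected Om" by (simp add: Om_def connected_connected_component)
lemma simply_connected_Om: "simply_connected Om"
  unfolding Om_def by (rule simply_connected_component_preimage_ball[OF holomorphic_orb])

lemma Om_maximal:
  assumes "connected T" "t1 \<in> T" "t1 \<in> Om" "\<And>t. t \<in> T \<Longrightarrow> orb t K \<in> ball (of_real x0) R"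
  shows "T \<subseteq> Om"
proof -
  have "connected_component_set {t. orb t K \<in> ball (of_real x0) R} t1 = Om"
    using assms(3) unfolding Om_def by (metis connected_component_eq)
  moreover have "T \<subseteq> connected_component_set {t. orb t K \<in> ball (of_real x0) R} t1"
    by (rule connected_component_maximal) (use assms in auto)
  ultimately show ?thesis by simp
qed

lemma cnj_Om: assumes "t \<in> Om" shows "cnj t \<in> Om"
proof -
  have "cnj ` Om \<subseteq> Om"
  proof (rule Om_maximal)
    show "connected (cnj ` Om)" by (intro connected_continuous_image connected_Om continuous_intros)
    show "of_real ts \<in> cnj ` Om" using ts_in_Om by (metis complex_cnj_complex_of_real imageI)
    fix t assume "t \<in> cnj ` Om"
    then obtain s where s: "s \<in> Om" "t = cnj s" by blast
    have "orb t K - of_real x0 = cnj (orb s K - of_real x0)" using s orb_cnj[of s K] by simp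
    then have "cmod (orb t K - of_real x0) = cmod (orb s K - of_real x0)" by (simp only: complex_mod_cnj)
    then show "orb t K \<in> ball (of_real x0) R" using s Om_subset by (auto simp: dist_norm norm_minus_commute)
  qed (rule ts_in_Om)
  then show ?thesis using assms by blast
qed

lemma orb_K_Om:
  assumes "t \<in> Om" shows "\<delta> < Re (orb t K)" "cmod (orb t K) < 2 * x0" "cmod (orb t K - of_real x0) < R"
proof -
  show b: "cmod (orb t K - of_real x0) < R" using assms Om_subset by (auto simp: dist_norm norm_minus_commute)
  then show "\<delta> < Re (orb t K)" using abs_Re_le_cmod[of "orb t K - of_real x0"] by simp
  show "cmod (orb t K) < 2 * x0" using b norm_triangle_ineq[of "orb t K - of_real x0" "of_real x0"] by simp
qed

lemma Om_bounded: assumes t: "t \<in> Om" shows "cmod t < 10"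
proof (rule ccontr)
  assume "\<not> cmod t < 10"
  then have t10: "10 \<le> cmod t" by simp
  have st: "cmod (orb t j) * (cmod (orb t j) - 1) \<le> cmod (orb t (Suc j))" "10 \<le> cmod (orb t j)" if "1 \<le> j" for j
  proof -
    show 10: "10 \<le> cmod (orb t j)" using orb_large(1)[OF t10 that] t10 by linarith
    show "cmod (orb t j) * (cmod (orb t j) - 1) \<le> cmod (orb t (Suc j))"
      by (rule orb_step) (use 10 orb_large(1)[OF t10 that] in linarith)+
  qed
  have mm: "b * (b - 1) \<le> cmod (orb t (Suc j))" if "1 \<le> j" "b \<le> cmod (orb t j)" "10 \<le> b" for j b
  proof -
    have "b * (b - 1) \<le> cmod (orb t j) * (cmod (orb t j) - 1)" using that by (intro mult_mono) linarith+
    then show ?thesis using st(1)[OF that(1)] by linarith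
  qed
  \<comment> \<open>The bounds iterate \<open>b * (b - 1)\<close> from 10; the fourth one already
    exceeds \<open>2 * x0\<close>, and \<open>K\<close> is at least 5.\<close>
  have 2: "90 \<le> cmod (orb t 2)" using mm[of 1 10] st(2)[of 1] by (simp add: numeral_2_eq_2)
  have 3: "8010 \<le> cmod (orb t 3)" using mm[of 2 90] 2 by (simp add: numeral_3_eq_3)
  have 4: "64000000 \<le> cmod (orb t 4)" using mm[of 3 8010] 3 by (simp add: eval_nat_numeral)
  have "64000000 \<le> cmod (orb t K)"
    using orb_less[of t 4 K] orb_strict[of t 4 K] param_le_orb[of t 4] 4 k_ge_3 by auto
  then show False using orb_K_Om(2)[OF t] by simp
qed

lemma Re_bound: "t \<in> Om \<Longrightarrow> - 10 \<le> Re t" using Om_bounded[of t] abs_Re_le_cmod[of t] by linarith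

text \<open>Separation at \<open>K\<close> comes from the disc itself. For earlier indices
  \<open>weak_sep_imp_sep\<close> looks two steps ahead only across an index of type
  \<open>Q2\<close>, hence never beyond \<open>K\<close>, which has type \<open>Q1\<close>.\<close>

lemma sep_Om:
  assumes "t \<in> Om" "1 \<le> n" "n \<le> K" shows "sep \<delta> n (orb t n)"
proof (rule sep_connected[of Om "of_real ts" "{1..K}" "\<lambda>n t. orb t n"])
  show "sep \<delta> n (orb (of_real ts) n)" if "n \<in> {1..K}" for n by (rule sep_mono[OF sep_ts]) (use that in auto)
  fix t n assume t: "t \<in> Om" and w: "\<And>m. m \<in> {1..K} \<Longrightarrow> weak_sep \<delta> m (orb t m)" and n: "n \<in> {1..K}"
  show "sep \<delta> n (orb t n)"
  proof (cases "n = K")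
    case True then show ?thesis using orb_K_Om(1)[OF t] Qk(3) type_disjoint(2)[of K] by (auto simp: sep_def)
  next
    case False
    have "weak_sep \<delta> (Suc (Suc n)) (orb t (Suc (Suc n)))" if "Q2 (Suc n)"
    proof -
      have "Suc n \<noteq> K" using that Qk(3) type_disjoint(1)[of K] by auto
      then show ?thesis using w n False by auto
    qed
    then show ?thesis using w[of 1] w[of 2] w[of n] w[of "Suc n"] n False Re_bound[OF t]
      by (intro weak_sep_imp_sep[of \<delta> t n]) (auto simp: orb_Suc numeral_2_eq_2)
  qed
qed (use assms ts_in_Om connected_Om continuous_on_orb in auto)

lemma Re_Om: "t \<in> Om \<Longrightarrow> Re t < - \<delta>" "t \<in> Om \<Longrightarrow> \<delta> < Re (t ^ 2 + t)"
  using sep_Om[of t 1] sep_Om[of t 2] Q3_1 Q1_2 by (auto simp: sep_def numeral_2_eq_2 orb_Suc)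

text \<open>If a pulled back orbit met the parameter at time \<open>Suc i\<close>, it would continue as the critical
  orbit itself; after the first mismatch of the two itineraries their pairs of types can only
  alternate between \<open>(Q2, Q3)\<close> and \<open>(Q3, Q2)\<close>, which is incompatible with \<open>Q1 K\<close>.\<close>

lemma chain_avoids_parameter:
  assumes t: "t \<in> Om" and i: "1 \<le> i" "i < k"
    and step: "\<And>j. i < j \<Longrightarrow> j < K \<Longrightarrow> z (Suc j) = z j ^ 2 + t" and sep: "\<And>j. i < j \<Longrightarrow> j \<le> K \<Longrightarrow> sep \<delta> j (z j)"
  shows "z (Suc i) \<noteq> t"
proof
  assume eq: "z (Suc i) = t"
  have z: "z (i + m) = orb t m" if "1 \<le> m" "i + m \<le> K" for m
    using that
  proof (induction m rule: dec_induct)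
    case (step m) then show ?case using assms(4)[of "i + m"] by (simp add: orb_Suc)
  qed (use eq in simp)
  have sep2: "sep \<delta> (i + m) (orb t m)" "sep \<delta> m (orb t m)" if "1 \<le> m" "i + m \<le> K" for m
    using sep[of "i + m"] z[OF that] sep_Om[OF t, of m] that by auto
  consider "Q1 i \<or> Q3 i" | "Q2 i" using type_cases by blast
  then show False
  proof cases
    \<comment> \<open>The values of \<open>z\<close> at the next two times are \<open>t\<close>, on
      the left, and \<open>t ^ 2 + t\<close>, on the right; the types that can follow
      \<open>Q1\<close> or \<open>Q3\<close> do not allow this.\<close>
    case 1
    then have "\<not> Q3 (Suc i)" using not_Q2_Suc type_disjoint by blast
    then consider "Q1 (Suc i)" | "Q2 (Suc i)" using type_cases by blast
    then show False
    proof cases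
      case 1 then show False using sep2(1)[of 1] i Re_Om(1)[OF t] by (simp add: sep_def)
    next
      case 2
      then show False using sep2(1)[of 2] i Re_Om(2)[OF t] Q2_Suc[OF 2]
        by (simp add: sep_def orb_Suc numeral_2_eq_2)
    qed
  next
    case 2
    obtain j where j: "1 \<le> j" "i + j \<le> k" "Q2 (i + j)" "Q1 j" using first_mismatch[OF k i(1,2) 2] by metis
    have "(Q2 (i + m) \<and> (Q1 m \<or> Q3 m)) \<or> (Q3 (i + m) \<and> Q2 m)" if "j \<le> m" "i + m \<le> K" for m
      using that
    proof (induction m rule: dec_induct)
      case base then show ?case using j by blast
    next
      case (step m)
      then have s: "sep \<delta> (Suc (i + m)) (orb t (Suc m))" "sep \<delta> (Suc m) (orb t (Suc m))"
        using sep2[of "Suc m"] j by auto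
      from step have "(Q2 (i + m) \<and> (Q1 m \<or> Q3 m)) \<or> (Q3 (i + m) \<and> Q2 m)" by simp
      then show ?case
      proof
        assume h: "Q2 (i + m) \<and> (Q1 m \<or> Q3 m)"
        then have 3: "Q3 (Suc (i + m))" using Q2_Suc by blast
        then have "\<not> Q1 (Suc m)" using s by (auto simp: sep_def)
        moreover have "\<not> Q3 (Suc m)" using h not_Q2_Suc type_disjoint by blast
        ultimately show ?thesis using 3 type_cases[of "Suc m"] by auto
      next
        assume h: "Q3 (i + m) \<and> Q2 m"
        then have 3: "Q3 (Suc m)" using Q2_Suc by blast
        then have "\<not> Q1 (Suc (i + m))" using s by (auto simp: sep_def)
        moreover have "\<not> Q3 (Suc (i + m))" using h not_Q2_Suc type_disjoint by blast
        ultimately show ?thesis using 3 type_cases[of "Suc (i + m)"] by auto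
      qed
    qed
    moreover have "j \<le> K - i" "i + (K - i) = K" using j i by linarith+
    ultimately have "Q2 K \<or> Q3 K" by (metis order_refl)
    then show False using Qk(3) type_disjoint by blast
  qed
qed

section \<open>Continuous lifting of backward orbits\<close>

lemma scaled_step:
  fixes w :: real and y y' t :: complex
  assumes "y ^ 2 = y' - t * of_real w ^ (2^i)" "0 < w" "1 \<le> i"
  shows "y' / of_real w ^ (2^i) = (y / of_real w ^ (2^(i-1))) ^ 2 + t"
proof -
  have "2^(i-1) * 2 = (2::nat)^i" using assms by (cases i) auto
  then have "(of_real w ^ (2^(i-1)))^2 = (of_real w :: complex) ^ (2^i)" by (simp only: power_mult[symmetric])
  then have "(y / of_real w ^ (2^(i-1))) ^ 2 = (y' - t * of_real w ^ (2^i)) / of_real w ^ (2^i)"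
    using assms(1) by (simp add: power_divide)
  then show ?thesis using assms(2) by (simp add: diff_divide_distrib)
qed

text \<open>The weight \<open>\<omega>\<close> rescales as in \<open>achain\<close>. Where it is
  positive, the rescaled chain is a true backward orbit, \<open>Z1\<close> prolongs it by two
  forward steps to time \<open>K\<close>, and \<open>chain_avoids_parameter\<close> keeps the
  radicand nonzero; where it vanishes, the radicand is the next entry itself. The constant weight 1
  serves to move the value at time \<open>k\<close>, the weight \<open>v\<close> to push the end
  point to infinity.\<close>

lemma lift_chain:
  fixes \<omega> :: "real \<Rightarrow> real" and Z :: "complex \<times> real \<Rightarrow> complex" and g :: "nat \<Rightarrow> complex \<Rightarrow> complex"
  assumes s0: "s0 \<in> {0..1}" "\<omega> s0 = 1"
    and \<omega>: "continuous_on {0..1} \<omega>" "\<And>s. s \<in> {0..1} \<Longrightarrow> 0 \<le> \<omega> s" "connected {s \<in> {0..1}. 0 < \<omega> s}"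
    and Z: "continuous_on (Om \<times> {0..1}) Z"
    and Z1: "\<And>t s. t \<in> Om \<Longrightarrow> s \<in> {0..1} \<Longrightarrow> 0 < \<omega> s \<Longrightarrow> Re ((Z (t,s) / of_real (\<omega> s) ^ (2^(k-1))) ^ 2 + t) < - \<delta>"
      "\<And>t s. t \<in> Om \<Longrightarrow> s \<in> {0..1} \<Longrightarrow> 0 < \<omega> s \<Longrightarrow> \<delta> < Re (((Z (t,s) / of_real (\<omega> s) ^ (2^(k-1))) ^ 2 + t) ^ 2 + t)"
    and Z0: "\<And>t s. t \<in> Om \<Longrightarrow> s \<in> {0..1} \<Longrightarrow> \<omega> s = 0 \<Longrightarrow> Z (t,s) \<noteq> 0"
    and g: "\<And>i. i \<in> {1..k} \<Longrightarrow> continuous_on Om (g i)" "\<And>t. t \<in> Om \<Longrightarrow> g k t = Z (t,s0)"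
      "\<And>i t. i \<in> {1..<k} \<Longrightarrow> t \<in> Om \<Longrightarrow> g i t ^ 2 = g (Suc i) t - t"
      "\<And>i t. i \<in> {1..k} \<Longrightarrow> t \<in> Om \<Longrightarrow> sep \<delta> i (g i t)"
  obtains Y where "\<And>i. i \<in> {1..k} \<Longrightarrow> continuous_on (Om \<times> {0..1}) (Y i)" "\<And>t s. t \<in> Om \<Longrightarrow> s \<in> {0..1} \<Longrightarrow> Y k (t,s) = Z (t,s)"
    "\<And>i t s. i \<in> {1..<k} \<Longrightarrow> t \<in> Om \<Longrightarrow> s \<in> {0..1} \<Longrightarrow> Y i (t,s) ^ 2 = Y (Suc i) (t,s) - t * of_real (\<omega> s) ^ (2^i)"
    "\<And>i t s. i \<in> {1..<k} \<Longrightarrow> t \<in> Om \<Longrightarrow> s \<in> {0..1} \<Longrightarrow> Y i (t,s) \<noteq> 0"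
    "\<And>i t. i \<in> {1..k} \<Longrightarrow> t \<in> Om \<Longrightarrow> Y i (t,s0) = g i t"
    "\<And>i t s. i \<in> {1..k} \<Longrightarrow> t \<in> Om \<Longrightarrow> s \<in> {0..1} \<Longrightarrow> 0 < \<omega> s \<Longrightarrow> sep \<delta> i (Y i (t,s) / of_real (\<omega> s) ^ (2^(i-1)))"
proof -
  define T where "T = {s \<in> {0..1}. 0 < \<omega> s}"
  define P where "P m Y \<longleftrightarrow> (\<forall>i\<in>{m..k}. continuous_on (Om \<times> {0..1}) (Y i)) \<and> (\<forall>t\<in>Om. \<forall>s\<in>{0..1}. Y k (t,s) = Z (t,s)) \<and>
     (\<forall>i\<in>{m..<k}. \<forall>t\<in>Om. \<forall>s\<in>{0..1}. Y i (t,s) ^ 2 = Y (Suc i) (t,s) - t * of_real (\<omega> s) ^ (2^i) \<and> Y i (t,s) \<noteq> 0) \<and>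
     (\<forall>i\<in>{m..k}. \<forall>t\<in>Om. Y i (t,s0) = g i t)" for m and Y :: "nat \<Rightarrow> complex \<times> real \<Rightarrow> complex"
  define sc where "sc Y i u = Y i u / of_real (\<omega> (snd u)) ^ (2^(i-1))" for Y :: "nat \<Rightarrow> complex \<times> real \<Rightarrow> complex" and i u
  have T01: "T \<subseteq> {0..1}" by (auto simp: T_def)
  have sc_step: "sc Y (Suc i) (t,s) = sc Y i (t,s) ^ 2 + t"
    if "P m Y" "1 \<le> m" "m \<le> i" "i < k" "t \<in> Om" "s \<in> T" for m Y i t s
  proof -
    have "Y i (t,s) ^ 2 = Y (Suc i) (t,s) - t * of_real (\<omega> s) ^ (2^i)" "0 < \<omega> s" "1 \<le> i"
      using that by (auto simp: P_def T_def)
    from scaled_step[OF this] show ?thesis by (simp add: sc_def)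
  qed
  have sc_k: "Re (sc Y k (t,s) ^ 2 + t) < - \<delta>" "\<delta> < Re ((sc Y k (t,s) ^ 2 + t) ^ 2 + t)"
    if "P m Y" "t \<in> Om" "s \<in> T" for m Y t s
  proof -
    have "sc Y k (t,s) = Z (t,s) / of_real (\<omega> s) ^ (2^(k-1))" "s \<in> {0..1}" "0 < \<omega> s"
      using that by (auto simp: P_def sc_def T_def)
    then show "Re (sc Y k (t,s) ^ 2 + t) < - \<delta>" "\<delta> < Re ((sc Y k (t,s) ^ 2 + t) ^ 2 + t)"
      using Z1[OF that(2), of s] by simp_all
  qed
  have P_sep: "sep \<delta> i (sc Y i (t,s))"
    if P: "P m Y" and m: "1 \<le> m" "m \<le> k" and i: "i \<in> {m..k}" and ts': "t \<in> Om" "s \<in> T" for m Y i t s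
  proof (rule sep_connected[of "Om \<times> T" "(of_real ts, s0)" "{m..k}" "sc Y"])
    show "connected (Om \<times> T)" using connected_Om \<omega>(3) unfolding T_def by (rule connected_Times)
    show "(of_real ts, s0) \<in> Om \<times> T" using ts_in_Om s0 by (simp add: T_def)
    show "continuous_on (Om \<times> T) (sc Y i)" if "i \<in> {m..k}" for i
      unfolding sc_def
    proof (intro continuous_intros)
      show "continuous_on (Om \<times> T) (Y i)"
        by (rule continuous_on_subset[of "Om \<times> {0..1}"]) (use P that T01 in \<open>auto simp: P_def\<close>)
      show "continuous_on (Om \<times> T) (\<lambda>u. \<omega> (snd u))"
        by (rule continuous_on_compose2[OF \<omega>(1)]) (use T01 in \<open>auto intro!: continuous_intros\<close>)
    qed (auto simp: T_def)
    show "sep \<delta> i (sc Y i (of_real ts, s0))" if "i \<in> {m..k}" for i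
      using P that ts_in_Om s0 g(4)[of i "of_real ts"] m by (auto simp: sc_def P_def)
    fix u i assume u: "u \<in> Om \<times> T" and w: "\<And>n. n \<in> {m..k} \<Longrightarrow> weak_sep \<delta> n (sc Y n u)" and i: "i \<in> {m..k}"
    obtain t s where u_eq: "u = (t,s)" "t \<in> Om" "s \<in> T" using u by auto
    show "sep \<delta> i (sc Y i u)"
    proof (cases "i = k")
      case True then show ?thesis using Qk(1) type_disjoint by (auto simp: sep_def)
    next
      case False
      have st: "sc Y (Suc i) u = sc Y i u ^ 2 + t" using sc_step[OF P m(1), of i t s] i False u_eq by simp
      have w3: "weak_sep \<delta> (Suc (Suc i)) (sc Y (Suc i) u ^ 2 + t)"
      proof (cases "Suc i = k")
        case True
        then show ?thesis using sc_k(1)[OF P u_eq(2,3)] Qk(2) type_disjoint(2)[of "Suc k"] u_eq by (auto simp: weak_sep_def)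
      next
        case False
        then have "sc Y (Suc (Suc i)) u = sc Y (Suc i) u ^ 2 + t"
          using sc_step[OF P m(1), of "Suc i" t s] i \<open>i \<noteq> k\<close> u_eq by simp
        moreover have "weak_sep \<delta> (Suc (Suc i)) (sc Y (Suc (Suc i)) u)" by (rule w) (use i False \<open>i \<noteq> k\<close> in auto)
        ultimately show ?thesis by simp
      qed
      show ?thesis
      proof (rule weak_sep_imp_sep[of \<delta> t i])
        show "weak_sep \<delta> 1 t" "weak_sep \<delta> 2 (t ^ 2 + t)"
          using sep_imp_weak[OF sep_Om[OF u_eq(2), of 1]] sep_imp_weak[OF sep_Om[OF u_eq(2), of 2]]
          by (auto simp: orb_Suc numeral_2_eq_2)
        show "weak_sep \<delta> (Suc i) (sc Y i u ^ 2 + t)" using w[of "Suc i"] i False st by auto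
        show "weak_sep \<delta> (Suc (Suc i)) ((sc Y i u ^ 2 + t) ^ 2 + t)" using w3 st by simp
      qed (use w[OF i] Re_bound[OF u_eq(2)] in auto)
    qed
  qed (use i ts' in auto)
  have "\<exists>Y. P m Y" if "m \<le> k" "1 \<le> m" for m
    using that
  proof (induction m rule: inc_induct)
    case base
    have "P k (\<lambda>i. Z)" unfolding P_def using Z g(2) by simp
    then show ?case by blast
  next
    case (step m)
    then obtain Y where Y: "P (Suc m) Y" by auto
    have mk: "1 \<le> m" "m < k" using step by auto
    define F where "F = (\<lambda>u. Y (Suc m) u - fst u * of_real (\<omega> (snd u)) ^ (2^m))"
    have cF: "continuous_on (Om \<times> {0..1}) F"
      unfolding F_def
    proof (intro continuous_intros)
      show "continuous_on (Om \<times> {0..1}) (Y (Suc m))" using Y mk by (simp add: P_def)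
      show "continuous_on (Om \<times> {0..1}) (\<lambda>u. \<omega> (snd u))"
        by (rule continuous_on_compose2[OF \<omega>(1)]) (auto intro!: continuous_intros)
    qed
    have nz: "F (t,s) \<noteq> 0" if ts': "t \<in> Om" "s \<in> {0..1}" for t s
    proof (cases "0 < \<omega> s")
      case False
      then have w0: "\<omega> s = 0" using \<omega>(2)[OF ts'(2)] by simp
      have "Y (Suc m) (t,s) \<noteq> 0"
      proof (cases "Suc m = k")
        case True then show ?thesis using Y ts' Z0[OF ts' w0] by (auto simp: P_def)
      next
        case False then show ?thesis using Y ts' mk by (auto simp: P_def)
      qed
      then show ?thesis using w0 by (simp add: F_def power_0_left)
    next
      case True
      then have sT: "s \<in> T" using ts' by (simp add: T_def)
      \<comment> \<open>The backward orbit, prolonged from time \<open>k\<close> to the times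
        \<open>Suc k\<close> and \<open>K\<close>.\<close>
      define z where "z j = (if j = K then (sc Y k (t,s) ^ 2 + t) ^ 2 + t else if j = Suc k then sc Y k (t,s) ^ 2 + t else sc Y j (t,s))" for j
      have "z (Suc m) \<noteq> t"
      proof (rule chain_avoids_parameter[OF ts'(1) mk])
        fix j assume j: "m < j"
        { assume "j < K"
          then consider "j = Suc k" | "j = k" | "j < k" by linarith
          then show "z (Suc j) = z j ^ 2 + t"
          proof cases
            case 3 then show ?thesis using sc_step[OF Y, of j t s] j ts' sT by (simp add: z_def)
          qed (simp_all add: z_def) }
        { assume "j \<le> K"
          then consider "j = K" | "j = Suc k" | "j \<le> k" by linarith
          then show "sep \<delta> j (z j)"
          proof cases
            case 1 then show ?thesis using sc_k(2)[OF Y ts'(1) sT] Qk(3) type_disjoint(2)[of K] by (auto simp: z_def sep_def)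
          next
            case 2 then show ?thesis using sc_k(1)[OF Y ts'(1) sT] Qk(2) type_disjoint(2)[of "Suc k"] by (auto simp: z_def sep_def)
          next
            case 3 then show ?thesis using P_sep[OF Y, of j t s] j mk ts' sT by (simp add: z_def)
          qed }
      qed
      then have "sc Y (Suc m) (t,s) \<noteq> t" using mk by (simp add: z_def)
      then show ?thesis using True by (simp add: F_def sc_def field_simps)
    qed
    have F0: "F (t,s0) = g m t ^ 2" if "t \<in> Om" for t
      using Y g(3)[of m t] that mk s0 by (auto simp: F_def P_def)
    have nz': "F u \<noteq> 0" if "u \<in> Om \<times> {0..1}" for u using nz that by auto
    have "(of_real ts, s0) \<in> Om \<times> {0..1}" "g m (of_real ts) ^ 2 = F (of_real ts, s0)"
      using ts_in_Om s0 F0[OF ts_in_Om] by simp_all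
    then obtain G where G: "continuous_on (Om \<times> {0..1}) G" "\<And>u. u \<in> Om \<times> {0..1} \<Longrightarrow> G u ^ 2 = F u"
      "G (of_real ts, s0) = g m (of_real ts)"
      using sqrt_lift[OF open_Om simply_connected_Om cF nz'] by blast
    have Gs0: "G (t,s0) = g m t" if "t \<in> Om" for t
    proof (rule sqrt_unique[OF connected_Om, of "\<lambda>t. G (t,s0)" "g m" "of_real ts"])
      show "continuous_on Om (\<lambda>t. G (t,s0))"
        by (rule continuous_on_compose2[OF G(1)]) (use s0 in \<open>auto intro!: continuous_intros\<close>)
      show "G (t,s0) ^ 2 = g m t ^ 2" if "t \<in> Om" for t using G(2)[of "(t,s0)"] F0 that s0 by auto
      show "G (t,s0) \<noteq> 0" if "t \<in> Om" for t using G(2)[of "(t,s0)"] nz[of t s0] that s0 by auto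
    qed (use that G(3) ts_in_Om g(1) mk in auto)
    have "P m (Y(m := G))"
      unfolding P_def
    proof (intro conjI ballI)
      fix i assume "i \<in> {m..k}" 
      then show "continuous_on (Om \<times> {0..1}) ((Y(m := G)) i)" using Y G by (auto simp: P_def)
    next
      fix t s assume "t \<in> Om" "s \<in> {0..1::real}" then show "(Y(m := G)) k (t,s) = Z (t,s)" using Y mk by (auto simp: P_def)
    next
      fix i t s assume i: "i \<in> {m..<k}" "t \<in> Om" "s \<in> {0..1::real}"
      then show "(Y(m := G)) i (t,s) ^ 2 = (Y(m := G)) (Suc i) (t,s) - t * of_real (\<omega> s) ^ (2^i)"
        using Y G(2)[of "(t,s)"] by (cases "i = m") (auto simp: P_def F_def)
      show "(Y(m := G)) i (t,s) \<noteq> 0" using i Y G(2)[of "(t,s)"] nz[of t s] by (cases "i = m") (auto simp: P_def)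
    next
      fix i t assume "i \<in> {m..k}" "t \<in> Om"
      then show "(Y(m := G)) i (t,s0) = g i t" using Y Gs0 by (cases "i = m") (auto simp: P_def)
    qed
    then show ?case by blast
  qed
  then have "\<exists>Y. P 1 Y" using k_ge_3 by simp
  then obtain Y where Y: "P 1 Y" by blast
  show thesis
  proof (rule that[of Y])
    show "sep \<delta> i (Y i (t,s) / of_real (\<omega> s) ^ (2^(i-1)))" if "i \<in> {1..k}" "t \<in> Om" "s \<in> {0..1}" "0 < \<omega> s" for i t s
      using P_sep[OF Y, of i t s] that by (simp add: sc_def T_def)
  qed (use Y in \<open>auto simp: P_def\<close>)
qed

end

section \<open>Plane geometry of the deformations\<close>

text \<open>The region \<open>Re y < 0\<close>, \<open>Re (y ^ 2) > m\<close> is the inside of one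
  branch of a hyperbola. Its convexity reduces to a reversed Cauchy-Schwarz inequality for the mixed
  product.\<close>

lemma left_hyperbola_convex:
  fixes y1 y2 :: complex
  assumes y: "Re y1 < 0" "m < Re (y1 ^ 2)" "Re y2 < 0" "m < Re (y2 ^ 2)" and m: "0 < m" and l: "0 \<le> l" "l \<le> 1"
  shows "m < Re ((of_real (1 - l) * y1 + of_real l * y2) ^ 2)"
proof -
  define a1 where "a1 = - Re y1"
  define a2 where "a2 = - Re y2"
  define b1 where "b1 = Im y1"
  define b2 where "b2 = Im y2"
  have h: "0 < a1" "0 < a2" "m + b1 ^ 2 < a1 ^ 2" "m + b2 ^ 2 < a2 ^ 2"
    using y by (auto simp: a1_def a2_def b1_def b2_def power2_eq_square)
  have "m + b1 * b2 < a1 * a2"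
  proof (rule ccontr)
    assume n: "\<not> m + b1 * b2 < a1 * a2"
    have "(m + b1 ^ 2) * (m + b2 ^ 2) < a1 ^ 2 * a2 ^ 2"
      using h m by (intro mult_strict_mono) (auto intro: add_pos_nonneg)
    also have "\<dots> = (a1 * a2) ^ 2" by (simp add: power_mult_distrib)
    also have "\<dots> \<le> (m + b1 * b2) ^ 2" using n h by (intro power_mono) auto
    finally have "m * (b1 - b2) ^ 2 < 0" by (simp add: power2_eq_square algebra_simps)
    then show False using m by (simp add: mult_less_0_iff)
  qed
  then have c: "m \<le> Re (y1 * y2)" by (simp add: a1_def a2_def b1_def b2_def)
  have "Re ((of_real (1 - l) * y1 + of_real l * y2) ^ 2) = (1-l)^2 * Re (y1^2) + l^2 * Re (y2^2) + 2 * l * (1-l) * Re (y1 * y2)"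
    by (simp add: power2_eq_square algebra_simps)
  moreover have "(1-l)^2 * Re (y1^2) + l^2 * Re (y2^2) > (1-l)^2 * m + l^2 * m"
  proof (cases "l = 0")
    case False
    then have "l^2 * m < l^2 * Re (y2^2)" using y by simp
    moreover have "(1-l)^2 * m \<le> (1-l)^2 * Re (y1^2)" using y by (intro mult_left_mono) auto
    ultimately show ?thesis by linarith
  qed (use y in simp)
  moreover have "2 * l * (1-l) * m \<le> 2 * l * (1-l) * Re (y1 * y2)" using c l by (intro mult_left_mono) auto
  moreover have "m = (1-l)^2 * m + l^2 * m + 2 * l * (1-l) * m" by (simp add: power2_eq_square algebra_simps)
  ultimately show ?thesis by linarith
qed

lemma nonzero_imp_pos:
  fixes f :: "real \<Rightarrow> real"
  assumes cont: "continuous_on {0..1} f" and nz: "\<And>v. v \<in> {0..1} \<Longrightarrow> f v \<noteq> 0" and u: "u \<in> {0..1}" "0 < f u" and v: "v \<in> {0..1}"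
  shows "0 < f v"
proof (rule ccontr)
  assume "\<not> 0 < f v"
  then have "f v \<le> 0" by simp
  have "connected (f ` {0..1})" by (intro connected_continuous_image cont) auto
  then have "0 \<in> f ` {0..1}" using u v \<open>f v \<le> 0\<close> unfolding connected_iff_interval by (meson imageI less_imp_le)
  then show False using nz by auto
qed

text \<open>Since \<open>x0 - 10\<close> exceeds \<open>900 ^ 2\<close>, the principal root stays
  far to the right and dominates \<open>t\<close>. The third conclusion is an implication from
  \<open>0 \<le> w' \<le> 1\<close>, written as a disjunction.\<close>

lemma csqrt_near_x0:
  fixes t :: complex
  assumes t: "cmod t < 10" and w: "0 \<le> w" "w \<le> (1::real)"
  shows "of_real x0 - t * of_real w \<notin> \<real>\<^sub>\<le>\<^sub>0" "900 \<le> Re (csqrt (of_real x0 - t * of_real w))"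
    "Re (- csqrt (of_real x0 - t * of_real w) - t * of_real w') < 0 \<or> \<not> (0 \<le> w' \<and> w' \<le> 1)"
proof -
  have b: "\<bar>Re (t * of_real u)\<bar> \<le> 10" if "0 \<le> u" "u \<le> 1" for u
  proof -
    have "\<bar>Re (t * of_real u)\<bar> \<le> cmod (t * of_real u)" by (rule abs_Re_le_cmod)
    also have "\<dots> \<le> 10 * 1" unfolding norm_mult using t that by (intro mult_mono) auto
    finally show ?thesis by simp
  qed
  let ?z = "of_real x0 - t * of_real w"
  have Re: "810000 \<le> Re ?z" using b[OF w] unfolding minus_complex.sel(1) Re_complex_of_real by linarith
  then show "?z \<notin> \<real>\<^sub>\<le>\<^sub>0" unfolding complex_nonpos_Reals_iff by linarith
  have "900 ^ 2 \<le> (cmod ?z + Re ?z) / 2" using Re complex_Re_le_cmod[of ?z] by simp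
  then have "900 \<le> sqrt ((cmod ?z + Re ?z) / 2)" by (rule real_le_rsqrt)
  then show 9: "900 \<le> Re (csqrt ?z)" unfolding csqrt.simps .
  show "Re (- csqrt ?z - t * of_real w') < 0 \<or> \<not> (0 \<le> w' \<and> w' \<le> 1)"
    using 9 b[of w'] unfolding minus_complex.sel(1) uminus_complex.sel(1) by linarith
qed

lemma Im_sign_of_square:
  fixes z w :: complex
  assumes "Im (z ^ 2) = Im w"
  shows "0 < Re z \<Longrightarrow> 0 < Im w \<Longrightarrow> 0 < Im z" "Re z < 0 \<Longrightarrow> 0 < Im w \<Longrightarrow> Im z < 0" "Re z < 0 \<Longrightarrow> Im w < 0 \<Longrightarrow> 0 < Im z"
  using assms by (auto simp: power2_eq_square zero_less_mult_iff mult_less_0_iff dest!: sym[of _ "Im w"])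

context core begin

text \<open>The image \<open>(of_real s * c) ^ 2 + t\<close> runs along the segment from
  \<open>t\<close> to \<open>c ^ 2 + t\<close>, and both ends lie in the convex region of
  \<open>left_hyperbola_convex\<close> with \<open>m = \<delta> - Re t\<close>.\<close>

lemma radial_path:
  assumes t: "t \<in> Om" and c: "Re (c ^ 2 + t) < - \<delta>" "\<delta> < Re ((c ^ 2 + t) ^ 2 + t)" and s: "s \<in> {0..1}"
  shows "Re ((of_real s * c) ^ 2 + t) < - \<delta>" "\<delta> < Re (((of_real s * c) ^ 2 + t) ^ 2 + t)"
proof -
  have t1: "Re t < - \<delta>" "\<delta> < Re (t ^ 2 + t)" using Re_Om[OF t] by auto
  define l where "l = s ^ 2"
  have l: "0 \<le> l" "l \<le> 1" using s by (auto simp: l_def power_le_one)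
  have eq: "(of_real s * c) ^ 2 + t = of_real (1 - l) * t + of_real l * (c ^ 2 + t)"
    by (simp add: l_def power_mult_distrib algebra_simps)
  have "Re ((of_real s * c) ^ 2 + t) = (1 - l) * Re t + l * Re (c ^ 2 + t)" unfolding eq by (simp add: algebra_simps)
  also have "\<dots> < - \<delta>" using convex_bound_lt[of "Re t" "- \<delta>" "Re (c ^ 2 + t)" "1 - l" l] t1 c l by simp
  finally show "Re ((of_real s * c) ^ 2 + t) < - \<delta>" .
  have "\<delta> - Re t < Re ((of_real (1 - l) * t + of_real l * (c ^ 2 + t)) ^ 2)"
    by (rule left_hyperbola_convex) (use t1 c l in auto)
  then show "\<delta> < Re (((of_real s * c) ^ 2 + t) ^ 2 + t)" unfolding eq plus_complex.sel(1)[of "_ ^ 2"] by linarith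
qed

lemma orb_k_Om:
  assumes t: "t \<in> Om"
  shows "Re (orb t k ^ 2 + t) < - \<delta>" "\<delta> < Re ((orb t k ^ 2 + t) ^ 2 + t)"
  using sep_Om[OF t, of "Suc k"] sep_Om[OF t, of K] Qk by (auto simp: sep_def orb_Suc)

lemma radial_lift:
  assumes c: "continuous_on Om c" "\<And>t. t \<in> Om \<Longrightarrow> Re (c t ^ 2 + t) < - \<delta>" "\<And>t. t \<in> Om \<Longrightarrow> \<delta> < Re ((c t ^ 2 + t) ^ 2 + t)"
    and s0: "s0 \<in> {0..1}"
    and g: "\<And>i. i \<in> {1..k} \<Longrightarrow> continuous_on Om (g i)" "\<And>t. t \<in> Om \<Longrightarrow> g k t = of_real s0 * c t"
      "\<And>i t. i \<in> {1..<k} \<Longrightarrow> t \<in> Om \<Longrightarrow> g i t ^ 2 = g (Suc i) t - t"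
      "\<And>i t. i \<in> {1..k} \<Longrightarrow> t \<in> Om \<Longrightarrow> sep \<delta> i (g i t)"
  obtains Y where "\<And>i. i \<in> {1..k} \<Longrightarrow> continuous_on (Om \<times> {0..1}) (Y i)"
    "\<And>t s. t \<in> Om \<Longrightarrow> s \<in> {0..1} \<Longrightarrow> Y k (t,s) = of_real s * c t"
    "\<And>i t s. i \<in> {1..<k} \<Longrightarrow> t \<in> Om \<Longrightarrow> s \<in> {0..1} \<Longrightarrow> Y i (t,s) ^ 2 = Y (Suc i) (t,s) - t"
    "\<And>i t s. i \<in> {1..<k} \<Longrightarrow> t \<in> Om \<Longrightarrow> s \<in> {0..1} \<Longrightarrow> Y i (t,s) \<noteq> 0"
    "\<And>i t. i \<in> {1..k} \<Longrightarrow> t \<in> Om \<Longrightarrow> Y i (t,s0) = g i t"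
    "\<And>i t s. i \<in> {1..k} \<Longrightarrow> t \<in> Om \<Longrightarrow> s \<in> {0..1} \<Longrightarrow> sep \<delta> i (Y i (t,s))"
proof -
  have Zc: "continuous_on (Om \<times> {0..1}) (\<lambda>u. of_real (snd u) * c (fst u))"
    by (intro continuous_intros continuous_on_compose2[OF c(1)]) auto
  define Z where "Z = (\<lambda>u. of_real (snd u) * c (fst u))"
  define \<omega> where "\<omega> = (\<lambda>_::real. 1::real)"
  have "{s \<in> {0..1}. 0 < \<omega> s} = {0..1}" by (auto simp: \<omega>_def)
  then have con: "connected {s \<in> {0..1}. 0 < \<omega> s}" by simp
  have Z1: "Re ((Z (t,s) / of_real (\<omega> s) ^ (2^(k-1))) ^ 2 + t) < - \<delta>"
      "\<delta> < Re (((Z (t,s) / of_real (\<omega> s) ^ (2^(k-1))) ^ 2 + t) ^ 2 + t)"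
      if "t \<in> Om" "s \<in> {0..1}" for t s
    using radial_path[OF that(1) c(2,3)[OF that(1)] that(2)] by (simp_all add: Z_def \<omega>_def)
  have gk: "g k t = Z (t,s0)" if "t \<in> Om" for t using g(2)[OF that] by (simp add: Z_def)
  have w: "\<omega> s0 = 1" "continuous_on {0..1} \<omega>" "\<And>s. s \<in> {0..1} \<Longrightarrow> 0 \<le> \<omega> s"
    "\<And>t s. t \<in> Om \<Longrightarrow> s \<in> {0..1} \<Longrightarrow> \<omega> s = 0 \<Longrightarrow> Z (t,s) \<noteq> 0" by (simp_all add: \<omega>_def)
  show thesis
    by (rule lift_chain[of s0 \<omega> Z g, OF s0 w(1-3) con Zc[folded Z_def] Z1 w(4) g(1) gk g(3,4)], assumption+)
       (rule that, assumption+, auto simp: Z_def \<omega>_def)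
qed

lemma csqrt_at_zero:
  assumes "t \<in> Om" "orb t K = of_real x0"
  shows "csqrt (of_real x0 - t) = - orb t (Suc k)"
proof -
  have "Re (orb t (Suc k)) < - \<delta>" using sep_Om[OF assms(1), of "Suc k"] Qk(2) by (simp add: sep_def)
  moreover have "orb t (Suc k) ^ 2 = of_real x0 - t" using assms(2) by (simp add: orb_Suc[of t "Suc k"] algebra_simps)
  ultimately show ?thesis by (intro csqrt_unique) auto
qed

text \<open>\<open>q\<close> is a continuous choice of the value at time \<open>k\<close> when the
  value at time \<open>K\<close> is \<open>x0\<close>. To continue the later roots consistently, the
  orbit value at time \<open>k\<close> is moved radially to 0 (\<open>U\<close>), then out to
  \<open>q\<close> (\<open>W\<close>), and then the end point \<open>x0\<close> is pushed to
  infinity (\<open>Y\<close>). The signs at \<open>ts\<close> record which branches have been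
  followed.\<close>

lemma central_chain:
  obtains q Y where "\<And>t. t \<in> Om \<Longrightarrow> q t ^ 2 = - csqrt (of_real x0 - t) - t" "continuous_on Om q" "Re (q (of_real ts)) = 0" "0 < Im (q (of_real ts))"
    "\<And>i. i \<in> {1..K} \<Longrightarrow> continuous_on (Om \<times> {0..1}) (Y i)" "\<And>t v. t \<in> Om \<Longrightarrow> v \<in> {0..1} \<Longrightarrow> Y K (t,v) = of_real x0"
    "\<And>t v. t \<in> Om \<Longrightarrow> v \<in> {0..1} \<Longrightarrow> Y (Suc k) (t,v) = - csqrt (of_real x0 - t * of_real v ^ (2^Suc k))"
    "\<And>i t v. i \<in> {1..<K} \<Longrightarrow> t \<in> Om \<Longrightarrow> v \<in> {0..1} \<Longrightarrow> Y i (t,v) ^ 2 = Y (Suc i) (t,v) - t * of_real v ^ (2^i)"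
    "\<And>t i. t \<in> Om \<Longrightarrow> orb t K = of_real x0 \<Longrightarrow> orb t k = q t \<Longrightarrow> i \<in> {1..K} \<Longrightarrow> Y i (t,1) = orb t i"
    "\<And>i v. i \<in> {1..k} \<Longrightarrow> v \<in> {0..1} \<Longrightarrow> if Q3 i then Im (Y i (of_real ts,v)) < 0 else 0 < Im (Y i (of_real ts,v))"
proof -
  let ?I = "{0..1::real}"
  \<comment> \<open>\<open>H\<close> is the value at time \<open>Suc k\<close>, the left root
    because of type \<open>Q3\<close>, and \<open>F\<close> is the radicand at time
    \<open>k\<close>, both rescaled by powers of \<open>v\<close>.\<close>
  define H where "H = (\<lambda>u::complex \<times> real. - csqrt (of_real x0 - fst u * of_real (snd u) ^ (2^Suc k)))"
  define F where "F = (\<lambda>u. H u - fst u * of_real (snd u) ^ (2^k))"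
  have v01: "0 \<le> v ^ n" "v ^ n \<le> 1" if "v \<in> ?I" for v :: real and n using that by (auto simp: power_le_one)
  have near: "of_real x0 - t * of_real v ^ (2^Suc k) \<notin> \<real>\<^sub>\<le>\<^sub>0" "Re (H (t,v)) \<le> - 900" "Re (F (t,v)) < 0"
    if "t \<in> Om" "v \<in> ?I" for t v
    using csqrt_near_x0[OF Om_bounded[OF that(1)] v01[OF that(2), of "2^Suc k"]] v01[OF that(2), of "2^k"]
    unfolding H_def F_def fst_conv snd_conv of_real_power uminus_complex.sel(1) by (blast, simp del: csqrt.simps power_Suc, metis of_real_power)
  have cH: "continuous_on (Om \<times> ?I) H"
    unfolding H_def by (intro continuous_intros continuous_on_compose2[OF continuous_on_csqrt]) (use near(1) in auto)
  have cF: "continuous_on (Om \<times> ?I) F" unfolding F_def by (intro continuous_intros cH)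
  have nzF: "F u \<noteq> 0" if "u \<in> Om \<times> ?I" for u
  proof -
    obtain t v where "u = (t,v)" "t \<in> Om" "v \<in> ?I" using \<open>u \<in> Om \<times> ?I\<close> by auto
    then show ?thesis using near(3)[of t v] by auto
  qed
  have Fts: "Im (F (of_real ts,v)) = 0" if v: "v \<in> ?I" for v
  proof -
    have n: "of_real x0 - of_real ts * of_real v ^ (2^Suc k) = (of_real (x0 - ts * v ^ (2^Suc k)) :: complex)" by simp
    have "0 \<le> - (ts * v ^ (2^Suc k))" using ts_bounds v01[OF v, of "2^Suc k"] by (simp add: mult_nonpos_nonneg del: power_Suc)
    then have "H (of_real ts, v) = - of_real (sqrt (x0 - ts * v ^ (2^Suc k)))"
      unfolding H_def fst_conv snd_conv n by (subst csqrt_of_real) simp_all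
    then have "F (of_real ts, v) = of_real (- sqrt (x0 - ts * v ^ (2^Suc k)) - ts * v ^ (2^k))"
      unfolding F_def fst_conv snd_conv by simp
    then show ?thesis by (simp only: Im_complex_of_real)
  qed
  \<comment> \<open>At the real parameter the radicand is negative, so its roots are imaginary; the
    upper one is chosen.\<close>
  define y where "y = sqrt (- Re (F (of_real ts, 1)))"
  have y0: "0 < y" using near(3)[OF ts_in_Om, of 1] by (simp add: y_def)
  have "(\<i> * of_real y) ^ 2 = - (of_real (y ^ 2) :: complex)" by (simp add: power_mult_distrib)
  also have "\<dots> = F (of_real ts, 1)"
    using near(3)[OF ts_in_Om, of 1] Fts[of 1] by (simp add: y_def complex_eq_iff)
  finally have st: "(\<i> * of_real y) ^ 2 = F (of_real ts, 1)" .
  have "(of_real ts, 1) \<in> Om \<times> ?I" using ts_in_Om by simp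
  then obtain G where G: "continuous_on (Om \<times> ?I) G" "\<And>u. u \<in> Om \<times> ?I \<Longrightarrow> G u ^ 2 = F u" "G (of_real ts, 1) = \<i> * of_real y"
    using sqrt_lift[OF open_Om simply_connected_Om cF nzF _ st] by blast
  define q where "q = (\<lambda>t. G (t,1))"
  have cq: "continuous_on Om q" unfolding q_def
    by (rule continuous_on_compose2[OF G(1)]) (auto intro!: continuous_intros)
  have q2: "q t ^ 2 = - csqrt (of_real x0 - t) - t" if "t \<in> Om" for t
    using G(2)[of "(t,1)"] that by (simp add: q_def F_def H_def del: csqrt.simps)
  have qreg: "Re (q t ^ 2 + t) < - \<delta>" "\<delta> < Re ((q t ^ 2 + t) ^ 2 + t)" if "t \<in> Om" for t
    using near(2)[OF that, of 1] by (simp_all add: q2[OF that] H_def del: csqrt.simps)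

  obtain U where U: "\<And>i. i \<in> {1..k} \<Longrightarrow> continuous_on (Om \<times> ?I) (U i)"
    "\<And>t s. t \<in> Om \<Longrightarrow> s \<in> ?I \<Longrightarrow> U k (t,s) = of_real s * orb t k"
    "\<And>i t s. i \<in> {1..<k} \<Longrightarrow> t \<in> Om \<Longrightarrow> s \<in> ?I \<Longrightarrow> U i (t,s) ^ 2 = U (Suc i) (t,s) - t"
    "\<And>i t s. i \<in> {1..<k} \<Longrightarrow> t \<in> Om \<Longrightarrow> s \<in> ?I \<Longrightarrow> U i (t,s) \<noteq> 0"
    "\<And>i t. i \<in> {1..k} \<Longrightarrow> t \<in> Om \<Longrightarrow> U i (t,1) = orb t i"
    "\<And>i t s. i \<in> {1..k} \<Longrightarrow> t \<in> Om \<Longrightarrow> s \<in> ?I \<Longrightarrow> sep \<delta> i (U i (t,s))"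
  proof (rule radial_lift[of "\<lambda>t. orb t k" 1 "\<lambda>i t. orb t i"])
    show "sep \<delta> i (orb t i)" if "i \<in> {1..k}" "t \<in> Om" for i t using sep_Om[OF that(2), of i] that by auto
  qed (use orb_k_Om continuous_on_orb orb_Suc in \<open>auto\<close>)
  obtain W where W: "\<And>i. i \<in> {1..k} \<Longrightarrow> continuous_on (Om \<times> ?I) (W i)"
    "\<And>t s. t \<in> Om \<Longrightarrow> s \<in> ?I \<Longrightarrow> W k (t,s) = of_real s * q t"
    "\<And>i t s. i \<in> {1..<k} \<Longrightarrow> t \<in> Om \<Longrightarrow> s \<in> ?I \<Longrightarrow> W i (t,s) ^ 2 = W (Suc i) (t,s) - t"
    "\<And>i t s. i \<in> {1..<k} \<Longrightarrow> t \<in> Om \<Longrightarrow> s \<in> ?I \<Longrightarrow> W i (t,s) \<noteq> 0"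
    "\<And>i t. i \<in> {1..k} \<Longrightarrow> t \<in> Om \<Longrightarrow> W i (t,0) = U i (t,0)"
    "\<And>i t s. i \<in> {1..k} \<Longrightarrow> t \<in> Om \<Longrightarrow> s \<in> ?I \<Longrightarrow> sep \<delta> i (W i (t,s))"
  proof (rule radial_lift[of q 0 "\<lambda>i t. U i (t,0)"])
    show "continuous_on Om (\<lambda>t. U i (t,0))" if "i \<in> {1..k}" for i
      by (rule continuous_on_compose2[OF U(1)[OF that]]) (auto intro!: continuous_intros)
  qed (use cq qreg U in auto)
  have w: "continuous_on ?I (\<lambda>v. v)" "\<And>v. v \<in> ?I \<Longrightarrow> 0 \<le> v" by auto
  have "{v \<in> ?I. 0 < v} = {0<..1}" by auto
  then have con: "connected {v \<in> ?I. 0 < v}" by simp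
  have G1: "Re ((G (t,v) / of_real v ^ (2^(k-1))) ^ 2 + t) < - \<delta>"
     "\<delta> < Re (((G (t,v) / of_real v ^ (2^(k-1))) ^ 2 + t) ^ 2 + t)" if t: "t \<in> Om" and v: "v \<in> ?I" "0 < v" for t v
  proof -
    have "G (t,v) ^ 2 = H (t,v) - t * of_real v ^ (2^k)" using G(2)[of "(t,v)"] t v by (simp add: F_def)
    then have e1: "(G (t,v) / of_real v ^ (2^(k-1))) ^ 2 + t = H (t,v) / of_real v ^ (2^k)"
      using scaled_step[of "G (t,v)" "H (t,v)" t v k] v k_ge_3 by simp
    have "H (t,v) ^ 2 = of_real x0 - t * of_real v ^ (2^Suc k)" by (simp add: H_def del: csqrt.simps power_Suc)
    then have e2: "(H (t,v) / of_real v ^ (2^k)) ^ 2 + t = of_real (x0 / v ^ (2^Suc k))"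
      using scaled_step[of "H (t,v)" "of_real x0" t v "Suc k"] v by simp
    have p: "0 < v ^ n" "v ^ n \<le> 1" for n using v by (auto simp: power_le_one)
    have "Re (H (t,v) / of_real v ^ (2^k)) = Re (H (t,v)) / v ^ (2^k)" by (metis Re_divide_of_real of_real_power)
    also have "\<dots> \<le> - 900"
    proof -
      have "900 * v ^ (2^k) \<le> 900" using p[of "2^k"] by simp
      then have "Re (H (t,v)) \<le> - 900 * v ^ (2^k)" using near(2)[OF t v(1)] by linarith
      then show ?thesis using p(1)[of "2^k"] by (simp add: pos_divide_le_eq)
    qed
    finally show "Re ((G (t,v) / of_real v ^ (2^(k-1))) ^ 2 + t) < - \<delta>" unfolding e1 by simp
    have "x0 * v ^ (2^Suc k) \<le> x0" using p[of "2^Suc k"] by (simp del: power_Suc)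
    then have "x0 \<le> x0 / v ^ (2^Suc k)" using p(1)[of "2^Suc k"] by (simp add: pos_le_divide_eq del: power_Suc)
    then show "\<delta> < Re (((G (t,v) / of_real v ^ (2^(k-1))) ^ 2 + t) ^ 2 + t)"
      unfolding e1 e2 Re_complex_of_real by linarith
  qed
  have G0: "G (t,v) \<noteq> 0" if "t \<in> Om" "v \<in> ?I" for t v using G(2)[of "(t,v)"] nzF[of "(t,v)"] that by auto
  obtain Y where Y: "\<And>i. i \<in> {1..k} \<Longrightarrow> continuous_on (Om \<times> ?I) (Y i)" "\<And>t s. t \<in> Om \<Longrightarrow> s \<in> ?I \<Longrightarrow> Y k (t,s) = G (t,s)"
    "\<And>i t s. i \<in> {1..<k} \<Longrightarrow> t \<in> Om \<Longrightarrow> s \<in> ?I \<Longrightarrow> Y i (t,s) ^ 2 = Y (Suc i) (t,s) - t * of_real s ^ (2^i)"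
    "\<And>i t s. i \<in> {1..<k} \<Longrightarrow> t \<in> Om \<Longrightarrow> s \<in> ?I \<Longrightarrow> Y i (t,s) \<noteq> 0"
    "\<And>i t. i \<in> {1..k} \<Longrightarrow> t \<in> Om \<Longrightarrow> Y i (t,1) = W i (t,1)"
  proof (rule lift_chain[of 1 "\<lambda>v. v" G "\<lambda>i t. W i (t,1)"])
    show "continuous_on Om (\<lambda>t. W i (t,1))" if "i \<in> {1..k}" for i
      by (rule continuous_on_compose2[OF W(1)[OF that]]) (auto intro!: continuous_intros)
    show "W k (t,1) = G (t,1)" if "t \<in> Om" for t using W(2)[OF that, of 1] by (simp add: q_def)
  qed (use w con G(1) G1 G0 W(3,6) in auto)
  have ts: "of_real ts \<in> Om" by (rule ts_in_Om)
  have c1: "continuous_on ?I (\<lambda>s. f (of_real ts, s))" if "continuous_on (Om \<times> ?I) f" for f :: "complex \<times> real \<Rightarrow> complex"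
    by (rule continuous_on_compose2[OF that]) (auto intro!: continuous_intros ts)
  have Im_sq: "Im (z ^ 2) = 2 * Re z * Im z" for z by (simp add: power2_eq_square)

  \<comment> \<open>The square is real and nonzero along the path and positive at
    \<open>s = 1\<close>, so the lift stays real and does not change sign.\<close>
  have realU: "Im (U i (of_real ts,s)) = 0 \<and> (i < k \<and> Q2 i \<longrightarrow> Re (U i (of_real ts,s)) < 0)"
    if "1 \<le> i" "i \<le> k" "s \<in> ?I" for i s
    using that(2,1,3)
  proof (induction i arbitrary: s rule: inc_induct)
    case base then show ?case using U(2)[OF ts base(2)] orb_real[of ts k] by simp
  next
    case (step i)
    have i: "i \<in> {1..<k}" "i \<in> {1..k}" "1 \<le> i" using step by auto
    define f where "f = (\<lambda>s. Re (U i (of_real ts,s) ^ 2))"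
    have I0: "Im (U i (of_real ts,s) ^ 2) = 0" if "s \<in> ?I" for s
      using step.IH[of s] that U(3)[OF i(1) ts that] by simp
    have "0 < f s" if "s \<in> ?I" for s
    proof (rule nonzero_imp_pos[of f 1])
      show "continuous_on ?I f" unfolding f_def by (intro continuous_intros c1 U(1) i)
      show "f s \<noteq> 0" if "s \<in> ?I" for s
      proof -
        have "U i (of_real ts,s) ^ 2 \<noteq> 0" using U(4)[OF i(1) ts that] by simp
        then show ?thesis using I0[OF that] unfolding f_def complex_eq_iff by simp
      qed
      then have "f 1 \<noteq> 0" by simp
      moreover have "f 1 = Re (orb (of_real ts) i) ^ 2"
        using U(5)[OF i(2) ts] orb_real[of ts i] by (simp add: f_def power2_eq_square)
      ultimately show "0 < f 1" by simp
    qed (use that in auto)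
    then have f: "0 < Re (U i (of_real ts,s)) ^ 2 - Im (U i (of_real ts,s)) ^ 2" if "s \<in> ?I" for s
      using that by (simp add: f_def power2_eq_square)
    have nzR: "Re (U i (of_real ts,s)) \<noteq> 0" if "s \<in> ?I" for s
    proof
      assume "Re (U i (of_real ts,s)) = 0"
      then show False using f[OF that] zero_le_power2[of "Im (U i (of_real ts,s))"] by simp
    qed
    have "Re (U i (of_real ts,s)) < 0" if "Q2 i"
    proof -
      have "0 < - Re (U i (of_real ts,s))"
      proof (rule nonzero_imp_pos[of "\<lambda>s. - Re (U i (of_real ts,s))" 1])
        show "continuous_on ?I (\<lambda>s. - Re (U i (of_real ts,s)))" by (intro continuous_intros c1 U(1) i)
        show "0 < - Re (U i (of_real ts,1))"
          using U(5)[OF i(2) ts] that core_axioms i(3) unfolding core_def core_axioms_def tuned_def by simp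
      qed (use nzR step.prems in auto)
      then show ?thesis by simp
    qed
    moreover have "Im (U i (of_real ts,s)) = 0" using I0[of s] nzR[of s] step.prems unfolding Im_sq by simp
    ultimately show ?case by blast
  qed

  \<comment> \<open>A positive imaginary part at time \<open>k\<close> propagates backwards: a root
    in the right half plane keeps the sign, a root in the left half plane reverses it. At type
    \<open>Q2\<close> the left half plane is inherited from the real chain \<open>U\<close>.\<close>
  have signW: "if Q3 i then Im (W i (of_real ts,s)) < 0 else 0 < Im (W i (of_real ts,s))"
    if "1 \<le> i" "i \<le> k" "s \<in> {0<..1}" for i s
    using that(2,1,3)
  proof (induction i arbitrary: s rule: inc_induct)
    case base
    then show ?case using W(2)[OF ts, of s] Qk(1) type_disjoint(3)[of k] G(3) y0 by (auto simp: q_def)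
  next
    case (step i)
    have i: "i \<in> {1..<k}" "i \<in> {1..k}" "1 \<le> i" using step by auto
    have s: "s \<in> ?I" using step.prems by auto
    have Im: "Im (W i (of_real ts,s) ^ 2) = Im (W (Suc i) (of_real ts,s))" if "s \<in> ?I" for s
      using W(3)[OF i(1) ts that] by simp
    have IH: "if Q3 (Suc i) then Im (W (Suc i) (of_real ts,s)) < 0 else 0 < Im (W (Suc i) (of_real ts,s))"
      if "s \<in> {0<..1}" for s using step.IH[of s] that by auto
    consider "Q1 i" | "Q2 i" | "Q3 i" using type_cases by blast
    then show ?case
    proof cases
      case 1
      then have "\<not> Q3 (Suc i)" "\<not> Q3 i" using not_Q2_Suc type_disjoint by blast+
      moreover have "0 < Re (W i (of_real ts,s))" using W(6)[OF i(2) ts s] 1 by (simp add: sep_def)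
      ultimately show ?thesis using IH[OF step.prems(2)] Im_sign_of_square(1)[OF Im[OF s]] by auto
    next
      case 3
      then have "\<not> Q3 (Suc i)" using not_Q2_Suc type_disjoint by blast
      moreover have "Re (W i (of_real ts,s)) < 0" using W(6)[OF i(2) ts s] 3 by (simp add: sep_def)
      ultimately show ?thesis using 3 IH[OF step.prems(2)] Im_sign_of_square(2)[OF Im[OF s]] by auto
    next
      case 2
      then have q3: "Q3 (Suc i)" "\<not> Q3 i" using Q2_Suc type_disjoint by blast+
      have R0: "Re (W i (of_real ts,0)) < 0" using realU[of i 0] W(5)[OF i(2) ts] i 2 by auto
      have "0 < - Re (W i (of_real ts,s))"
      proof (rule nonzero_imp_pos[of "\<lambda>s. - Re (W i (of_real ts,s))" 0])
        show "continuous_on ?I (\<lambda>s. - Re (W i (of_real ts,s)))" by (intro continuous_intros c1 W(1) i)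
        show "- Re (W i (of_real ts,s)) \<noteq> 0" if "s \<in> ?I" for s
        proof (cases "s = 0")
          case False
          then have "Im (W i (of_real ts,s) ^ 2) < 0" using IH[of s] q3 Im[OF that] that by auto
          then show ?thesis unfolding Im_sq by auto
        qed (use R0 in simp)
      qed (use R0 s in auto)
      then show ?thesis using q3 IH[OF step.prems(2)] Im_sign_of_square(3)[OF Im[OF s]] by auto
    qed
  qed

  \<comment> \<open>At \<open>ts\<close> the radicand at time \<open>k\<close> stays negative and
    before that only real numbers are subtracted, so no imaginary part can vanish and the signs of
    \<open>W\<close> persist.\<close>
  have signY: "if Q3 i then Im (Y i (of_real ts,v)) < 0 else 0 < Im (Y i (of_real ts,v))"
    if "1 \<le> i" "i \<le> k" "v \<in> ?I" for i v
    using that(2,1,3)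
  proof (induction i arbitrary: v rule: inc_induct)
    case base
    have k1: "k \<in> {1..k}" using base by simp
    have "0 < Im (Y k (of_real ts,v))"
    proof (rule nonzero_imp_pos[of "\<lambda>v. Im (Y k (of_real ts,v))" 1])
      show "continuous_on ?I (\<lambda>v. Im (Y k (of_real ts,v)))" by (intro continuous_intros c1 Y(1) k1)
      show "Im (Y k (of_real ts,v)) \<noteq> 0" if "v \<in> ?I" for v
      proof
        assume 0: "Im (Y k (of_real ts,v)) = 0"
        have "Y k (of_real ts,v) ^ 2 = F (of_real ts,v)" using G(2)[of "(of_real ts,v)"] Y(2)[OF ts that] that ts by simp
        then have "Re (Y k (of_real ts,v) ^ 2) < 0" using near(3)[OF ts that] by simp
        then show False using 0 zero_le_power2[of "Re (Y k (of_real ts,v))"] by (simp add: power2_eq_square)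
      qed
      show "0 < Im (Y k (of_real ts,1))" using Y(2)[OF ts, of 1] G(3) y0 by simp
    qed (use base in auto)
    then show ?case using Qk(1) type_disjoint(3)[of k] by auto
  next
    case (step i)
    have i: "i \<in> {1..<k}" "i \<in> {1..k}" "1 \<le> i" using step by auto
    have nz: "Im (Y i (of_real ts,v)) \<noteq> 0" if v: "v \<in> ?I" for v
    proof -
      have "Im (Y i (of_real ts,v) ^ 2) = Im (Y (Suc i) (of_real ts,v) - of_real (ts * v ^ (2^i)))"
        using Y(3)[OF i(1) ts v] by simp
      also have "\<dots> \<noteq> 0" using step.IH[of v] v unfolding minus_complex.sel(2) Im_complex_of_real by (auto split: if_splits)
      finally show ?thesis unfolding Im_sq by auto
    qed
    have c: "continuous_on ?I (\<lambda>v. Im (Y i (of_real ts,v)))" by (intro continuous_intros c1 Y(1) i)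
    have one: "if Q3 i then Im (Y i (of_real ts,1)) < 0 else 0 < Im (Y i (of_real ts,1))"
      using signW[of i 1] i Y(5)[OF i(2) ts] by simp
    show ?case
    proof (cases "Q3 i")
      case True
      have "0 < - Im (Y i (of_real ts,v))"
        by (rule nonzero_imp_pos[of "\<lambda>v. - Im (Y i (of_real ts,v))" 1])
           (use c nz one True step.prems in \<open>auto intro!: continuous_intros\<close>)
      then show ?thesis using True by simp
    next
      case False
      have "0 < Im (Y i (of_real ts,v))"
        by (rule nonzero_imp_pos[of "\<lambda>v. Im (Y i (of_real ts,v))" 1]) (use c nz one False step.prems in auto)
      then show ?thesis using False by simp
    qed
  qed

  define X where "X i u = (if i = K then of_real x0 else if i = Suc k then H u else Y i u)" for i u
  have XY: "X i = Y i" if "i \<le> k" for i using that by (auto simp: X_def)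
  \<comment> \<open>If the orbit itself passes through \<open>q t\<close>, then \<open>U\<close> and
    \<open>W\<close> run along the same radius, so going in and out again returns to the
    orbit.\<close>
  have match: "X i (t,1) = orb t i" if t: "t \<in> Om" and z: "orb t K = of_real x0" "orb t k = q t" and i: "i \<in> {1..K}" for t i
  proof -
    have UW: "U i (t,s) = W i (t,s)" if "1 \<le> i" "i \<le> k" "s \<in> ?I" for i s
      using that(2,1,3)
    proof (induction i arbitrary: s rule: inc_induct)
      case base then show ?case using U(2)[OF t base(2)] W(2)[OF t base(2)] z by simp
    next
      case (step i)
      have i: "i \<in> {1..<k}" "i \<in> {1..k}" "1 \<le> i" using step by auto
      have c: "continuous_on ?I (\<lambda>s. f (t, s))" if "continuous_on (Om \<times> ?I) f" for f :: "complex \<times> real \<Rightarrow> complex"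
        by (rule continuous_on_compose2[OF that]) (auto intro!: continuous_intros t)
      show ?case
      proof (rule sqrt_unique[of ?I "\<lambda>s. U i (t,s)" "\<lambda>s. W i (t,s)" 0])
        show "U i (t,s) ^ 2 = W i (t,s) ^ 2" if "s \<in> ?I" for s
          using U(3)[OF i(1) t that] W(3)[OF i(1) t that] step.IH[of s] that by simp
      qed (use c[OF U(1)[OF i(2)]] c[OF W(1)[OF i(2)]] U(4)[OF i(1) t] W(5)[OF i(2) t] step.prems in auto)
    qed
    consider "i = K" | "i = Suc k" | "i \<le> k" using i by fastforce
    then show ?thesis
    proof cases
      case 2
      then show ?thesis using csqrt_at_zero[OF t z(1)] by (simp add: X_def H_def del: csqrt.simps)
    next
      case 3
      then have "X i (t,1) = W i (t,1)" using XY[OF 3] Y(5)[OF _ t, of i] i by simp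
      also have "\<dots> = U i (t,1)" using UW[of i 1] i 3 by simp
      also have "\<dots> = orb t i" using U(5)[OF _ t, of i] i 3 by simp
      finally show ?thesis .
    qed (use z in \<open>simp add: X_def\<close>)
  qed
  show thesis
  proof (rule that[of q X])
    show "0 < Im (q (of_real ts))" "Re (q (of_real ts)) = 0" using G(3) y0 by (simp_all add: q_def)
    show "continuous_on (Om \<times> ?I) (X i)" if i: "i \<in> {1..K}" for i
    proof -
      consider "i = K" | "i = Suc k" | "i \<le> k" using i by fastforce
      then show ?thesis
      proof cases
        case 3 then show ?thesis using XY[OF 3] Y(1)[of i] i by simp
      qed (simp_all add: X_def cH)
    qed
    show "X i (t,v) ^ 2 = X (Suc i) (t,v) - t * of_real v ^ (2^i)" if i: "i \<in> {1..<K}" and t: "t \<in> Om" and v: "v \<in> ?I" for i t v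
    proof -
      consider "i = Suc k" | "i = k" | "i < k" using i by fastforce
      then show ?thesis
      proof cases
        case 1 then show ?thesis by (simp add: X_def H_def del: csqrt.simps power_Suc)
      next
        case 2 then show ?thesis using G(2)[of "(t,v)"] Y(2)[OF t v] t v by (simp add: X_def F_def)
      next
        case 3 then show ?thesis using Y(3)[OF _ t v, of i] i by (simp add: X_def)
      qed
    qed
    show "if Q3 i then Im (X i (of_real ts,v)) < 0 else 0 < Im (X i (of_real ts,v))" if "i \<in> {1..k}" "v \<in> ?I" for i v
      using signY[of i v] that XY[of i] by simp
  qed (use q2 cq match in \<open>auto simp: X_def H_def simp del: csqrt.simps\<close>)
qed

section \<open>The two centres of the disc\<close>

text \<open>For \<open>i \<le> K\<close>, the binary number with the digits from \<open>d i\<close>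
  up to \<open>d (K - 1)\<close> followed by zeros: the angle reached when the positive number
  \<open>x0\<close> at time \<open>K\<close> is pulled back by pure square roots.\<close>

definition b :: "nat \<Rightarrow> real" where "b i = a i - a K / 2 ^ (K - i)"

lemma b_step: assumes "i < K" shows "b i = (d i + b (Suc i)) / 2"
proof -
  have "K - i = Suc (K - Suc i)" using assms by simp
  then have "a K / 2 ^ (K - i) = a K / 2 ^ (K - Suc i) / 2" by simp
  then show ?thesis using a_step[of i] by (simp add: b_def add_divide_distrib diff_divide_distrib)
qed

lemma cis_b_square: assumes "i < K" shows "cis (2 * pi * b i) ^ 2 = cis (2 * pi * b (Suc i))"
proof -
  have "2 * (2 * pi * b i) = 2 * pi * b (Suc i) + 2 * pi * d i" using b_step[OF assms] by (simp add: algebra_simps)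
  moreover have "cis (2 * pi * b i) ^ 2 = cis (2 * (2 * pi * b i))" by (simp add: Complex.DeMoivre)
  ultimately show ?thesis by (simp add: d_def cis_mult[symmetric])
qed

lemma b_K: "b K = 0" by (simp add: b_def)

lemma b_bounds: assumes "i \<le> Suc k" shows "0 < b i \<and> b i < 1"
  using assms
proof (induction i rule: inc_induct)
  case base
  then show ?case using b_step[of "Suc k"] b_K Qk(2) by (simp add: d_def)
next
  case (step i)
  have "0 \<le> d i" "d i \<le> 1" by (auto simp: d_def)
  then show ?case using b_step[of i] step by auto
qed

text \<open>The angle is \<open>pi * b (Suc i)\<close>, strictly between 0 and \<open>pi\<close>,
  plus a half turn exactly when the digit is 1.\<close>

lemma sign_sin_b:
  assumes "i \<le> k"
  shows "if Q3 i then sin (2 * pi * b i) < 0 else 0 < sin (2 * pi * b i)"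
proof -
  have bb: "0 < b (Suc i)" "b (Suc i) < 1" using b_bounds[of "Suc i"] assms by auto
  then have s: "0 < sin (pi * b (Suc i))" by (intro sin_gt_zero) (auto simp: mult_less_cancel_left1)
  have "2 * pi * b i = pi * b (Suc i) + pi * d i" using b_step[of i] assms by (simp add: algebra_simps)
  then show ?thesis using s by (simp add: d_def)
qed

definition e :: complex where "e = of_real (x0 powr (1 / 2 ^ (K - 1))) * cis (2 * pi * b 1)"

text \<open>At \<open>v = 0\<close> the entries of the central chain are pure roots of
  \<open>x0\<close>, so the first one is constant over \<open>Om\<close>; at \<open>ts\<close> the
  signs of the imaginary parts determine it. This gives \<open>e\<close> if the orbit follows
  \<open>q\<close> at time \<open>k\<close>; otherwise the conjugate parameter does.\<close>

lemma zero_value: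
  assumes "t \<in> Om" "orb t K = of_real x0"
  shows "A K t = e \<or> A K (cnj t) = e"
proof -
  obtain q Y where q: "\<And>t. t \<in> Om \<Longrightarrow> q t ^ 2 = - csqrt (of_real x0 - t) - t" "continuous_on Om q" "Re (q (of_real ts)) = 0" "0 < Im (q (of_real ts))"
    and Y: "\<And>i. i \<in> {1..K} \<Longrightarrow> continuous_on (Om \<times> {0..1}) (Y i)" "\<And>t v. t \<in> Om \<Longrightarrow> v \<in> {0..1} \<Longrightarrow> Y K (t,v) = of_real x0"
    "\<And>t v. t \<in> Om \<Longrightarrow> v \<in> {0..1} \<Longrightarrow> Y (Suc k) (t,v) = - csqrt (of_real x0 - t * of_real v ^ (2^Suc k))"
    "\<And>i t v. i \<in> {1..<K} \<Longrightarrow> t \<in> Om \<Longrightarrow> v \<in> {0..1} \<Longrightarrow> Y i (t,v) ^ 2 = Y (Suc i) (t,v) - t * of_real v ^ (2^i)"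
    "\<And>t i. t \<in> Om \<Longrightarrow> orb t K = of_real x0 \<Longrightarrow> orb t k = q t \<Longrightarrow> i \<in> {1..K} \<Longrightarrow> Y i (t,1) = orb t i"
    "\<And>i v. i \<in> {1..k} \<Longrightarrow> v \<in> {0..1} \<Longrightarrow> if Q3 i then Im (Y i (of_real ts,v)) < 0 else 0 < Im (Y i (of_real ts,v))"
    using central_chain by blast
  note ts = ts_in_Om
  have Y0: "Y i (t,0) ^ 2 = Y (Suc i) (t,0)" if "i \<in> {1..<K}" "t \<in> Om" for i t
    using Y(4)[OF that, of 0] by (simp add: power_0_left)
  have Y0K: "Y i (t,0) ^ (2^(K-i)) = of_real x0" if "1 \<le> i" "i \<le> K" "t \<in> Om" for i t
    using that(2,1,3)
  proof (induction i rule: inc_induct)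
    case base then show ?case using Y(2)[of t 0] by simp
  next
    case (step i)
    have "2^(K-i) = (2::nat) * 2 ^ (K - Suc i)" using step by (simp add: Suc_diff_Suc[symmetric] del: diff_Suc_Suc)
    then have "Y i (t,0) ^ (2^(K-i)) = (Y i (t,0) ^ 2) ^ (2 ^ (K - Suc i))" by (simp only: power_mult)
    also have "\<dots> = of_real x0" using Y0[of i t] step by auto
    finally show ?case .
  qed
  have val: "Y i (of_real ts,0) = of_real (x0 powr (1 / 2 ^ (K - i))) * cis (2 * pi * b i)" if "1 \<le> i" "i \<le> Suc k" for i
    using that(2,1)
  proof (induction i rule: inc_induct)
    case base
    have b12: "b (Suc k) = 1/2" using b_step[of "Suc k"] b_K Qk(2) by (simp add: d_def)
    have "cis (2 * pi * b (Suc k)) = - 1" unfolding b12 by simp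
    moreover have "csqrt (of_real x0) = of_real (sqrt x0)" by (rule csqrt_of_real) simp
    ultimately show ?case using Y(3)[OF ts, of 0] by (simp add: power_0_left powr_half_sqrt del: csqrt.simps power_Suc)
  next
    case (step i)
    have iK: "i < K" using step by simp
    define w where "w = of_real (x0 powr (1 / 2 ^ (K - i))) * cis (2 * pi * b i)"
    have pw: "(x0 powr (1 / 2 ^ (K - i))) ^ 2 = x0 powr (1 / 2 ^ (K - Suc i))"
    proof -
      have "(x0 powr (1 / 2 ^ (K - i))) ^ 2 = x0 powr (1 / 2 ^ (K - i) + 1 / 2 ^ (K - i))"
        by (simp only: power2_eq_square powr_add)
      moreover have "1 / 2 ^ (K - i) + 1 / 2 ^ (K - i) = (1 / 2 ^ (K - Suc i) :: real)"
        using step by (simp add: Suc_diff_Suc[symmetric] del: diff_Suc_Suc)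
      ultimately show ?thesis by simp
    qed
    have "w ^ 2 = Y i (of_real ts,0) ^ 2"
      unfolding w_def power_mult_distrib cis_b_square[OF iK] of_real_power[symmetric] pw using Y0[of i "of_real ts"] step ts by auto
    \<comment> \<open>The two square roots are told apart by the sign of the imaginary part.\<close>
    then consider "Y i (of_real ts,0) = w" | "Y i (of_real ts,0) = - w" by (auto simp: power2_eq_iff)
    then show ?case
    proof cases
      case 2
      have "Im w = x0 powr (1 / 2 ^ (K - i)) * sin (2 * pi * b i)" by (simp add: w_def)
      moreover have "0 < x0 powr (1 / 2 ^ (K - i))" by simp
      ultimately have "if Q3 i then Im w < 0 else 0 < Im w"
        using sign_sin_b[of i] step by (simp add: mult_less_0_iff zero_less_mult_iff)
      then show ?thesis using Y(6)[of i 0] step 2 by (auto split: if_splits)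
    qed (simp add: w_def)
  qed
  have main: "A K s = e" if s: "s \<in> Om" "orb s K = of_real x0" "orb s k = q s" for s
  proof -
    have "achain K s (\<lambda>i v. Y i (s,v))"
      unfolding achain_def
    proof (intro conjI ballI)
      show "continuous_on {0..1} (\<lambda>v. Y i (s,v))" if "i \<in> {1..K}" for i
        by (rule continuous_on_compose2[OF Y(1)[OF that]]) (use s in \<open>auto intro!: continuous_intros\<close>)
    qed (use s Y(2,4,5) in auto)
    moreover have "s \<in> V K" using s by (simp add: V_def)
    ultimately have "A K s = Y 1 (s,0)" by (intro A_eq) auto
    also have "\<dots> = Y 1 (of_real ts,0)"
    proof (rule root_of_unity_constant[OF connected_Om, of "\<lambda>t. Y 1 (t,0)" "2^(K-1)" "of_real x0"])
      show "continuous_on Om (\<lambda>t. Y 1 (t,0))"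
        by (rule continuous_on_compose2[OF Y(1)]) (auto intro!: continuous_intros)
    qed (use s ts Y0K[of 1] in auto)
    also have "\<dots> = e" using val[of 1] by (simp add: e_def)
    finally show ?thesis .
  qed
  \<comment> \<open>At \<open>ts\<close> the value of \<open>q\<close> is purely imaginary, so both
    sides agree there. Conjugating the parameter thus exchanges the two roots at time
    \<open>k\<close>.\<close>
  have qc: "q (cnj s) = - cnj (q s)" if s: "s \<in> Om" for s
  proof (rule sqrt_unique[OF connected_Om, of "\<lambda>s. q (cnj s)" "\<lambda>s. - cnj (q s)" "of_real ts"])
    show "continuous_on Om (\<lambda>s. q (cnj s))"
      by (rule continuous_on_compose2[OF q(2)]) (auto intro!: continuous_intros cnj_Om)
    show "continuous_on Om (\<lambda>s. - cnj (q s))" by (intro continuous_intros q)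
    fix s assume s: "s \<in> Om"
    have "csqrt (cnj (of_real x0 - s)) = cnj (csqrt (of_real x0 - s))"
      using csqrt_near_x0(1)[OF Om_bounded[OF s], of 1] cnj_csqrt[of "of_real x0 - s"] by simp
    then have cj: "csqrt (of_real x0 - cnj s) = cnj (csqrt (of_real x0 - s))" by simp
    have "(- cnj (q s)) ^ 2 = cnj (q s ^ 2)" by simp
    also have "\<dots> = - cnj (csqrt (of_real x0 - s)) - cnj s" using q(1)[OF s] by (simp del: csqrt.simps)
    finally show "q (cnj s) ^ 2 = (- cnj (q s)) ^ 2" unfolding q(1)[OF cnj_Om[OF s]] cj by simp
    have neg: "Re (- csqrt (of_real x0 - cnj s) - cnj s) < 0"
      using csqrt_near_x0(3)[OF Om_bounded[OF cnj_Om[OF s]], of 1 1] by (simp del: csqrt.simps)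
    show "q (cnj s) \<noteq> 0"
    proof
      assume "q (cnj s) = 0"
      then have "- csqrt (of_real x0 - cnj s) - cnj s = 0" using q(1)[OF cnj_Om[OF s]] by (simp only: zero_power2)
      then show False using neg by (simp only: zero_complex.sel less_irrefl)
    qed
  qed (use s ts q in \<open>auto simp: complex_eq_iff\<close>)
  note csqrt_at_zero[OF assms]
  then have "q t ^ 2 = orb t k ^ 2" using q(1)[OF assms(1)] by (simp add: orb_Suc[of t k] del: csqrt.simps)
  then consider "orb t k = q t" | "orb t k = - q t" by (auto simp: power2_eq_iff)
  then show ?thesis
  proof cases
    case 1 then show ?thesis using main assms by blast
  next
    case 2
    have "orb (cnj t) k = q (cnj t)" using qc[OF assms(1)] 2 orb_cnj by simp
    moreover have "orb (cnj t) K = of_real x0" using assms(2) orb_cnj[of t K] by simp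
    ultimately show ?thesis using main[OF cnj_Om[OF assms(1)]] by blast
  qed
qed

text \<open>For a real parameter the square of the value at time \<open>k\<close> would be negative.
  Hence the two centres are distinct.\<close>

lemma zero_not_real: assumes "t \<in> Om" "orb t K = of_real x0" shows "t \<noteq> cnj t"
proof
  assume "t = cnj t"
  then have t: "t = of_real (Re t)" by (simp add: complex_eq_iff)
  note csqrt_at_zero[OF assms]
  then have "Re (orb t (Suc k) - t) < 0"
    using csqrt_near_x0(3)[OF Om_bounded[OF assms(1)], of 1 1] by (simp del: csqrt.simps)
  then have "Re (orb t k ^ 2) < 0" by (simp add: orb_Suc[of t k])
  moreover have "Im (orb t k) = 0" by (subst t) (rule orb_real)
  ultimately show False by (simp add: power2_eq_square mult_less_0_iff)
qed

lemma compact_sublevel: assumes "\<eta> < R" shows "compact {t \<in> Om. cmod (orb t K - of_real x0) \<le> \<eta>}"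
  unfolding compact_eq_bounded_closed
proof
  show "bounded {t \<in> Om. cmod (orb t K - of_real x0) \<le> \<eta>}"
    by (rule boundedI[of _ 10]) (use Om_bounded less_imp_le in auto)
  have c: "closed {t. cmod (orb t K - of_real x0) \<le> \<eta>}"
    by (intro closed_Collect_le continuous_intros continuous_on_orb)
  have sub: "{t. cmod (orb t K - of_real x0) \<le> \<eta>} \<subseteq> {t. orb t K \<in> ball (of_real x0) R}"
    using assms by (auto simp: dist_norm norm_minus_commute)
  have "closedin (top_of_set {t. orb t K \<in> ball (of_real x0) R}) Om"
    unfolding Om_def by (rule closedin_connected_component)
  then obtain C where C: "closed C" "Om = {t. orb t K \<in> ball (of_real x0) R} \<inter> C" unfolding closedin_closed by blast
  have "{t \<in> Om. cmod (orb t K - of_real x0) \<le> \<eta>} = {t. cmod (orb t K - of_real x0) \<le> \<eta>} \<inter> C"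
    using C(2) sub by blast
  then show "closed {t \<in> Om. cmod (orb t K - of_real x0) \<le> \<eta>}" using closed_Int[OF c C(1)] by simp
qed

text \<open>A Riemann map of \<open>Om\<close> turns the normalised value at time \<open>K\<close>
  into a map \<open>h\<close> of the disc, close to modulus 1 near the circle, with exactly two
  simple zeros. If the product of the two Moebius factors is at most \<open>r\<close>, one of them
  is at most \<open>sqrt r\<close>, so the Riemann map is recentred at each zero.\<close>

lemma core_structure:
  obtains E F1 F2 where "E \<in> Om" "orb E K = of_real x0" "A K E = e"
    "F1 holomorphic_on ball 0 1" "F1 ` ball 0 1 \<subseteq> Om" "F1 0 = E"
    "F2 holomorphic_on ball 0 1" "F2 ` ball 0 1 \<subseteq> Om" "F2 0 = cnj E"
    "\<And>t. t \<in> Om \<Longrightarrow> cmod (orb t K - of_real x0) \<le> x0 - 1/50 \<Longrightarrow>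
      \<exists>z. cmod z \<le> sqrt ((x0 - 1/50) / R) \<and> (F1 z = t \<or> F2 z = t)"
proof -
  have "Om \<noteq> {}" "Om \<noteq> UNIV"
    using ts_in_Om Om_bounded[of 10] by auto
  then obtain f g where f: "f holomorphic_on Om" "g holomorphic_on ball 0 1"
    "\<And>z. z \<in> Om \<Longrightarrow> f z \<in> ball 0 1 \<and> g (f z) = z" "\<And>z. z \<in> ball 0 1 \<Longrightarrow> g z \<in> Om \<and> f (g z) = z"
    using Riemann_mapping_theorem[of Om] open_Om simply_connected_Om by metis
  define h where "h = (\<lambda>z. (orb (g z) K - of_real x0) / of_real R)"
  have Rpos: "0 < R" by simp
  have hn: "cmod (h z) = cmod (orb (g z) K - of_real x0) / R" for z
    unfolding h_def norm_divide norm_of_real by (simp only: abs_of_pos[OF Rpos])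
  have ho: "(\<lambda>z. orb (g z) K) holomorphic_on ball 0 1"
  proof -
    have "((\<lambda>t. orb t K) \<circ> g) holomorphic_on ball 0 1"
      by (rule holomorphic_on_compose_gen[OF f(2) holomorphic_orb[of _ UNIV]]) auto
    then show ?thesis by (simp add: o_def)
  qed
  then have hh: "h holomorphic_on ball 0 1" unfolding h_def by (intro holomorphic_intros) auto
  \<comment> \<open>Sublevel sets are compact in \<open>Om\<close>, so their images under the
    Riemann map keep away from the circle.\<close>
  have bd: "\<exists>r0<1. \<forall>z. r0 \<le> cmod z \<and> cmod z < 1 \<longrightarrow> \<eta> \<le> cmod (h z)" if eta: "\<eta> < 1" for \<eta>
  proof -
    define C where "C = {t \<in> Om. cmod (orb t K - of_real x0) \<le> \<eta> * R}"
    have "\<eta> * R < 1 * R" using eta Rpos by (intro mult_strict_right_mono)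
    then have C: "compact C" unfolding C_def by (intro compact_sublevel) simp
    have CO: "C \<subseteq> Om" by (auto simp: C_def)
    have inC: "g z \<in> C" if "cmod z < 1" "cmod (h z) < \<eta>" for z
    proof -
      have "cmod (orb (g z) K - of_real x0) < \<eta> * R" using that(2) Rpos unfolding hn by (simp only: pos_divide_less_eq)
      then show ?thesis using f(4)[of z] that(1) by (simp add: C_def)
    qed
    show ?thesis
    proof (cases "C = {}")
      case True
      then have "\<forall>z. 0 \<le> cmod z \<and> cmod z < 1 \<longrightarrow> \<eta> \<le> cmod (h z)" using inC by (meson emptyE not_less)
      then show ?thesis using zero_less_one by blast
    next
      case False
      have "continuous_on C (\<lambda>t. cmod (f t))"
        by (intro continuous_intros holomorphic_on_imp_continuous_on holomorphic_on_subset[OF f(1) CO])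
      then obtain m where m: "m \<in> C" "\<And>t. t \<in> C \<Longrightarrow> cmod (f t) \<le> cmod (f m)"
        using continuous_attains_sup[OF C False] by blast
      have m1: "cmod (f m) < 1" using f(3)[of m] m(1) CO by auto
      have "\<eta> \<le> cmod (h z)" if "(1/2 + cmod (f m) / 2) \<le> cmod z" "cmod z < 1" for z
      proof (rule ccontr)
        assume "\<not> \<eta> \<le> cmod (h z)"
        then have "g z \<in> C" using inC that by simp
        then have "cmod (f (g z)) \<le> cmod (f m)" by (rule m(2))
        then show False using f(4)[of z] that m1 by simp
      qed
      moreover have "1/2 + cmod (f m) / 2 < 1" using m1 by simp
      ultimately show ?thesis by blast
    qed
  qed
  have "cmod (h 0) < 1" using orb_K_Om(3)[of "g 0"] f(4)[of 0] Rpos unfolding hn by simp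
  then obtain z0 where z0: "cmod z0 < 1" "h z0 = 0" using min_modulus_proper[OF hh bd] by blast
  have zero_iff: "h z = 0 \<longleftrightarrow> orb (g z) K = of_real x0" for z by (simp add: h_def)
  have t0: "g z0 \<in> Om" "orb (g z0) K = of_real x0" using f(4)[of z0] z0 zero_iff by auto
  have cz: "cnj t \<in> Om \<and> orb (cnj t) K = of_real x0" if "t \<in> Om" "orb t K = of_real x0" for t
    using cnj_Om[OF that(1)] orb_cnj[of t K] that(2) by simp
  obtain E where E: "E \<in> Om" "orb E K = of_real x0" "A K E = e"
    using zero_value[OF t0] t0 cz[OF t0] by blast
  have VK: "t \<in> V K" if "orb t K = of_real x0" for t using that by (simp add: V_def)
  have Ainj: "inj_on (A K) (V K)" using A_bij[of K] by (simp add: bij_betw_def)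
  have only: "t = E \<or> t = cnj E" if t: "t \<in> Om" "orb t K = of_real x0" for t
  proof -
    have "A K t = A K E \<or> A K (cnj t) = A K E" using zero_value[OF t] E(3) by simp
    then have "t = E \<or> cnj t = E"
      using inj_onD[OF Ainj, of t E] inj_onD[OF Ainj, of "cnj t" E] VK t cz[OF t] E(2) by blast
    then show ?thesis by auto
  qed
  define za where "za = f E"
  define zb where "zb = f (cnj E)"
  have za: "cmod za < 1" "g za = E" and zb: "cmod zb < 1" "g zb = cnj E"
    using f(3)[OF E(1)] f(3)[of "cnj E"] cz[OF E(1,2)] by (auto simp: za_def zb_def)
  have "za \<noteq> zb" using za zb zero_not_real[OF E(1,2)] by auto
  have ginj: "inj_on g (ball 0 1)" using f(4) by (metis inj_onI)
  have dh: "deriv h z \<noteq> 0" if z: "cmod z < 1" "orb (g z) K = of_real x0" for z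
  proof -
    have zb: "z \<in> ball 0 1" using z by simp
    have "(g has_field_derivative deriv g z) (at z)" by (rule holomorphic_derivI[OF f(2) open_ball zb])
    moreover have "((\<lambda>t. orb t K) has_field_derivative deriv (\<lambda>t. orb t K) (g z)) (at (g z))"
      by (rule holomorphic_derivI[OF holomorphic_orb[of _ UNIV] open_UNIV UNIV_I])
    ultimately have "((\<lambda>z. orb (g z) K) has_field_derivative deriv (\<lambda>t. orb t K) (g z) * deriv g z) (at z)"
      by (rule DERIV_chain2[rotated])
    then have "((\<lambda>z. (orb (g z) K - of_real x0) / of_real R) has_field_derivative
        (deriv (\<lambda>t. orb t K) (g z) * deriv g z - 0) / of_real R) (at z)"
      by (intro DERIV_cdivide DERIV_diff DERIV_const)
    then have "deriv h z = (deriv (\<lambda>t. orb t K) (g z) * deriv g z - 0) / of_real R"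
      unfolding h_def by (rule DERIV_imp_deriv)
    moreover have "deriv g z \<noteq> 0" by (rule holomorphic_injective_imp_regular[OF f(2) open_ball ginj zb])
    moreover have "deriv (\<lambda>t. orb t K) (g z) \<noteq> 0" by (rule deriv_orb_nonzero) (use VK z in auto)
    moreover have "of_real R \<noteq> (0::complex)" unfolding of_real_eq_0_iff by simp
    ultimately show ?thesis by (metis diff_zero divide_eq_0_iff mult_eq_0_iff)
  qed
  have zeros: "h za = 0" "h zb = 0" "deriv h za \<noteq> 0" "deriv h zb \<noteq> 0"
    using zero_iff za zb E(2) cz[OF E(1,2)] dh[of za] dh[of zb] by auto
  have only': "z = za \<or> z = zb" if "cmod z < 1" "h z = 0" for z
  proof -
    have "g z = E \<or> g z = cnj E" using only[of "g z"] f(4)[of z] that zero_iff by auto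
    then show ?thesis using f(4)[of z] that unfolding za_def zb_def by auto
  qed
  define M where "M = (\<lambda>w z. Moebius_function 0 w z)"
  have Mn: "cmod (M w z) < 1" if "cmod w < 1" "cmod z < 1" for w z
    unfolding M_def by (rule Moebius_function_norm_lt_1[OF that])
  have Minv: "M (- w) (M w z) = z" if "cmod w < 1" "cmod z < 1" for w z
    unfolding M_def by (rule Moebius_function_compose) (use that in auto)
  define F where "F = (\<lambda>w z. g (M (- w) z))"
  have F: "F w holomorphic_on ball 0 1" "F w ` ball 0 1 \<subseteq> Om" "F w 0 = g w" if w: "cmod w < 1" for w
  proof -
    have "(g \<circ> M (- w)) holomorphic_on ball 0 1"
    proof (rule holomorphic_on_compose_gen[OF _ f(2)])
      show "M (- w) holomorphic_on ball 0 1" unfolding M_def by (rule Moebius_function_holomorphic) (use w in simp)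
      show "M (- w) ` ball 0 1 \<subseteq> ball 0 1" using Mn[of "- w"] w by auto
    qed
    then show "F w holomorphic_on ball 0 1" by (simp add: F_def o_def)
    show "F w ` ball 0 1 \<subseteq> Om" using Mn[of "- w"] w f(4) by (auto simp: F_def)
    show "F w 0 = g w" by (simp add: F_def M_def Moebius_function_simple)
  qed
  have est: "\<exists>z. cmod z \<le> sqrt ((x0 - 1/50) / R) \<and> (F za z = t \<or> F zb z = t)"
    if t: "t \<in> Om" "cmod (orb t K - of_real x0) \<le> x0 - 1/50" for t
  proof -
    define z where "z = f t"
    have z: "cmod z < 1" "g z = t" using f(3)[OF t(1)] by (auto simp: z_def)
    let ?r = "(x0 - 1/50) / R"
    have r0: "0 \<le> ?r" by simp
    have "cmod (M za z) * cmod (M zb z) \<le> cmod (h z)"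
      unfolding M_def by (rule Moebius_le_of_proper[OF hh bd za(1) zb(1) \<open>za \<noteq> zb\<close> zeros only' z(1)])
    also have "\<dots> \<le> ?r" unfolding hn z(2) using t(2) Rpos by (intro divide_right_mono) auto
    also have "\<dots> = sqrt ?r * sqrt ?r" using r0 by (simp only: real_sqrt_mult_self abs_of_nonneg)
    finally have "cmod (M za z) \<le> sqrt ?r \<or> cmod (M zb z) \<le> sqrt ?r"
      using mult_strict_mono[of "sqrt ?r" "cmod (M za z)" "sqrt ?r" "cmod (M zb z)"] real_sqrt_ge_zero[OF r0]
      by (meson not_less norm_ge_zero le_less_trans)
    moreover have "F za (M za z) = t" "F zb (M zb z) = t" using Minv za zb z by (auto simp: F_def)
    ultimately show ?thesis by blast
  qed
  show thesis
    by (rule that[of E "F za" "F zb"]) (use E F[OF za(1)] F[OF zb(1)] za zb est in auto)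
qed

end

section \<open>Landing of the ray\<close>

text \<open>An infinite set of exceptional indices would be a sequence to which
  \<open>shrinking_discs\<close> applies.\<close>

lemma shrinking_discs_cofinite:
  fixes F :: "nat \<Rightarrow> complex \<Rightarrow> complex"
  assumes hol: "\<And>j. F j holomorphic_on ball 0 1"
    and bdd: "\<And>j z. cmod z < 1 \<Longrightarrow> cmod (F j z) \<le> B"
    and avoid: "\<And>i. finite {j. F i 0 \<in> F j ` ball 0 1}"
    and \<sigma>: "\<sigma> < 1" and e: "e > 0"
  shows "finite {j. \<not> (\<forall>z. cmod z \<le> \<sigma> \<longrightarrow> dist (F j z) (F j 0) < e)}" (is "finite ?B")
proof (rule ccontr)
  assume inf: "infinite ?B"
  define r where "r = enumerate ?B"
  have inj: "inj r" unfolding r_def using strict_mono_enumerate[OF inf] strict_mono_imp_inj_on by blast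
  have "\<exists>j. \<forall>z. cmod z \<le> \<sigma> \<longrightarrow> dist (F (r j) z) (F (r j) 0) < e"
  proof (rule shrinking_discs[of "\<lambda>j. F (r j)"])
    show "finite {j. F (r i) 0 \<in> F (r j) ` ball 0 1}" for i
      using finite_vimageI[OF avoid[of "r i"] inj] by (simp add: vimage_def)
  qed (use hol bdd \<sigma> e in auto)
  then show False using enumerate_in_set[OF inf] by (auto simp: r_def)
qed

lemma core_bound:
  assumes "1/30 < Re w" "cmod w \<le> 108"
  shows "cmod (w - of_real x0) \<le> x0 - 1/50"
proof (rule power2_le_imp_le)
  have "cmod (w - of_real x0) ^ 2 = cmod w ^ 2 - 2 * x0 * Re w + x0 ^ 2"
    unfolding cmod_power2 by (simp add: power2_eq_square algebra_simps)
  moreover have "cmod w ^ 2 \<le> 108 ^ 2" using assms(2) by (rule power_mono) simp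
  ultimately show "cmod (w - of_real x0) ^ 2 \<le> (x0 - 1/50) ^ 2" using assms(1) by (simp add: power2_eq_square)
qed simp

context core begin

lemma cis_b: "i \<le> K \<Longrightarrow> cis (2 * pi * b i) ^ (2^(K-i)) = 1"
proof (induction i rule: inc_induct)
  case base then show ?case by (simp add: b_K)
next
  case (step i)
  have "2^(K-i) = (2::nat) * 2 ^ (K - Suc i)" using step by (simp add: Suc_diff_Suc[symmetric] del: diff_Suc_Suc)
  then have "cis (2 * pi * b i) ^ (2^(K-i)) = (cis (2 * pi * b i) ^ 2) ^ (2 ^ (K - Suc i))" by (simp only: power_mult)
  also have "cis (2 * pi * b i) ^ 2 = cis (2 * pi * b (Suc i))" by (rule cis_b_square) (use step in simp)
  finally show ?case using step by simp
qed

text \<open>The arc on which the \<open>K\<close>-th orbit value runs from \<open>x0\<close> to its value on the ray stays in \<open>Om\<close>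
  because \<open>A K\<close> is explicit on it.\<close>

lemma ray_tail:
  assumes p: "p \<in> Om" "orb p K = of_real x0" "A K p = e"
  shows "\<exists>r1>1. \<forall>r. 1 < r \<and> r \<le> r1 \<longrightarrow> ray r \<in> Om \<and> cmod (orb (ray r) K - of_real x0) \<le> x0 - 1/50"
proof -
  define n where "n = (2::nat) ^ (K - 1)"
  have n0: "0 < n" by (simp add: n_def)
  \<comment> \<open>With \<open>r1 ^ n = 36\<close> the value at time \<open>K\<close> has modulus
    at least 12 at \<open>r1\<close> and at most 108 on the rest of the ray inwards.\<close>
  define r1 where "r1 = root n 36"
  have r1: "1 < r1" "r1 ^ n = 36" using n0 by (auto simp: r1_def)
  define t1 where "t1 = ray r1"
  define w1 where "w1 = orb t1 K"
  have Phi1: "t1 \<notin> mandelbrot" "Phi t1 = of_real r1 * cis (2 * pi * a 1)"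
    using parameter_ray_properties[OF r1(1)] by (auto simp: t1_def)
  have Phi_norm: "cmod (Phi (ray r)) = r" if "1 < r" for r
    using parameter_ray_properties(2)[OF that] that by (simp add: norm_mult)
  have 12: "12 \<le> cmod w1" and t1V: "t1 \<in> V K"
    using orb_ge_of_Phi[OF Phi1(1), of K] Phi_norm[OF r1(1)] r1 by (auto simp: w1_def t1_def n_def)
  have Re1: "9 \<le> Re w1"
    using Re_orb_ray_large(1)[OF r1(1), of K] 12 Qk(3) r1(2) by (simp add: w1_def t1_def n_def)
  have bound: "cmod (orb (ray r) K - of_real x0) \<le> x0 - 1/50" if r: "1 < r" "r \<le> r1" for r
  proof (rule core_bound)
    show "1/30 < Re (orb (ray r) K)" using sep_ray[OF r(1), of K] Qk(3) by (simp add: sep_def)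
    show "cmod (orb (ray r) K) \<le> 108"
    proof (cases "ray r \<in> V K")
      case True
      have "cmod (orb (ray r) K) \<le> 3 * cmod (Phi (ray r)) ^ n" using Phi_bounds(1)[OF _ True] by (simp add: n_def)
      also have "\<dots> = 3 * r ^ n" using Phi_norm[OF r(1)] by simp
      also have "\<dots> \<le> 3 * r1 ^ n" using r by (intro mult_left_mono power_mono) auto
      finally show ?thesis using r1(2) by simp
    qed (simp add: V_def)
  qed
  obtain g where g: "continuous_on (E K) g" "\<And>t. t \<in> V K \<Longrightarrow> g (A K t) = t" 
    "\<And>y. y \<in> E K \<Longrightarrow> g y \<in> V K \<and> A K (g y) = y" using A_inverse[of K] by auto
  define y where "y w = cis (2 * pi * b 1) * exp (Ln w / of_nat n)" for w
  \<comment> \<open>A convex set that contains both \<open>x0\<close> and the ray value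
    \<open>w1\<close>, and on which \<open>y\<close> is an explicit branch of the
    \<open>n\<close>-th root.\<close>
  define B where "B = {w. 2 < Re w} \<inter> ball (of_real x0) R"
  have yn: "y w ^ n = w" if "w \<noteq> 0" for w
  proof -
    have "cis (2 * pi * b 1) ^ n = 1" using cis_b[of 1] by (simp add: n_def)
    moreover have "exp (Ln w / of_nat n) ^ n = w" using n0 that by (simp add: exp_of_nat_mult[symmetric])
    ultimately show ?thesis by (simp add: y_def power_mult_distrib)
  qed
  have yE: "y w \<in> E K" if "2 < Re w" for w
  proof -
    have "cmod (y w) ^ n = cmod w" using yn[of w] that by (metis norm_power complex_Re_le_cmod less_eq_real_def not_less zero_complex.sel(1) zero_less_numeral)
    then show ?thesis using that complex_Re_le_cmod[of w] by (simp add: E_def n_def)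
  qed
  define T where "T w = g (y w)" for w
  have orbT: "orb (T w) K = w" if "2 < Re w" for w
  proof -
    have "orb (T w) K = A K (T w) ^ n" using A_power[of "T w" K] g(3)[OF yE[OF that]] by (simp add: T_def n_def)
    also have "\<dots> = y w ^ n" using g(3)[OF yE[OF that]] by (simp add: T_def)
    also have "\<dots> = w" using that by (intro yn) auto
    finally show ?thesis .
  qed
  have cT: "continuous_on B T"
    unfolding T_def
  proof (rule continuous_on_compose2[OF g(1)])
    have "w \<notin> \<real>\<^sub>\<le>\<^sub>0" if "w \<in> B" for w using that by (auto simp: B_def complex_nonpos_Reals_iff)
    then show "continuous_on B y" unfolding y_def by (intro continuous_intros) (use n0 in auto)
  qed (use yE in \<open>auto simp: B_def\<close>)
  have "convex B" unfolding B_def by (intro convex_Int convex_ball convex_halfspace_Re_gt)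
  then have conTB: "connected (T ` B)" by (intro connected_continuous_image cT convex_connected)
  have "y (of_real x0) = e"
  proof -
    have "Ln (of_real x0) = of_real (ln x0)" by (rule Ln_of_real) simp
    then have "exp (Ln (of_real x0) / of_nat n) = of_real (exp (ln x0 / real n))" by (simp add: exp_of_real[symmetric])
    also have "exp (ln x0 / real n) = x0 powr (1 / real n)" by (simp add: powr_def)
    finally show ?thesis by (simp add: y_def e_def n_def mult.commute)
  qed
  then have Tx0: "T (of_real x0) = p" using g(2)[of p] p(2,3) by (simp add: T_def V_def)
  \<comment> \<open>Adding the tail \<open>a K / n\<close> to the truncated angle \<open>b 1\<close>
    gives \<open>a 1\<close>. The principal logarithm is the right one because type
    \<open>Q1\<close> keeps \<open>2 * pi * a K\<close> between 0 and \<open>pi / 3\<close>.\<close>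
  have Tw1: "T w1 = t1"
  proof -
    have S: "cmod (S K t1) \<le> 1/5"
    proof -
      have "cmod (S K t1) \<le> 2 * (1 / cmod w1)" using S_bound[OF t1V] ratio_bound(2)[OF t1V order_refl] by (simp add: w1_def)
      also have "\<dots> \<le> 2 * (1 / 12)" using 12 by (intro mult_left_mono divide_left_mono) auto
      finally show ?thesis by simp
    qed
    define u where "u = of_real (n * ln r1) + \<i> * of_real (2 * pi * a K) - S K t1"
    have "exp u = of_real (exp (ln r1)) ^ n * cis (2 * pi * a K) * exp (- S K t1)"
      by (simp add: u_def exp_add exp_diff exp_minus field_simps cis_conv_exp exp_of_real[symmetric] exp_of_nat_mult[symmetric])
    also have "\<dots> = w1" using ray_orb[OF r1(1), of K] t1V r1 by (simp add: w1_def t1_def n_def)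
    finally have eu: "exp u = w1" .
    have "\<bar>Im (S K t1)\<bar> \<le> 1/5" using S abs_Im_le_cmod[of "S K t1"] by linarith
    moreover have "0 \<le> 2 * pi * a K" "2 * pi * a K \<le> pi / 3" using a_Q1[OF Qk(3)] a_nonneg[of K] by (auto simp: field_simps)
    moreover have "Im u = 2 * pi * a K - Im (S K t1)" by (simp add: u_def)
    ultimately have "- pi < Im u" "Im u \<le> pi" using pi_gt3 by linarith+
    then have "Ln w1 = u" unfolding eu[symmetric] by (rule Ln_exp)
    then have "y w1 = cis (2 * pi * b 1) * exp (of_real (ln r1) + \<i> * of_real (2 * pi * a K / n) - S K t1 / of_nat n)"
      using n0 by (simp add: y_def u_def add_divide_distrib diff_divide_distrib)
    also have "\<dots> = of_real r1 * (cis (2 * pi * b 1) * cis (2 * pi * a K / n)) * exp (- (S K t1 / of_nat n))"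
      using r1(1) by (simp add: exp_add exp_diff exp_minus field_simps cis_conv_exp exp_of_real)
    also have "cis (2 * pi * b 1) * cis (2 * pi * a K / n) = cis (2 * pi * a 1)"
      unfolding cis_mult by (simp add: b_def n_def algebra_simps)
    also have "of_real r1 * cis (2 * pi * a 1) * exp (- (S K t1 / of_nat n)) = A K t1"
      using Phi_eq[OF _ t1V] Phi1(2) by (simp add: n_def exp_minus field_simps)
    finally show ?thesis using g(2)[OF t1V] by (simp add: T_def)
  qed
  have "T ` B \<subseteq> Om"
  proof (rule Om_maximal[OF conTB _ p(1)])
    show "p \<in> T ` B" using Tx0 by (intro image_eqI[of _ _ "of_real x0"]) (auto simp: B_def)
    show "orb t K \<in> ball (of_real x0) R" if "t \<in> T ` B" for t using that orbT by (auto simp: B_def)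
  qed
  moreover have inball: "orb (ray r) K \<in> ball (of_real x0) R" if "1 < r" "r \<le> r1" for r
    using bound[OF that] by (simp add: dist_norm norm_minus_commute)
  moreover have "w1 \<in> B" using inball[of r1] r1 Re1 by (simp add: B_def w1_def t1_def)
  ultimately have t1Om: "t1 \<in> Om" using Tw1 by blast
  have "ray ` {1<..r1} \<subseteq> Om"
  proof (rule Om_maximal[OF _ _ t1Om])
    show "connected (ray ` {1<..r1})"
      by (intro connected_continuous_image continuous_on_subset[OF continuous_on_parameter_ray]) auto
  qed (use r1 inball in \<open>auto simp: t1_def\<close>)
  then show ?thesis using bound r1(1) by (intro exI[of _ r1]) auto
qed

end

context rotation begin

lemma core_of: "closest_return k \<Longrightarrow> tuned t \<Longrightarrow> core \<gamma> k t"
  unfolding core_def core_axioms_def using rotation_axioms by blast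

text \<open>The radius \<open>\<sigma>\<close> in \<open>core_structure\<close> is the same for all
  closest returns. Every centre escapes and hence lies in only finitely many of the sets
  \<open>Om\<close>, which is the avoidance condition of the normal family argument.\<close>

lemma small_core:
  assumes ts: "tuned ts" and \<epsilon>: "0 < \<epsilon>"
  shows "\<exists>k p. closest_return k \<and> p \<in> core.Om k ts \<and> orb p (Suc (Suc k)) = of_real x0 \<and> A (Suc (Suc k)) p = core.e \<gamma> k \<and>
    (\<forall>t\<in>core.Om k ts. cmod (orb t (Suc (Suc k)) - of_real x0) \<le> x0 - 1/50 \<longrightarrow> cmod (t - of_real ts) < \<epsilon>)"
proof -
  define \<sigma> where "\<sigma> = sqrt ((x0 - 1/50) / (x0 - 1/60))"
  have \<sigma>: "\<sigma> < 1" by (simp add: \<sigma>_def)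
  have inf: "infinite {k. closest_return k}"
    unfolding infinite_nat_iff_unbounded using closest_return_exists by (metis mem_Collect_eq)
  define kk where "kk = enumerate {k. closest_return k}"
  have kk: "closest_return (kk j)" for j using enumerate_in_set[OF inf, of j] by (simp add: kk_def)
  have kk_ge: "j \<le> kk j" for j unfolding kk_def using strict_mono_enumerate[OF inf] strict_mono_imp_increasing by blast
  define KK where "KK j = Suc (Suc (kk j))" for j
  define P where "P j p F1 F2 \<longleftrightarrow> p \<in> core.Om (kk j) ts \<and> orb p (KK j) = of_real x0 \<and> A (KK j) p = core.e \<gamma> (kk j) \<and>
    F1 holomorphic_on ball 0 1 \<and> F1 ` ball 0 1 \<subseteq> core.Om (kk j) ts \<and> F1 0 = p \<and>
    F2 holomorphic_on ball 0 1 \<and> F2 ` ball 0 1 \<subseteq> core.Om (kk j) ts \<and> F2 0 = cnj p \<and>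
    (\<forall>t. t \<in> core.Om (kk j) ts \<longrightarrow> cmod (orb t (KK j) - of_real x0) \<le> x0 - 1/50 \<longrightarrow>
      (\<exists>z. cmod z \<le> \<sigma> \<and> (F1 z = t \<or> F2 z = t)))" for j p and F1 F2 :: "complex \<Rightarrow> complex"
  have "\<exists>p F1 F2. P j p F1 F2" for j
  proof -
    interpret c: core \<gamma> "kk j" ts by (rule core_of[OF kk ts])
    obtain p F1 F2 where "P j p F1 F2" unfolding P_def KK_def \<sigma>_def by (rule c.core_structure) blast
    then show ?thesis by blast
  qed
  then obtain p F1 F2 where P: "\<And>j. P j (p j) (F1 j) (F2 j)" by metis
  have Om: "cmod t < 10 \<and> cmod (orb t (KK j)) < 2 * x0" if "t \<in> core.Om (kk j) ts" for j t
  proof -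
    interpret c: core \<gamma> "kk j" ts by (rule core_of[OF kk ts])
    show ?thesis using c.Om_bounded[OF that] c.orb_K_Om(2)[OF that] by (simp add: KK_def)
  qed
  have av: "finite {j. t \<in> core.Om (kk j) ts}" if "t \<in> V n" for t n
  proof -
    have "eventually (\<lambda>m. 2 * x0 \<le> cmod (orb t m)) sequentially"
      using orb_tends_to_infinity[OF that] by (simp add: filterlim_at_top)
    then obtain M where M: "\<And>m. M \<le> m \<Longrightarrow> 2 * x0 \<le> cmod (orb t m)" by (auto simp: eventually_sequentially)
    have "{j. t \<in> core.Om (kk j) ts} \<subseteq> {..M}"
    proof
      fix j assume "j \<in> {j. t \<in> core.Om (kk j) ts}"
      then have "cmod (orb t (KK j)) < 2 * x0" using Om by blast
      then have "\<not> M \<le> KK j" using M[of "KK j"] by linarith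
      then show "j \<in> {..M}" using kk_ge[of j] by (simp add: KK_def)
    qed
    then show ?thesis by (rule finite_subset) simp
  qed
  have pV: "p j \<in> V (KK j)" "cnj (p j) \<in> V (KK j)" for j
    using P[of j] orb_cnj[of "p j" "KK j"] by (auto simp: P_def V_def)
  have F: "F1 j holomorphic_on ball 0 1" "F1 j ` ball 0 1 \<subseteq> core.Om (kk j) ts" "F1 j 0 = p j"
    "F2 j holomorphic_on ball 0 1" "F2 j ` ball 0 1 \<subseteq> core.Om (kk j) ts" "F2 j 0 = cnj (p j)" for j
    using P[of j] unfolding P_def by blast+
  let ?e = "\<epsilon> / 2"
  have f1: "finite {j. \<not> (\<forall>z. cmod z \<le> \<sigma> \<longrightarrow> dist (F1 j z) (F1 j 0) < ?e)}"
  proof (rule shrinking_discs_cofinite[OF _ _ _ \<sigma>])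
    show "cmod (F1 j z) \<le> 10" if "cmod z < 1" for j z
    proof -
      have "F1 j z \<in> F1 j ` ball 0 1" using that by (intro imageI) simp
      then show ?thesis using F(2)[of j] Om[of "F1 j z" j] by fastforce
    qed
    show "finite {j. F1 i 0 \<in> F1 j ` ball 0 1}" for i
      by (rule finite_subset[OF _ av[OF pV(1)[of i]]]) (unfold F(3), intro Collect_mono impI, erule subsetD[OF F(2)])
  qed (use \<epsilon> F in simp_all)
  have f2: "finite {j. \<not> (\<forall>z. cmod z \<le> \<sigma> \<longrightarrow> dist (F2 j z) (F2 j 0) < ?e)}"
  proof (rule shrinking_discs_cofinite[OF _ _ _ \<sigma>])
    show "cmod (F2 j z) \<le> 10" if "cmod z < 1" for j z
    proof -
      have "F2 j z \<in> F2 j ` ball 0 1" using that by (intro imageI) simp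
      then show ?thesis using F(5)[of j] Om[of "F2 j z" j] by fastforce
    qed
    show "finite {j. F2 i 0 \<in> F2 j ` ball 0 1}" for i
      by (rule finite_subset[OF _ av[OF pV(2)[of i]]]) (unfold F(6), intro Collect_mono impI, erule subsetD[OF F(5)])
  qed (use \<epsilon> F in simp_all)
  obtain j where "j \<notin> {j. \<not> (\<forall>z. cmod z \<le> \<sigma> \<longrightarrow> dist (F1 j z) (F1 j 0) < ?e)} \<union> {j. \<not> (\<forall>z. cmod z \<le> \<sigma> \<longrightarrow> dist (F2 j z) (F2 j 0) < ?e)}"
    using ex_new_if_finite[OF infinite_UNIV_nat finite_UnI[OF f1 f2]] by blast
  then have j: "dist (F1 j z) (p j) < ?e" "dist (F2 j z) (cnj (p j)) < ?e" if "cmod z \<le> \<sigma>" for z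
    using that unfolding F(3,6) by blast+
  have near: "cmod (t - p j) < ?e \<or> cmod (t - cnj (p j)) < ?e"
    if t: "t \<in> core.Om (kk j) ts" "cmod (orb t (KK j) - of_real x0) \<le> x0 - 1/50" for t
  proof -
    obtain z where "cmod z \<le> \<sigma>" "F1 j z = t \<or> F2 j z = t" using P[of j] t unfolding P_def by blast
    then show ?thesis using j[of z] by (auto simp: dist_norm)
  qed
  \<comment> \<open>The real parameter itself has its value in the smaller disc, so it is near one
    of the two centres and, by symmetry, near both.\<close>
  have "cmod (of_real ts - p j) < ?e \<or> cmod (of_real ts - cnj (p j)) < ?e"
  proof -
    interpret c: core \<gamma> "kk j" ts by (rule core_of[OF kk ts])
    show ?thesis by (rule near) (use c.ts_in_Om c.orb_ts_in_core in \<open>auto simp: KK_def\<close>)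
  qed
  moreover have "cmod (of_real ts - cnj (p j)) = cmod (of_real ts - p j)"
    using complex_mod_cnj[of "of_real ts - p j"] by simp
  ultimately have "cmod (of_real ts - p j) < ?e" "cmod (of_real ts - cnj (p j)) < ?e" by auto
  then have "cmod (t - of_real ts) < \<epsilon>"
    if t: "t \<in> core.Om (kk j) ts" "cmod (orb t (KK j) - of_real x0) \<le> x0 - 1/50" for t
    using near[OF t] norm_triangle_ineq4[of "t - p j" "of_real ts - p j"]
      norm_triangle_ineq4[of "t - cnj (p j)" "of_real ts - cnj (p j)"] by auto
  then show ?thesis using P[of j] kk[of j] unfolding P_def KK_def by blast
qed

lemma tuned_lands:
  assumes ts: "tuned ts"
  shows "ray_lands_at (T_ble (theta_rot \<gamma>)) (of_real ts)"
  unfolding ray_lands_at_def theta_rot_eq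
proof (rule tendstoI)
  fix \<epsilon> :: real assume \<epsilon>: "0 < \<epsilon>"
  obtain k p where k: "closest_return k" and p: "p \<in> core.Om k ts" "orb p (Suc (Suc k)) = of_real x0" "A (Suc (Suc k)) p = core.e \<gamma> k"
    and near: "\<And>t. t \<in> core.Om k ts \<Longrightarrow> cmod (orb t (Suc (Suc k)) - of_real x0) \<le> x0 - 1/50 \<Longrightarrow> cmod (t - of_real ts) < \<epsilon>"
    using small_core[OF ts \<epsilon>] by blast
  interpret c: core \<gamma> k ts by (rule core_of[OF k ts])
  obtain r1 where r1: "1 < r1" "\<And>r. 1 < r \<Longrightarrow> r \<le> r1 \<Longrightarrow> ray r \<in> c.Om \<and> cmod (orb (ray r) (Suc (Suc k)) - of_real x0) \<le> x0 - 1/50"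
    using c.ray_tail[OF p] by blast
  have "dist (ray r) (of_real ts) < \<epsilon>" if "1 < r" "r < r1" for r
    using near[of "ray r"] r1(2)[of r] that by (simp add: dist_norm)
  then show "\<forall>\<^sub>F r in at_right 1. dist (ray r) (of_real ts) < \<epsilon>"
    unfolding eventually_at_right_field using r1(1) by blast
qed

end

section \<open>Kneading maps of real parameters\<close>

definition rorb :: "real \<Rightarrow> nat \<Rightarrow> real" where "rorb t n = (quad t ^^ n) 0"

lemma rorb_0 [simp]: "rorb t 0 = 0" by (simp add: rorb_def)
lemma rorb_Suc: "rorb t (Suc n) = rorb t n ^ 2 + t" by (simp add: rorb_def quad_def)
lemma rorb_1 [simp]: "rorb t (Suc 0) = t" by (simp add: rorb_Suc)

lemma orb_of_real: "orb (of_real t) n = of_real (rorb t n)"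
  by (induction n) (auto simp: orb_Suc rorb_Suc)

lemma continuous_on_rorb: "continuous_on T (\<lambda>t. rorb t n)"
  by (induction n) (auto simp: rorb_Suc intro!: continuous_intros)

lemma conjugate_orbit: "((\<lambda>x. - quad t (- x)) ^^ n) 0 = - rorb t n"
  by (induction n) (auto simp: rorb_Suc quad_def)

lemma image_segment_quad:
  fixes p q t :: real
  assumes "0 < p" "p \<le> q"
  shows "(\<lambda>x. - quad t (- x)) ` closed_segment p q = closed_segment (- quad t (- p)) (- quad t (- q))"
proof -
  have "(\<lambda>x. - quad t (- x)) ` {p..q} = {- (q ^ 2) - t .. - (p ^ 2) - t}"
  proof (intro equalityI subsetI)
    fix y assume "y \<in> (\<lambda>x. - quad t (- x)) ` {p..q}"
    then obtain u where u: "p \<le> u" "u \<le> q" "y = - (u ^ 2) - t" by (auto simp: quad_def)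
    then have "p ^ 2 \<le> u ^ 2" "u ^ 2 \<le> q ^ 2" using assms by (auto intro!: power_mono)
    then show "y \<in> {- (q ^ 2) - t .. - (p ^ 2) - t}" using u by simp
  next
    fix y assume y: "y \<in> {- (q ^ 2) - t .. - (p ^ 2) - t}"
    define u where "u = sqrt (- y - t)"
    have yp: "p ^ 2 \<le> - y - t" "- y - t \<le> q ^ 2" using y by auto
    then have "0 \<le> - y - t" using zero_le_power2[of p] by linarith
    then have "y = - quad t (- u)" by (simp add: u_def quad_def)
    moreover have "p \<le> u" unfolding u_def by (rule real_le_rsqrt[OF yp(1)])
    moreover have "u \<le> q" unfolding u_def by (rule real_le_lsqrt) (use yp assms in auto)
    ultimately show "y \<in> (\<lambda>x. - quad t (- x)) ` {p..q}" by auto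
  qed
  moreover have "p ^ 2 \<le> q ^ 2" using assms by (intro power_mono) auto
  ultimately show ?thesis using assms by (simp add: closed_segment_eq_real_ivl quad_def)
qed

lemma enumerate_range:
  fixes S :: "nat \<Rightarrow> nat"
  assumes "strict_mono S"
  shows "enumerate (range S) n = S n"
proof -
  have inf: "infinite (range S)" using assms by (simp add: finite_image_iff strict_mono_imp_inj_on)
  show ?thesis
  proof (induction n)
    case 0
    have "(LEAST m. m \<in> range S) = S 0"
      by (rule Least_equality) (use assms in \<open>auto simp: strict_mono_less_eq\<close>)
    then show ?case by (simp add: enumerate_0)
  next
    case (Suc n)
    have "(LEAST m. m \<in> range S \<and> S n < m) = S (Suc n)"
      by (rule Least_equality) (use assms in \<open>auto simp: strict_mono_less_eq strict_mono_less\<close>)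
    then show ?case using enumerate_Suc''[OF inf, of n] Suc by simp
  qed
qed

section \<open>Cutting times and signs of the critical orbit\<close>

context rotation begin

text \<open>Cuts are meant to occur exactly at the indices not of type \<open>Q2\<close>. A zero of
  the orbit is a cut, so \<open>Q1\<close> and \<open>Q3\<close> carry weak inequalities and
  \<open>Q2\<close> a strict one.\<close>

definition signs :: "real \<Rightarrow> nat \<Rightarrow> bool" where
  "signs t n \<longleftrightarrow> (Q1 n \<longrightarrow> 0 \<le> rorb t n) \<and> (Q2 n \<longrightarrow> rorb t n < 0) \<and> (Q3 n \<longrightarrow> rorb t n \<le> 0)"

abbreviation "D' t \<equiv> D (\<lambda>x. - quad t (- x)) 0"

lemma D'_1: "D' t (Suc 0) = closed_segment 0 (- t)" by (simp add: quad_def)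

lemma D'_after_cut:
  assumes "0 \<in> D' t (Suc n)"
  shows "D' t (Suc (Suc n)) = closed_segment (- rorb t (Suc (Suc n))) (- t)"
proof -
  have "D' t (Suc (Suc n)) = closed_segment (((\<lambda>x. - quad t (- x)) ^^ Suc (Suc n)) 0) (- quad t (- 0))"
    by (simp only: D.simps assms not_True_eq_False if_False)
  then show ?thesis unfolding conjugate_orbit by (simp add: quad_def)
qed

text \<open>After a cut the interval joins the current orbit value to the critical value, so a sign
  decides about the next cut. An index of type \<open>Q2\<close> follows a cut and adds one step
  without a cut; the image interval then has the negative endpoint \<open>- (t ^ 2 + t)\<close>, and
  again the sign of the other endpoint decides.\<close>

lemma cut_iff_signs:
  assumes t: "t < - 1" and n: "1 \<le> n" and before: "\<And>m. 1 \<le> m \<Longrightarrow> m < n \<Longrightarrow> 0 \<in> D' t m \<longleftrightarrow> \<not> Q2 m"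
  shows "(0 \<in> D' t n \<longleftrightarrow> \<not> Q2 n) \<longleftrightarrow> signs t n"
proof -
  have c2: "0 < t ^ 2 + t"
  proof -
    have "t ^ 2 + t = t * (t + 1)" by (simp add: power2_eq_square algebra_simps)
    then show ?thesis using t by (simp add: mult_neg_neg)
  qed
  consider "n = 1" | m where "n = Suc (Suc m)" "\<not> Q2 (Suc m)" | m where "n = Suc (Suc m)" "Q2 (Suc m)"
  proof -
    have "n = 1 \<or> n = Suc (Suc (n - 2))" using n by linarith
    then show thesis using that(1) that(2,3)[of "n - 2"] by blast
  qed
  then show ?thesis
  proof cases
    case 1
    then show ?thesis using t Q3_1 type_disjoint unfolding D'_1 signs_def
      by (auto simp: closed_segment_eq_real_ivl D'_1)
  next
    case 2
    then have "0 \<in> D' t (Suc m)" using before[of "Suc m"] by simp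
    then have "D' t n = closed_segment (- rorb t n) (- t)" using D'_after_cut[of t m] 2 by simp
    then have "0 \<in> D' t n \<longleftrightarrow> 0 \<le> rorb t n" using t by (auto simp: closed_segment_eq_real_ivl)
    moreover have "\<not> Q3 n" using not_Q2_Suc 2 by blast
    then have "Q1 n \<longleftrightarrow> \<not> Q2 n" using type_cases type_disjoint by blast
    ultimately show ?thesis using \<open>\<not> Q3 n\<close> unfolding signs_def by auto
  next
    case 3
    have "m \<noteq> 0" using 3(2) Q3_1 type_disjoint(3) by metis
    then obtain l where l: "m = Suc l" using not0_implies_Suc by blast
    have "\<not> Q2 (Suc l)" using Q2_Suc[of "Suc l"] 3 l type_disjoint by auto
    then have "0 \<in> D' t (Suc l)" using before[of "Suc l"] 3 l by simp
    then have Dm: "D' t (Suc m) = closed_segment (- rorb t (Suc m)) (- t)" using D'_after_cut[of t l] l by simp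
    have n0: "0 \<notin> D' t (Suc m)" using before[of "Suc m"] 3 by simp
    then have neg: "rorb t (Suc m) < 0"
      using t unfolding Dm by (auto simp: closed_segment_eq_real_ivl not_le split: if_splits)
    have "D' t n = (\<lambda>x. - quad t (- x)) ` closed_segment (- rorb t (Suc m)) (- t)" using 3 n0 Dm by simp
    also have "\<dots> = closed_segment (- rorb t n) (- (t ^ 2 + t))"
    proof -
      have q: "- quad t (- (- rorb t (Suc m))) = - rorb t n" "- quad t (- (- t)) = - (t ^ 2 + t)"
        using 3(1) rorb_Suc[of t "Suc m"] by (simp_all add: quad_def)
      have "(\<lambda>x. - quad t (- x)) ` closed_segment p (- t) = closed_segment (- quad t (- p)) (- quad t (- (- t)))"
        if "0 < p" for p
      proof (cases "p \<le> - t")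
        case False
        then have "(\<lambda>x. - quad t (- x)) ` closed_segment (- t) p = closed_segment (- quad t (- (- t))) (- quad t (- p))"
          using t by (intro image_segment_quad) auto
        then show ?thesis by (simp only: closed_segment_commute)
      qed (use image_segment_quad that in blast)
      from this[of "- rorb t (Suc m)"] show ?thesis using neg unfolding q by simp
    qed
    finally have "0 \<in> D' t n \<longleftrightarrow> rorb t n \<le> 0" using c2 by (auto simp: closed_segment_eq_real_ivl)
    moreover have "Q3 n" using Q2_Suc 3 by blast
    ultimately show ?thesis using type_disjoint unfolding signs_def by auto
  qed
qed

lemma cuts_iff_signs:
  assumes "t < - 1"
  shows "cutting_times (\<lambda>x. - quad t (- x)) 0 = {n. 1 \<le> n \<and> \<not> Q2 n} \<longleftrightarrow> (\<forall>n\<ge>1. signs t n)"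
proof -
  have "(\<forall>n\<ge>1. 0 \<in> D' t n \<longleftrightarrow> \<not> Q2 n) \<longleftrightarrow> (\<forall>n\<ge>1. signs t n)"
  proof
    assume "\<forall>n\<ge>1. signs t n"
    have "0 \<in> D' t n \<longleftrightarrow> \<not> Q2 n" if "1 \<le> n" for n
      using that
    proof (induction n rule: less_induct)
      case (less n)
      then show ?case using cut_iff_signs[OF assms less.prems] \<open>\<forall>n\<ge>1. signs t n\<close> by blast
    qed
    then show "\<forall>n\<ge>1. 0 \<in> D' t n \<longleftrightarrow> \<not> Q2 n" by blast
  qed (use cut_iff_signs[OF assms] in blast)
  then show ?thesis unfolding cutting_times_def by blast
qed

section \<open>Cutting times of the rotation\<close>

text \<open>The cutting times in closed form: \<open>Q_rot\<close> takes only the values 0 and 1,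
  and the first two cutting times are 1 and 2, so the increments
  \<open>Suc (Q_rot \<gamma> j)\<close> telescope.\<close>

definition Sk :: "nat \<Rightarrow> nat" where "Sk j = Suc (j + nat \<lfloor>real j * omega \<gamma>\<rfloor>)"

lemma omega_bounds: "0 < omega \<gamma>" "omega \<gamma> < 1" using pos half by (auto simp: omega_def field_simps)

lemma Q_rot_cases: "Q_rot \<gamma> j = 0 \<or> Q_rot \<gamma> j = 1"
proof -
  have "real j * omega \<gamma> = (real j - 1) * omega \<gamma> + omega \<gamma>" by (simp add: algebra_simps)
  then have "\<lfloor>real j * omega \<gamma>\<rfloor> \<le> \<lfloor>(real j - 1) * omega \<gamma>\<rfloor> + 1" using omega_bounds by linarith
  then show ?thesis unfolding Q_rot_def by linarith
qed

lemma Sk_0: "Sk 0 = 1" by (simp add: Sk_def)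

lemma Sk_1: "Sk (Suc 0) = 2" using omega_bounds by (simp add: Sk_def) 

lemma Sk_Suc: "Sk (Suc j) = Sk j + Suc (Q_rot \<gamma> (Suc j))"
proof -
  have "0 \<le> \<lfloor>real j * omega \<gamma>\<rfloor>" using omega_bounds by simp
  moreover have "\<lfloor>real j * omega \<gamma>\<rfloor> \<le> \<lfloor>real (Suc j) * omega \<gamma>\<rfloor>"
    using omega_bounds by (intro floor_mono mult_right_mono) auto
  ultimately show ?thesis by (simp add: Sk_def Q_rot_def nat_diff_distrib)
qed

lemma strict_mono_Sk: "strict_mono Sk"
  unfolding strict_mono_Suc_iff Sk_Suc by simp

text \<open>A Beatty sequence argument. With \<open>n = Suc m\<close>, the floor \<open>h\<close>
  counts the indices of type \<open>Q2\<close> before \<open>n\<close> and \<open>j = m - h\<close>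
  the others; \<open>h\<close> is also the floor of \<open>j * omega \<gamma>\<close> exactly when
  the position of \<open>n\<close> is below \<open>1 - \<gamma>\<close>.\<close>

lemma range_Sk: "range Sk = {n. 1 \<le> n \<and> \<not> Q2 n}"
proof (intro equalityI subsetI)
  fix n assume "n \<in> range Sk"
  then obtain j where n: "n = Sk j" by blast
  define m where "m = n - 1"
  define h where "h = \<lfloor>real m * \<gamma>\<rfloor>"
  have m: "int m - int j = \<lfloor>real j * omega \<gamma>\<rfloor>" using omega_bounds by (simp add: m_def n Sk_def)
  then have "real_of_int (int m - int j) \<le> real j * omega \<gamma>" "real j * omega \<gamma> < real_of_int (int m - int j) + 1"
    by linarith+
  then have "(real m - real j) * (1 - \<gamma>) \<le> real j * \<gamma>" "real j * \<gamma> < (real m - real j + 1) * (1 - \<gamma>)"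
    using half by (simp_all add: omega_def field_simps)
  then have b: "real m - real j \<le> real m * \<gamma>" "real j < (real m + 1) * (1 - \<gamma>)" by (simp_all add: algebra_simps)
  from b(1) have "int m - int j \<le> h" unfolding h_def by (simp add: le_floor_iff)
  then have "real m - real j \<le> real_of_int h" by linarith
  then have "real m * \<gamma> - real_of_int h < 1 - \<gamma>" using b(2) by (simp add: algebra_simps)
  then have "x n < 1 - \<gamma>" by (simp add: x_def frac_def h_def m_def n Sk_def)
  then show "n \<in> {n. 1 \<le> n \<and> \<not> Q2 n}" by (simp add: Q2_def n Sk_def)
next
  fix n assume n: "n \<in> {n. 1 \<le> n \<and> \<not> Q2 n}"
  define m where "m = n - 1"
  define h where "h = \<lfloor>real m * \<gamma>\<rfloor>"
  have nm: "n = Suc m" using n by (simp add: m_def)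
  have h0: "0 \<le> h" using pos by (simp add: h_def)
  have "real m * \<gamma> \<le> real m" using half pos by (simp add: mult_left_le)
  then have hm: "h \<le> int m" unfolding h_def by linarith
  define j where "j = nat (int m - h)"
  have j: "real j = real m - real_of_int h" using hm by (simp add: j_def)
  have "real m * \<gamma> - real_of_int h < 1 - \<gamma>" using n by (simp add: Q2_def x_def frac_def h_def m_def not_le)
  then have "real j * \<gamma> < (real_of_int h + 1) * (1 - \<gamma>)" unfolding j by (simp add: algebra_simps)
  moreover have "real_of_int h \<le> real m * \<gamma>" unfolding h_def by linarith
  then have "real_of_int h * (1 - \<gamma>) \<le> real j * \<gamma>" unfolding j by (simp add: algebra_simps)
  ultimately have "real_of_int h \<le> real j * omega \<gamma>" "real j * omega \<gamma> < real_of_int h + 1"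
    using half by (simp_all add: omega_def field_simps)
  then have "\<lfloor>real j * omega \<gamma>\<rfloor> = h" by linarith
  then have "Sk j = n" using hm h0 by (simp add: Sk_def nm j_def)
  then show "n \<in> range Sk" by blast
qed

text \<open>For a unimodal map in this range the first two cutting times are 1 and 2. Since
  \<open>Q_rot\<close> takes only the values 0 and 1, they determine all further cutting times
  recursively.\<close>

lemma kneading_iff:
  assumes t: "- 2 \<le> t" "t < - 1"
  shows "quad_has_kneading_map t (Q_rot \<gamma>) \<longleftrightarrow>
    unimodal (- beta t) (beta t) (\<lambda>x. - quad t (- x)) 0 \<and> (\<forall>n\<ge>1. signs t n)"
proof -
  let ?f = "\<lambda>x. - quad t (- x)"
  let ?C = "cutting_times ?f 0"
  have "infinite ?C \<and> (\<forall>k\<ge>1. cutting_time ?f 0 k - cutting_time ?f 0 (k - 1) = cutting_time ?f 0 (Q_rot \<gamma> k)) \<longleftrightarrow> ?C = range Sk"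
    if "unimodal (- beta t) (beta t) ?f 0"
  proof
    assume h: "infinite ?C \<and> (\<forall>k\<ge>1. cutting_time ?f 0 k - cutting_time ?f 0 (k - 1) = cutting_time ?f 0 (Q_rot \<gamma> k))"
    then have inf: "infinite ?C" by blast
    have d1: "0 \<in> D' t (Suc 0)" using t unfolding D'_1 by (simp add: closed_segment_eq_real_ivl)
    have "0 \<in> D' t (Suc (Suc 0))"
    proof -
      have "0 < t * (t + 1)" using t by (simp add: mult_neg_neg)
      then show ?thesis unfolding D'_after_cut[OF d1] using t
        by (simp add: closed_segment_eq_real_ivl rorb_Suc power2_eq_square algebra_simps)
    qed
    then have in12: "1 \<in> ?C" "2 \<in> ?C" using d1 by (auto simp: cutting_times_def numeral_2_eq_2)
    have ge1: "1 \<le> n" if "n \<in> ?C" for n using that by (simp add: cutting_times_def)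
    have e0: "enumerate ?C 0 = 1"
      unfolding enumerate_0 by (rule Least_equality) (use in12 ge1 in auto)
    have e1: "enumerate ?C (Suc 0) = 2"
      unfolding enumerate_Suc''[OF inf] e0 by (rule Least_equality) (use in12 in auto)
    have "enumerate ?C j = Sk j" for j
    proof (induction j)
      case (Suc j)
      have "enumerate ?C (Suc j) - enumerate ?C j = enumerate ?C (Q_rot \<gamma> (Suc j))"
        using h unfolding cutting_time_def by (metis diff_Suc_1 le_add1 plus_1_eq_Suc)
      also have "\<dots> = Suc (Q_rot \<gamma> (Suc j))" using Q_rot_cases[of "Suc j"] e0 e1 by auto
      finally show ?case using enumerate_step[OF inf, of j] Suc Sk_Suc[of j] by linarith
    qed (use e0 Sk_0 in simp)
    then have "enumerate ?C = Sk" by blast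
    then show "?C = range Sk" using range_enumerate[OF inf] by simp
  next
    assume C: "?C = range Sk"
    have "infinite (range Sk)" using strict_mono_Sk by (simp add: finite_image_iff strict_mono_imp_inj_on)
    moreover have ct: "cutting_time ?f 0 = Sk"
      unfolding cutting_time_def C using enumerate_range[OF strict_mono_Sk] by blast
    moreover have "Sk j - Sk (j - 1) = Sk (Q_rot \<gamma> j)" if "1 \<le> j" for j
      using Sk_Suc[of "j - 1"] Q_rot_cases[of j] Sk_0 Sk_1 that by auto
    ultimately show "infinite ?C \<and> (\<forall>k\<ge>1. cutting_time ?f 0 k - cutting_time ?f 0 (k - 1) = cutting_time ?f 0 (Q_rot \<gamma> k))"
      using C by simp
  qed
  then show ?thesis unfolding quad_has_kneading_map_def has_kneading_map_def cuts_iff_signs[OF t(2), symmetric] range_Sk[symmetric]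
    using t by auto
qed

text \<open>After a value near 0 at a type other than \<open>Q2\<close> the next two values are near
  \<open>t\<close> and \<open>v = t ^ 2 + t > 0\<close>, while the types force the second to be
  nonpositive. This bounds \<open>v\<close> by four times the square of the value. At index 2 the
  value is \<open>v\<close> itself, which bounds \<open>v\<close> from below, and then the same
  estimate bounds all the other values.\<close>

lemma signs_imp_tuned:
  assumes t: "- 2 \<le> t" "t < - 1" and s: "\<And>n. 1 \<le> n \<Longrightarrow> signs t n"
  shows "tuned t"
proof -
  define v where "v = t ^ 2 + t"
  have "v = t * (t + 1)" by (simp add: v_def power2_eq_square algebra_simps)
  then have v0: "0 < v" using t by (simp add: mult_neg_neg)
  have away: "v \<le> 4 * rorb t n ^ 2" if n: "1 \<le> n" "\<not> Q2 n" "\<bar>rorb t n\<bar> \<le> 1/30" for n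
  proof (rule ccontr)
    assume less: "\<not> v \<le> 4 * rorb t n ^ 2"
    define u where "u = rorb t n ^ 2"
    have u: "0 \<le> u" "u \<le> 1/900"
    proof -
      have "\<bar>rorb t n\<bar> ^ 2 \<le> (1/30) ^ 2" using n(3) by (rule power_mono) simp
      then show "u \<le> 1/900" by (simp add: u_def power2_eq_square)
    qed (simp add: u_def)
    have r1: "rorb t (Suc n) = u + t" by (simp add: rorb_Suc u_def)
    then have "rorb t (Suc n) < 0" using u t by linarith
    then have "\<not> Q1 (Suc n)" using s[of "Suc n"] by (auto simp: signs_def)
    moreover have "\<not> Q3 (Suc n)" using not_Q2_Suc n(2) by blast
    ultimately have "Q2 (Suc n)" using type_cases by blast
    then have "rorb t (Suc (Suc n)) \<le> 0" using Q2_Suc s[of "Suc (Suc n)"] by (auto simp: signs_def)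
    moreover have "rorb t (Suc (Suc n)) = v + 2 * (t * u) + u ^ 2"
      unfolding rorb_Suc[of t "Suc n"] r1 v_def by (simp add: power2_eq_square algebra_simps)
    moreover have "- 2 * u \<le> t * u" using t u by (intro mult_right_mono) auto
    ultimately show False using less[folded u_def] zero_le_power2[of u] by linarith
  qed
  have v30: "1/30 < v"
  proof (rule ccontr)
    assume n: "\<not> 1/30 < v"
    have "rorb t 2 = v" by (simp add: rorb_Suc v_def numeral_2_eq_2)
    moreover have "\<not> Q2 2" using Q1_2 type_disjoint by (auto simp: numeral_2_eq_2)
    ultimately have "v \<le> 4 * v ^ 2" using away[of 2] n v0 by simp
    moreover have "v * v \<le> v * (1/30)" using n v0 by (intro mult_left_mono) auto
    ultimately show False using v0 by (simp add: power2_eq_square)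
  qed
  have "1/30 < \<bar>rorb t n\<bar>" if n: "1 \<le> n" "\<not> Q2 n" for n
  proof (rule ccontr)
    assume a: "\<not> 1/30 < \<bar>rorb t n\<bar>"
    then have "\<bar>rorb t n\<bar> ^ 2 \<le> (1/30) ^ 2" by (intro power_mono) auto
    then have "rorb t n ^ 2 \<le> 1/900" by (simp add: power2_eq_square)
    then show False using away[OF n] a v30 by simp
  qed
  then have "sep (1/30) n (orb (of_real t) n)" if "1 \<le> n" for n
    using s[OF that] that type_disjoint unfolding sep_def signs_def orb_of_real Re_complex_of_real by fastforce
  then show ?thesis using t s unfolding tuned_def orb_of_real Re_complex_of_real by (auto simp: signs_def)
qed

lemma kneading_lands:
  assumes "quad_has_kneading_map t (Q_rot \<gamma>)"
  shows "ray_lands_at (T_ble (theta_rot \<gamma>)) (of_real t)"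
proof -
  have t: "- 2 \<le> t" "t < - 1" using assms by (auto simp: quad_has_kneading_map_def)
  then show ?thesis using assms kneading_iff[OF t] by (intro tuned_lands signs_imp_tuned) auto
qed

section \<open>Existence of a parameter with the prescribed kneading map\<close>

text \<open>Backward iteration from the value 0 at time \<open>k\<close>, with branches given by the
  types; entry \<open>j\<close> stands for time \<open>k - j\<close>. The cut-off at 0 makes it
  continuous in every parameter and turns out to be inactive at the parameter found by the
  intermediate value theorem.\<close>

primrec pullback :: "nat \<Rightarrow> real \<Rightarrow> nat \<Rightarrow> real" where
  "pullback k t 0 = 0"
| "pullback k t (Suc j) = (if Q1 (k - Suc j) then 1 else - 1) * sqrt (max 0 (pullback k t j - t))"

lemma continuous_on_pullback: "continuous_on T (\<lambda>t. pullback k t j)"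
  by (induction j) (auto intro!: continuous_intros)

lemma abs_pullback_le:
  assumes "- 2 \<le> t" "t \<le> 0" shows "\<bar>pullback k t j\<bar> \<le> 2"
proof (induction j)
  case (Suc j)
  have "sqrt (max 0 (pullback k t j - t)) \<le> sqrt (2 ^ 2)" using Suc assms by (intro real_sqrt_le_mono) auto
  then show ?case by (simp add: abs_mult)
qed simp

text \<open>Closed conditions, with the sign at type \<open>Q2\<close> relaxed, so that they survive
  a limit of parameters.\<close>

definition weak_signs :: "real \<Rightarrow> nat \<Rightarrow> bool" where
  "weak_signs t n \<longleftrightarrow> (if Q1 n then 0 \<le> rorb t n else rorb t n \<le> 0)"

text \<open>A parameter that equals its own pulled back value at time 1 has a critical orbit that
  returns to 0 at time \<open>k\<close> with the prescribed signs.\<close>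

lemma superattracting:
  assumes k: "closest_return k"
  shows "\<exists>t\<in>{-2..-5/4}. \<forall>i\<in>{1..k}. weak_signs t i"
proof -
  define z where "z i t = pullback k t (k - i)" for i t
  have zk: "z k t = 0" for t by (simp add: z_def)
  have z: "z i t = (if Q1 i then 1 else - 1) * sqrt (max 0 (z (Suc i) t - t))" if "i < k" for i t
  proof -
    have "k - i = Suc (k - Suc i)" "k - Suc (k - Suc i) = i" using that by auto
    then show ?thesis unfolding z_def by simp
  qed
  have sq: "z i t ^ 2 = max 0 (z (Suc i) t - t)" if "i < k" for i t using z[OF that, of t] by (simp add: power_mult_distrib)
  have sg: "if Q1 i then 0 \<le> z i t else z i t \<le> 0" if "i \<le> k" for i t
    using z[of i t] zk[of t] that by (cases "i = k") auto
  have k3: "3 \<le> k" by (rule closest_return_ge_3[OF k])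
  have n1: "\<not> Q1 (Suc 0)" using Q3_1 type_disjoint by blast
  have "\<exists>t\<ge>-2. t \<le> -5/4 \<and> z 1 t - t = 0"
  proof (rule IVT2')
    show "continuous_on {-2..-5/4} (\<lambda>t. z 1 t - t)" unfolding z_def by (intro continuous_intros continuous_on_pullback)
    show "0 \<le> z 1 (-2) - (-2)" using abs_pullback_le[of "-2" k "k - 1"] unfolding z_def by linarith
    \<comment> \<open>The estimate is carried back from time 3: \<open>z 3 t \<ge> -23/20\<close>
      gives \<open>z 2 t \<ge> 5/16\<close>, and \<open>5/16 + 5/4 = (5/4) ^ 2\<close> then gives
      \<open>z 1 t \<le> -5/4\<close>.\<close>
    define t :: real where "t = -5/4"
    have z3: "-23/20 \<le> z 3 t"
    proof (cases "k = 3 \<or> Q1 3")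
      case True then show ?thesis using zk[of t] sg[of 3 t] k3 by auto
    next
      case False
      have "\<not> Q3 3" using not_Q2_Suc[of 2] Q1_2 type_disjoint by (auto simp: numeral_2_eq_2 numeral_3_eq_3)
      then have "Q2 3" using False type_cases by blast
      then have "Q3 4" using Q2_Suc[of 3] by simp
      then have "z 4 t \<le> 0" using sg[of 4 t] type_disjoint(2)[of 4] k3 False by auto
      then have "z 3 t ^ 2 \<le> 5/4" using sq[of 3 t] k3 False by (simp add: t_def max_def)
      also have "\<dots> \<le> (23/20) ^ 2" by (simp add: power2_eq_square)
      finally have "\<bar>z 3 t\<bar> \<le> 23/20" by (rule power2_le_imp_le[of "\<bar>z 3 t\<bar>", simplified]) simp
      then show ?thesis by linarith
    qed
    have "5/16 \<le> z 2 t"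
    proof -
      have "(5/16) ^ 2 \<le> max 0 (z 3 t - t)" using z3 by (simp add: t_def power2_eq_square)
      then have "5/16 \<le> sqrt (max 0 (z 3 t - t))" by (rule real_le_rsqrt)
      then show ?thesis using z[of 2 t] k3 Q1_2 by (simp add: numeral_2_eq_2 numeral_3_eq_3)
    qed
    then have "(5/4) ^ 2 \<le> max 0 (z 2 t - t)" by (simp add: t_def power2_eq_square)
    then have "5/4 \<le> sqrt (max 0 (z 2 t - t))" by (rule real_le_rsqrt)
    then have "z 1 t \<le> t" using z[of 1 t] k3 n1 by (simp add: numeral_2_eq_2 t_def)
    then show "z 1 (-5/4) - (-5/4) \<le> 0" by (simp add: t_def)
  qed simp
  then obtain t where t: "- 2 \<le> t" "t \<le> -5/4" "z 1 t = t" by auto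
  define y where "y i = z i t" for i
  have y1: "y 1 = t" and yk: "y k = 0" using t zk by (auto simp: y_def)
  have ysq: "y i ^ 2 = max 0 (y (Suc i) - t)" if "i < k" for i using sq[OF that] by (simp add: y_def)
  have ysg: "Q1 i \<Longrightarrow> 0 \<le> y i" "\<not> Q1 i \<Longrightarrow> y i \<le> 0" if "i \<le> k" for i using sg[OF that, of t] by (auto simp: y_def)
  have full: "y (Suc i) = y i ^ 2 + t" if "i < k" "y i \<noteq> 0" for i
    using ysq[OF that(1)] that(2) by (simp add: max_def split: if_splits)
  have ge: "y (Suc i) \<le> y i ^ 2 + t" if "i < k" for i using ysq[OF that] by linarith
  \<comment> \<open>A cut-off at \<open>i\<close> would put the next value below
    \<open>y 1 = t\<close>. This is possible only at type \<open>Q3\<close>, hence after type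
    \<open>Q2\<close>. The order of the two pulled back orbits then follows their common types up to
    the first mismatch, where \<open>Q2\<close> against \<open>Q1\<close> contradicts the
    signs.\<close>
  have no_trunc: "t \<le> y (Suc i)" if i: "1 \<le> i" "i < k" for i
  proof (rule ccontr)
    assume "\<not> t \<le> y (Suc i)"
    then have lt: "y (Suc i) < y 1" using y1 by simp
    have ik: "Suc i < k"
    proof (rule ccontr)
      assume "\<not> Suc i < k"
      then have "Suc i = k" using i by simp
      then show False using lt yk y1 t by simp
    qed
    have "\<not> Q1 (Suc i)" using ysg(1)[of "Suc i"] lt y1 t ik by fastforce
    have "\<not> Q2 (Suc i)"
    proof
      assume "Q2 (Suc i)"
      then have "y (Suc (Suc i)) \<le> 0" using Q2_Suc type_disjoint(2) ysg(2)[of "Suc (Suc i)"] ik by auto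
      moreover have "y (Suc (Suc i)) = y (Suc i) ^ 2 + t" using full[OF ik] lt y1 t by auto
      moreover have "(- t) ^ 2 \<le> (- y (Suc i)) ^ 2" using lt y1 t by (intro power_mono) auto
      moreover have "(-5/4) * t \<le> t * t" using t by (intro mult_right_mono_neg) auto
      ultimately show False using t by (simp add: power2_eq_square)
    qed
    then have "Q3 (Suc i)" using \<open>\<not> Q1 (Suc i)\<close> type_cases by blast
    then have "Q2 i" using not_Q2_Suc by blast
    then obtain j where j: "1 \<le> j" "i + j \<le> k" "\<And>l. 1 \<le> l \<Longrightarrow> l < j \<Longrightarrow> same_type (i + l) l" "Q2 (i + j)" "Q1 j"
      using first_mismatch[OF k i] by metis
    have "if Q3 l then y (i + l) < y l else y l < y (i + l)" if "1 \<le> l" "l \<le> j" for l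
      using that
    proof (induction l rule: dec_induct)
      case base then show ?case using lt Q3_1 by simp
    next
      case (step l)
      have lk: "i + l < k" "l < k" using step j by auto
      have st: "same_type (i + l) l" using j(3) step by simp
      have IH: "if Q3 l then y (i + l) < y l else y l < y (i + l)" using step by simp
      have sgl: "Q1 l \<Longrightarrow> 0 \<le> y l" "\<not> Q1 l \<Longrightarrow> y l \<le> 0" "\<not> Q1 l \<Longrightarrow> y (i + l) \<le> 0"
        using ysg[of l] ysg[of "i + l"] lk st by (auto simp: same_type_def)
      consider "Q1 l" | "Q2 l" | "Q3 l" using type_cases by blast
      then show ?case
      proof cases
        case 1
        then have "0 \<le> y l" "y l < y (i + l)" using sgl IH type_disjoint by auto
        then have "y l ^ 2 < y (i + l) ^ 2" "y (i + l) \<noteq> 0" by (auto intro!: power_strict_mono)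
        then have "y (Suc l) < y (Suc (i + l))" using ge[OF lk(2)] full[OF lk(1)] by linarith
        moreover have "\<not> Q3 (Suc l)" using 1 not_Q2_Suc type_disjoint by blast
        ultimately show ?thesis by simp
      next
        case 2
        then have o: "y l < y (i + l)" "y (i + l) \<le> 0" using sgl IH type_disjoint by auto
        then have "(- y (i + l)) ^ 2 < (- y l) ^ 2" by (intro power_strict_mono; simp)
        moreover have "y l \<noteq> 0" using o by linarith
        ultimately have "y (Suc (i + l)) < y (Suc l)" using ge[OF lk(1)] full[OF lk(2)] by simp
        then show ?thesis using Q2_Suc[OF 2] by simp
      next
        case 3
        then have o: "y (i + l) < y l" "y l \<le> 0" using sgl IH type_disjoint by auto
        then have "(- y l) ^ 2 < (- y (i + l)) ^ 2" by (intro power_strict_mono; simp)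
        moreover have "y (i + l) \<noteq> 0" using o by linarith
        ultimately have "y (Suc l) < y (Suc (i + l))" using ge[OF lk(2)] full[OF lk(1)] by simp
        moreover have "\<not> Q3 (Suc l)" using 3 not_Q2_Suc type_disjoint by blast
        ultimately show ?thesis by simp
      qed
    qed
    from this[of j] have "y j < y (i + j)" using j type_disjoint by auto
    moreover have "0 \<le> y j" using ysg(1)[of j] j by simp
    moreover have "y (i + j) \<le> 0" using ysg(2)[of "i + j"] j type_disjoint by blast
    ultimately show False by simp
  qed
  have "y i = rorb t i" if "1 \<le> i" "i \<le> k" for i
    using that
  proof (induction i rule: dec_induct)
    case (step i) 
    then have "y i ^ 2 = y (Suc i) - t" using ysq[of i] no_trunc[of i] by simp
    then show ?case using step by (simp add: rorb_Suc)
  qed (use y1 in simp)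
  then have "weak_signs t i" if "i \<in> {1..k}" for i using ysg[of i] that by (auto simp: weak_signs_def)
  then show ?thesis using t(1,2) by (intro bexI[of _ t]) auto
qed

text \<open>Superattracting parameters satisfy arbitrarily many weak sign conditions, and
  compactness gives a parameter satisfying all of them. Zeros of its orbit at type \<open>Q2\<close>
  have to be excluded afterwards, because a limit could create them.\<close>

lemma kneading_exists: "\<exists>t. quad_has_kneading_map t (Q_rot \<gamma>)"
proof -
  define T where "T n = {t \<in> {-2..-5/4}. \<forall>i\<in>{1..n}. weak_signs t i}" for n
  have "(\<Inter>n. T n) \<noteq> {}"
  proof (rule compact_nest)
    show "compact (T n)" for n
    proof -
      have "closed {t. weak_signs t i}" for i unfolding weak_signs_def
        by (cases "Q1 i") (auto intro!: closed_Collect_le continuous_intros continuous_on_rorb)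
      then have "closed (\<Inter>i\<in>{1..n}. {t. weak_signs t i})" by blast
      moreover have "T n = {-2..-5/4} \<inter> (\<Inter>i\<in>{1..n}. {t. weak_signs t i})" by (auto simp: T_def)
      ultimately show ?thesis by (simp add: compact_Int_closed)
    qed
    show "T n \<noteq> {}" for n
    proof -
      obtain k where k: "n < k" "closest_return k" using closest_return_exists by blast
      obtain t where "t \<in> {-2..-5/4}" "\<forall>i\<in>{1..k}. weak_signs t i" using superattracting[OF k(2)] by blast
      then have "t \<in> T n" using k(1) by (auto simp: T_def)
      then show ?thesis by blast
    qed
    show "T n \<subseteq> T m" if "m \<le> n" for m n using that by (auto simp: T_def)
  qed
  then obtain t where tT: "\<And>n. t \<in> T n" by blast
  have t: "- 2 \<le> t" "t \<le> -5/4" using tT[of 0] by (auto simp: T_def)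
  have w: "weak_signs t n" if "1 \<le> n" for n using tT[of n] that by (auto simp: T_def)
  have c2: "0 < rorb t 2"
  proof -
    have "0 < t * (t + 1)" using t by (simp add: mult_neg_neg)
    then show ?thesis by (simp add: rorb_Suc numeral_2_eq_2 power2_eq_square algebra_simps)
  qed
  \<comment> \<open>After a zero come \<open>t\<close> and \<open>t ^ 2 + t > 0\<close>, which the
    types following \<open>Q1\<close> or \<open>Q3\<close> exclude.\<close>
  have nonzero: "rorb t n \<noteq> 0" if n: "1 \<le> n" "\<not> Q2 n" for n
  proof
    assume 0: "rorb t n = 0"
    have "rorb t (Suc n) = t" using 0 by (simp add: rorb_Suc)
    then have "\<not> Q1 (Suc n)" using w[of "Suc n"] t by (auto simp: weak_signs_def)
    then have "Q2 (Suc n)" using not_Q2_Suc n(2) type_cases by blast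
    then have "\<not> Q1 (Suc (Suc n))" using Q2_Suc type_disjoint by blast
    then have "rorb t (Suc (Suc n)) \<le> 0" using w[of "Suc (Suc n)"] by (simp add: weak_signs_def)
    moreover have "rorb t (Suc (Suc n)) = rorb t 2" using 0 by (simp add: rorb_Suc numeral_2_eq_2)
    ultimately show False using c2 by simp
  qed
  have neg: "rorb t n < 0" if n: "1 \<le> n" "Q2 n" for n
  proof (rule ccontr)
    assume "\<not> rorb t n < 0"
    moreover have "\<not> Q1 n" using n type_disjoint by blast
    ultimately have 0: "rorb t n = 0" using w[of n] n by (simp add: weak_signs_def)
    \<comment> \<open>A zero at type \<open>Q2\<close> makes the orbit repeat from its beginning, so
      by \<open>first_mismatch\<close> one value would occur at both types \<open>Q2\<close> and
      \<open>Q1\<close> and vanish at type \<open>Q1\<close>.\<close>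
    have per: "rorb t (n + j) = rorb t j" for j using 0 by (induction j) (auto simp: rorb_Suc)
    obtain k where k: "n < k" "closest_return k" using closest_return_exists by blast
    obtain j where j: "1 \<le> j" "Q2 (n + j)" "Q1 j" using first_mismatch[OF k(2) n(1) k(1) n(2)] by metis
    then have "rorb t j \<le> 0" using w[of "n + j"] type_disjoint(1)[of "n + j"] per[of j] by (auto simp: weak_signs_def)
    moreover have "0 \<le> rorb t j" using w[of j] j by (simp add: weak_signs_def)
    ultimately show False using nonzero[of j] j type_disjoint by auto
  qed
  have s: "signs t n" if "1 \<le> n" for n
    using w[OF that] neg[OF that] type_disjoint unfolding signs_def weak_signs_def by (auto split: if_splits)
  have t2: "- 2 < t"
  proof (rule ccontr)
    assume "\<not> - 2 < t"
    then have "t = - 2" using t by simp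
    then have 2: "rorb t (Suc (Suc n)) = 2" for n by (induction n) (auto simp: rorb_Suc)
    obtain k where k: "closest_return k" using closest_return_exists by blast
    have "rorb t k < 0" using neg[of k] closest_return_types(1)[OF k] closest_return_ge_3[OF k] by simp
    moreover have "k = Suc (Suc (k - 2))" using closest_return_ge_3[OF k] by simp
    then have "rorb t k = 2" using 2[of "k - 2"] by simp
    ultimately show False by simp
  qed
  have "unimodal (- beta t) (beta t) (\<lambda>x. - quad t (- x)) 0"
  proof -
    define b where "b = beta t"
    have d: "0 \<le> 1 - 4 * t" using t by simp
    have bb: "b ^ 2 = b - t"
    proof -
      have "sqrt (1 - 4 * t) ^ 2 = 1 - 4 * t" using d by simp
      then show ?thesis unfolding b_def beta_def by (simp add: power2_eq_square field_simps)
    qed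
    have "1/2 \<le> b" using real_sqrt_ge_zero[OF d] unfolding b_def beta_def by simp
    have tb: "- t \<le> b"
    proof -
      have "(- 2 * t - 1) ^ 2 \<le> 1 - 4 * t"
        using mult_right_mono_neg[of "-2" t t] t by (simp add: power2_eq_square algebra_simps)
      then have "- 2 * t - 1 \<le> sqrt (1 - 4 * t)" by (rule real_le_rsqrt)
      then show ?thesis unfolding b_def beta_def by simp
    qed
    define f :: "real \<Rightarrow> real" where "f = (\<lambda>u. - (u ^ 2) - t)"
    have f: "(\<lambda>u. - quad t (- u)) = f" by (simp add: f_def quad_def fun_eq_iff)
    have im: "f ` {- b..b} \<subseteq> {- b..b}"
    proof
      fix y assume "y \<in> f ` {- b..b}"
      then obtain u where u: "u \<in> {- b..b}" "y = - (u ^ 2) - t" unfolding f_def by blast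
      then have "\<bar>u\<bar> ^ 2 \<le> b ^ 2" by (intro power_mono) auto
      then have "u ^ 2 \<le> b ^ 2" by simp
      then show "y \<in> {- b..b}" using u(2) bb tb zero_le_power2[of u] unfolding atLeastAtMost_iff by linarith
    qed
    have mono: "strict_mono_on {- b..0} f" 
    proof (rule strict_mono_onI)
      fix r s :: real assume "r \<in> {- b..0}" "s \<in> {- b..0}" "r < s"
      then have "(- s) ^ 2 < (- r) ^ 2" by (intro power_strict_mono) auto
      then show "f r < f s" by (simp add: f_def)
    qed
    have anti: "strict_antimono_on {0..b} f"
    proof (rule monotone_onI)
      fix r s :: real assume "r \<in> {0..b}" "s \<in> {0..b}" "r < s"
      then have "r ^ 2 < s ^ 2" by (intro power_strict_mono) auto
      then show "f r > f s" by (simp add: f_def)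
    qed
    have c3: "rorb t 3 < rorb t 2"
    proof -
      have "rorb t 3 - rorb t 2 = t ^ 2 * (t * (t + 2))"
        by (simp add: rorb_Suc numeral_2_eq_2 numeral_3_eq_3 power2_eq_square algebra_simps)
      moreover have "t ^ 2 * (t * (t + 2)) < 0" using t t2 by (simp add: mult_pos_neg mult_neg_pos)
      ultimately show ?thesis by simp
    qed
    have orbit: "(f ^^ n) 0 = - rorb t n" for n using conjugate_orbit[where t = t and n = n] unfolding f .
    have cont: "continuous_on {- b..b} f" unfolding f_def by (intro continuous_intros)
    have "f ` {- b, b} \<subseteq> {- b, b}" "f 0 = - t" using bb by (simp_all add: f_def)
    then show ?thesis
      unfolding unimodal_def b_def[symmetric] f orbit
      using \<open>1/2 \<le> b\<close> im mono anti c2 c3 t cont by (intro conjI) (assumption | linarith)+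
  qed
  then have "quad_has_kneading_map t (Q_rot \<gamma>)" using t s by (subst kneading_iff) simp_all
  then show ?thesis by blast
qed

end

theorem proposition3p11:
  fixes \<gamma> :: real
  assumes "0 < \<gamma>" and "\<gamma> < 1 / 2" and "\<gamma> \<notin> \<rat>"
  shows "t_ble \<gamma> = t_rot \<gamma> \<and> quad_has_kneading_map (t_ble \<gamma>) (Q_rot \<gamma>)"
proof -
  interpret rotation \<gamma> by unfold_locales (use assms in auto)
  obtain t where t: "quad_has_kneading_map t (Q_rot \<gamma>)" using kneading_exists by blast
  have unique: "of_real s = (of_real t :: complex)" if "ray_lands_at (T_ble (theta_rot \<gamma>)) (of_real s)" for s :: real
    by (rule tendsto_unique[OF trivial_limit_at_right_real that[unfolded ray_lands_at_def]
          kneading_lands[OF t, unfolded ray_lands_at_def]])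
  have "t_rot \<gamma> = t"
    unfolding t_rot_def
  proof (rule the_equality)
    show "t \<in> {-2..-1} \<and> quad_has_kneading_map t (Q_rot \<gamma>)" using t by (auto simp: quad_has_kneading_map_def)
    show "s = t" if "s \<in> {-2..-1} \<and> quad_has_kneading_map s (Q_rot \<gamma>)" for s
      using unique[OF kneading_lands[of s]] that by simp
  qed
  moreover have "t_ble \<gamma> = t"
    unfolding t_ble_def
  proof (rule the_equality)
    show "ray_lands_at (T_ble (theta_rot \<gamma>)) (of_real t)" by (rule kneading_lands[OF t])
    show "s = t" if "ray_lands_at (T_ble (theta_rot \<gamma>)) (of_real s)" for s :: real
      using unique[OF that] by simp
  qed
  ultimately show ?thesis using t by simp
qed

end
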